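(* Fix an integer $i>0$. Let $r\ge 3$, let $p=\alpha n^{-(r-1)}$ where $\alpha=\alpha(n)=\Theta(1)$ satisfies $\sup_n\alpha(n)<\alpha^*_r$, and let $F\in\mathcal F^r_{n,p}$ be a random formula. Condition on the event $\mathcal E_i$ that $F$ is unsatisfiable and contains no minimal unsatisfiable formula (MUF) $F'$ with $\operatorname{ex}(F')<\operatorname{ex}_i$. Then, with (conditional) probability $1-O(1/n)$ as $n\to\infty$, both of the following hold: (i) $F$ contains a unique MUF $F_0$ (i.e. exactly one subformula of $F$ is a MUF); (ii) $F_0\in\mathcal F_i$ (up to isomorphism), i.e. $\operatorname{ex}(F_0)=\operatorname{ex}_i$. Moreover, (iii) for each $F'\in\mathcal F_i$, the conditional probability given $\mathcal E_i$ satisfies $$\Pr(F_0\cong F')\sim \frac1Z\cdot\frac{\alpha^{e(F')}2^{|F'|}}{|\operatorname{aut}F'|},\qquad\text{where } Z=\sum_{F'\in\mathcal F_i}\frac{\alpha^{e(F')}2^{|F'|}}{|\operatorname{aut}F'|},$$ the sum being over isomorphism classes in $\mathcal F_i$, and $\sim$ meaning that the ratio of the two sides tends to $1$ as $n\to\infty$.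
   Context: An $r$-SAT formula consists of a finite set of variables and a set of clauses, each clause consisting of $r$ literals (variables or negated variables) on $r$ distinct variables of the formula. On $n$ variables there are $2^r\binom nr$ possible clauses. It is satisfiable if some True/False assignment of the variables makes at least one literal in each clause True. The random formula $\mathcal F^r_{n,p}$ has $n$ variables, each of the $2^r\binom nr$ possible clauses being present independently with probability $p$. For a formula $H$: the order $|H|$ is the number of variables, the size $e(H)$ is the number of clauses, and the excess is $\operatorname{ex}(H)=(r-1)e(H)-|H|$. Two formulae of the same order $m$ are isomorphic ($\cong$) if one is obtained from the other by a bijection of variables together with flipping the signs of some variables (the acting group has $2^m m!$ elements); $\operatorname{aut}H$ is the group of isomorphisms from $H$ to itself. $H$ is a (proper) subformula of $F$ if its variable and clause sets are subsets of those of $F$ (at least one containment being proper). $F$ contains $H$ if some subformula of $F$ is isomorphic to $H$. A minimal unsatisfiable formula (MUF) is an unsatisfiable formula with no unsatisfiable proper subformula. The values of excess attained by $r$-SAT MUFs are positive integers, listed as $\operatorname{ex}_1<\operatorname{ex}_2<\cdots$; $\mathcal F_s$ denotes the (finite) set of isomorphism classes of MUFs $F'$ with $\operatorname{ex}(F')=\operatorname{ex}_s$. The pure literal threshold is $\displaystyle\alpha^*_r=\min_{y>0}\frac{(r-1)!\,y}{2^{r-1}(1-e^{-y})^{r-1}}$. *)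

theory Defs
  imports "HOL-Probability.Probability" "HOL-Library.Landau_Symbols"
begin

text \<open>
  A literal is a pair \<open>(x, b)\<close>: the variable \<open>x\<close> if \<open>b\<close> is true, its negation otherwise.
\<close>

type_synonym 'v clause = "('v \<times> bool) set"

datatype 'v formula = Formula (vars: "'v set") (clauses: "'v clause set")

definition possible_clauses :: "nat \<Rightarrow> 'v set \<Rightarrow> 'v clause set" where
  "possible_clauses r V = {C. C \<subseteq> V \<times> UNIV \<and> inj_on fst C \<and> card C = r}"

definition sat_formula :: "nat \<Rightarrow> 'v formula \<Rightarrow> bool" where
  "sat_formula r F \<longleftrightarrow> finite (vars F) \<and> clauses F \<subseteq> possible_clauses r (vars F)"

definition satisfiable :: "'v formula \<Rightarrow> bool" where
  "satisfiable F \<longleftrightarrow> (\<exists>A :: 'v \<Rightarrow> bool. \<forall>C\<in>clauses F. \<exists>(x, b)\<in>C. A x = b)"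

definition excess :: "nat \<Rightarrow> 'v formula \<Rightarrow> int" where
  "excess r F = (int r - 1) * int (card (clauses F)) - int (card (vars F))"

definition subformula :: "nat \<Rightarrow> 'v formula \<Rightarrow> 'v formula \<Rightarrow> bool" where
  "subformula r H F \<longleftrightarrow> sat_formula r H \<and> vars H \<subseteq> vars F \<and> clauses H \<subseteq> clauses F"

definition lit_map :: "('v \<Rightarrow> 'w) \<Rightarrow> 'v set \<Rightarrow> 'v \<times> bool \<Rightarrow> 'w \<times> bool" where
  "lit_map \<pi> S = (\<lambda>(x, b). (\<pi> x, b \<noteq> (x \<in> S)))"

text \<open>
  An isomorphism is a pair \<open>(\<pi>, S)\<close> consisting of a bijection \<open>\<pi>\<close> of the variables and the set \<open>S\<close>
  of variables whose sign is flipped.  Requiring \<open>\<pi>\<close> to be extensional and \<open>S\<close> to consist of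
  variables of \<open>F\<close> makes each isomorphism be counted exactly once, so that \<open>2 ^ m * fact m\<close> pairs
  are available between two variable sets of size \<open>m\<close>.
\<close>

definition isos :: "'v formula \<Rightarrow> 'w formula \<Rightarrow> (('v \<Rightarrow> 'w) \<times> 'v set) set" where
  "isos F G = {(\<pi>, S). \<pi> \<in> extensional (vars F) \<and> bij_betw \<pi> (vars F) (vars G) \<and>
     S \<subseteq> vars F \<and> (\<lambda>C. lit_map \<pi> S ` C) ` clauses F = clauses G}"

definition isomorphic :: "'v formula \<Rightarrow> 'w formula \<Rightarrow> bool" where
  "isomorphic F G \<longleftrightarrow> isos F G \<noteq> {}"

definition aut :: "'v formula \<Rightarrow> (('v \<Rightarrow> 'v) \<times> 'v set) set" where
  "aut F = isos F F"

definition contains_copy :: "nat \<Rightarrow> 'v formula \<Rightarrow> 'w formula \<Rightarrow> bool" where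
  "contains_copy r F H \<longleftrightarrow> (\<exists>G. subformula r G F \<and> isomorphic G H)"

definition muf :: "nat \<Rightarrow> 'v formula \<Rightarrow> bool" where
  "muf r F \<longleftrightarrow> sat_formula r F \<and> \<not> satisfiable F \<and>
     (\<forall>H. subformula r H F \<and> H \<noteq> F \<longrightarrow> satisfiable H)"

definition mufs_in :: "nat \<Rightarrow> 'v formula \<Rightarrow> 'v formula set" where
  "mufs_in r F = {G. subformula r G F \<and> muf r G}"

text \<open>
  Every finite formula has an isomorphic copy with natural numbers as variables, so such formulas
  represent all isomorphism classes.  The levels are indexed from 1, whereas \<^const>\<open>enumerate\<close>
  counts from 0; the excess of a minimal unsatisfiable formula is always positive.
\<close>

definition muf_excess :: "nat \<Rightarrow> nat \<Rightarrow> nat" where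
  "muf_excess r s = enumerate {k. \<exists>F :: nat formula. muf r F \<and> excess r F = int k} (s - 1)"

definition muf_level :: "nat \<Rightarrow> nat \<Rightarrow> nat formula set" where
  "muf_level r s = {F. muf r F \<and> excess r F = int (muf_excess r s)}"

definition muf_classes :: "nat \<Rightarrow> nat \<Rightarrow> nat formula set set" where
  "muf_classes r s =
     muf_level r s // {(F, G). F \<in> muf_level r s \<and> G \<in> muf_level r s \<and> isomorphic F G}"

definition weight :: "real \<Rightarrow> 'v formula \<Rightarrow> real" where
  "weight a F = a ^ card (clauses F) * 2 ^ card (vars F) / real (card (aut F))"

text \<open>The weight is invariant under isomorphism, so any representative of a class may be used.\<close>

definition total_weight :: "nat \<Rightarrow> nat \<Rightarrow> real \<Rightarrow> real" where
  "total_weight r s a = (\<Sum>K\<in>muf_classes r s. weight a (SOME F. F \<in> K))"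

definition random_sat :: "nat \<Rightarrow> nat \<Rightarrow> real \<Rightarrow> nat formula pmf" where
  "random_sat r n p =
     map_pmf (\<lambda>g. Formula {..<n} {C \<in> possible_clauses r {..<n}. g C})
       (Pi_pmf (possible_clauses r {..<n}) False (\<lambda>_. bernoulli_pmf p))"

definition unsat_from_level :: "nat \<Rightarrow> nat \<Rightarrow> nat formula \<Rightarrow> bool" where
  "unsat_from_level r s F \<longleftrightarrow> \<not> satisfiable F \<and>
     \<not> (\<exists>F' :: nat formula. muf r F' \<and> excess r F' < int (muf_excess r s) \<and> contains_copy r F F')"

definition pure_literal_fun :: "nat \<Rightarrow> real \<Rightarrow> real" where
  "pure_literal_fun r y = fact (r - 1) * y / (2 ^ (r - 1) * (1 - exp (- y)) ^ (r - 1))"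

definition pure_literal_threshold :: "nat \<Rightarrow> real" where
  "pure_literal_threshold r = (INF y\<in>{0<..}. pure_literal_fun r y)"

text \<open>For \<open>r \<ge> 3\<close> the infimum is a minimum.\<close>

lemma pure_literal_threshold_attained:
  assumes r: "r \<ge> 3"
  shows "\<exists>y>0. pure_literal_threshold r = pure_literal_fun r y \<and>
           (\<forall>z>0. pure_literal_fun r y \<le> pure_literal_fun r z)"
proof -
  define K :: real where "K = fact (r - 1) / 2 ^ (r - 1)"
  define q where "q y = (1 - exp (- y)) ^ (r - 1)" for y :: real
  have K: "K > 0" by (simp add: K_def)
  have f: "pure_literal_fun r y = K * (y / q y)" for y
    by (simp add: pure_literal_fun_def K_def q_def)
  have q0: "q y > 0" if "y > 0" for y using that by (simp add: q_def)
  have q1: "q y \<le> 1" if "y > 0" for y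
    unfolding q_def using that by (intro power_le_one) auto
  have q2: "q y \<le> y\<^sup>2" if "y > 0" "y \<le> 1" for y
  proof -
    have "1 - exp (- y) \<le> y" using exp_ge_add_one_self[of "- y"] by simp
    then have "q y \<le> y ^ (r - 1)"
      unfolding q_def using that by (intro power_mono) auto
    also have "\<dots> \<le> y\<^sup>2" using that r by (intro power_decreasing) auto
    finally show ?thesis .
  qed
  have large: "y / q y \<ge> y" if "y > 0" for y
    using q0[OF that] q1[OF that] that by (simp add: field_simps)
  have small: "y / q y \<ge> 1 / y" if "y > 0" "y \<le> 1" for y
    using q0[OF that(1)] q2[OF that] that by (simp add: field_simps power2_eq_square)
  define d where "d = 1 / q 1"
  have d: "d \<ge> 1" using large[of 1] by (simp add: d_def)
  have "continuous_on {1 / d..d} (\<lambda>y. y / q y)"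
  proof (intro continuous_on_divide continuous_on_id)
    show "continuous_on {1 / d..d} q" unfolding q_def by (intro continuous_intros)
    show "\<forall>y\<in>{1 / d..d}. q y \<noteq> 0"
    proof
      fix y assume "y \<in> {1 / d..d}"
      then have "y \<ge> 1 / d" by simp
      moreover have "1 / d > 0" using d by simp
      ultimately show "q y \<noteq> 0" using q0[of y] by linarith
    qed
  qed
  moreover have one: "1 \<in> {1 / d..d}" using d by simp
  ultimately obtain y where y: "y \<in> {1 / d..d}" "\<And>z. z \<in> {1 / d..d} \<Longrightarrow> y / q y \<le> z / q z"
    using continuous_attains_inf[of "{1 / d..d}" "\<lambda>y. y / q y"] compact_Icc by blast
  have "1 / d > 0" using d by simp
  then have y0: "y > 0" using y(1) by (meson atLeastAtMost_iff less_le_trans)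
  have yd: "y / q y \<le> d" using y(2)[OF one] by (simp add: d_def)
  have min: "y / q y \<le> z / q z" if z: "z > 0" for z
  proof -
    consider "z \<in> {1 / d..d}" | "z > d" | "z < 1 / d" by fastforce
    then show ?thesis
    proof cases
      case 1 then show ?thesis by (rule y(2))
    next
      case 2 then show ?thesis using yd large[OF z] by linarith
    next
      case 3
      have "1 / d \<le> 1" using d by simp
      then have "z \<le> 1" using 3 by linarith
      moreover have "1 / z \<ge> d" using 3 z d by (simp add: field_simps)
      ultimately show ?thesis using yd small[OF z] by linarith
    qed
  qed
  have fmin: "pure_literal_fun r y \<le> pure_literal_fun r z" if "z > 0" for z
    unfolding f using min[OF that] K by (intro mult_left_mono) auto
  have "pure_literal_threshold r = pure_literal_fun r y"
    unfolding pure_literal_threshold_def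
    by (rule cInf_eq_minimum) (use y0 fmin in auto)
  then show ?thesis using y0 fmin by blast
qed

end

theory Submission
  imports Defs "HOL-Real_Asymp.Real_Asymp"
begin

text \<open>
  For a set \<open>Q\<close> of clauses put \<open>ex(Q) = (r - 1) |Q| - |var(Q)|\<close>.  The expected number of clause sets
  of bounded size and excess \<open>K\<close> in the random formula has order \<open>n\<^sup>-\<^sup>K\<close>.  In a minimal unsatisfiable
  formula (MUF) every variable occurs with both signs, so the size of a MUF is bounded in terms of its
  excess, and adding a MUF to a set that does not contain it strictly increases the excess.
  Let \<open>k\<close> be the \<open>i\<close>-th excess.  Two MUFs of excess at most \<open>k\<close>, one of them of excess \<open>k\<close>,
  together have excess greater than \<open>k\<close>, so up to an event of probability \<open>O(n\<^sup>-\<^sup>k\<^sup>-\<^sup>1)\<close> a MUF of excess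
  \<open>k\<close> is the only one, and the theorem follows by counting copies.

  It remains to exclude MUFs of excess at least \<open>K = k + 2\<close>, of whatever size.  Suppose that such a
  MUF \<open>G\<close> has no small clause set of excess at least \<open>K\<close>.  Choose a small set \<open>H\<close> of clauses of \<open>G\<close> whose
  excess cannot be raised by adding \<open>2 t + 1\<close> clauses.  Walking away from \<open>H\<close>, and passing from a
  literal \<open>z\<close> of a clause to a clause containing the negation of \<open>z\<close>, one never closes a cycle
  within \<open>t\<close> steps, since a cycle would raise the excess.  This gives a tree of depth \<open>t\<close> of distinct
  clauses.  By the inequalities of van den Berg--Kesten and Harris, such a tree with a given root
  exists with probability at most the \<open>t\<close>-th iterate at 1 of \<open>q \<mapsto> 1 - exp (- L q\<^sup>r\<^sup>-\<^sup>1)\<close>.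
  Below the pure literal threshold the iterates decay doubly exponentially, so \<open>t = O(log log n)\<close>
  suffices to beat any power of \<open>n\<close>, while \<open>O(log log n)\<close>-element clause sets of excess \<open>K\<close> still
  appear with probability at most \<open>n\<^sup>1\<^sup>-\<^sup>K\<close>.
\<close>

section \<open>Correlation inequalities for random subsets\<close>

definition rsub :: "real \<Rightarrow> 'a set \<Rightarrow> 'a set pmf" where
  "rsub p E = map_pmf (\<lambda>g. {x \<in> E. g x}) (Pi_pmf E False (\<lambda>_. bernoulli_pmf p))"

lemma rsub_empty: "rsub p {} = return_pmf {}"
  by (simp add: rsub_def)

lemma set_rsub: "X \<in> set_pmf (rsub p E) \<Longrightarrow> X \<subseteq> E"
  by (auto simp: rsub_def)

lemma rsub_insert:
  assumes "finite E" "e \<notin> E"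
  shows "rsub p (insert e E) =
    bernoulli_pmf p \<bind> (\<lambda>b. map_pmf (\<lambda>X. if b then insert e X else X) (rsub p E))"
proof -
  have eq: "{x \<in> insert e E. (g(e := b)) x} = (if b then insert e {x\<in>E. g x} else {x\<in>E. g x})"
    for g :: "'a \<Rightarrow> bool" and b
    using assms by auto
  show ?thesis
    unfolding rsub_def Pi_pmf_insert'[OF assms] map_bind_pmf map_return_pmf eq
    by (simp only: map_pmf_def bind_assoc_pmf bind_return_pmf)
qed

text \<open>Conditioning on whether \<open>e\<close> is present. The correlation inequalities below
  are proved by induction on \<open>E\<close> through this recursion.\<close>

lemma prob_rsub_insert:
  assumes "finite E" "e \<notin> E" "0 \<le> p" "p \<le> 1"
  shows "measure_pmf.prob (rsub p (insert e E)) A =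
    (1 - p) * measure_pmf.prob (rsub p E) A + p * measure_pmf.prob (rsub p E) {X. insert e X \<in> A}"
proof -
  have "emeasure (rsub p (insert e E)) A
    = ennreal (measure_pmf.prob (rsub p E) {X. insert e X \<in> A} * p + measure_pmf.prob (rsub p E) A * (1 - p))"
    unfolding rsub_insert[OF assms(1,2)] using assms
    by (simp add: vimage_def) (simp add: measure_pmf.emeasure_eq_measure ennreal_mult ennreal_plus)
  then have "measure_pmf.prob (rsub p (insert e E)) A
    = measure_pmf.prob (rsub p E) {X. insert e X \<in> A} * p + measure_pmf.prob (rsub p E) A * (1 - p)"
    unfolding measure_pmf.emeasure_eq_measure by (subst (asm) ennreal_inj) (use assms in auto)
  then show ?thesis by (simp add: algebra_simps)
qed

section \<open>Increasing events and disjoint occurrence\<close>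

definition upclosed :: "'a set set \<Rightarrow> bool" where
  "upclosed A \<longleftrightarrow> (\<forall>X Y. X \<in> A \<longrightarrow> X \<subseteq> Y \<longrightarrow> Y \<in> A)"

lemma upclosedD: "upclosed A \<Longrightarrow> X \<in> A \<Longrightarrow> X \<subseteq> Y \<Longrightarrow> Y \<in> A"
  by (auto simp: upclosed_def)

lemma upclosedI: "(\<And>X Y. X \<in> A \<Longrightarrow> X \<subseteq> Y \<Longrightarrow> Y \<in> A) \<Longrightarrow> upclosed A"
  by (auto simp: upclosed_def)

lemma upclosed_section:
  assumes "upclosed A"
  shows "upclosed {X. insert e X \<in> A}"
proof (rule upclosedI)
  fix X Y assume "X \<in> {X. insert e X \<in> A}" "X \<subseteq> Y"
  then show "Y \<in> {X. insert e X \<in> A}"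
    using upclosedD[OF assms, of "insert e X" "insert e Y"] by auto
qed

lemma upclosed_UN: "(\<And>j. j \<in> J \<Longrightarrow> upclosed (A j)) \<Longrightarrow> upclosed (\<Union>j\<in>J. A j)"
  by (rule upclosedI) (auto dest: upclosedD)

text \<open>For up-closed events a subset of \<open>X\<close> certifies the event exactly when it is
  itself a member, so the certificates \<open>Y\<close> and \<open>Z\<close> can be asked to lie in
  \<open>A\<close> and \<open>B\<close>.\<close>

definition disj_occ :: "'a set set \<Rightarrow> 'a set set \<Rightarrow> 'a set set" (infixr "\<box>" 70) where
  "A \<box> B = {X. \<exists>Y Z. Y \<subseteq> X \<and> Z \<subseteq> X \<and> Y \<inter> Z = {} \<and> Y \<in> A \<and> Z \<in> B}"

lemma disj_occ_mono: "A \<subseteq> A' \<Longrightarrow> B \<subseteq> B' \<Longrightarrow> A \<box> B \<subseteq> A' \<box> B'"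
  unfolding disj_occ_def by blast

lemma upclosed_disj_occ: "upclosed (A \<box> B)"
proof (rule upclosedI)
  fix X X' assume "X \<in> A \<box> B" "X \<subseteq> X'"
  then obtain Y Z where "Y \<subseteq> X" "Z \<subseteq> X" "Y \<inter> Z = {}" "Y \<in> A" "Z \<in> B" "X \<subseteq> X'"
    by (auto simp: disj_occ_def)
  then have "Y \<subseteq> X' \<and> Z \<subseteq> X' \<and> Y \<inter> Z = {} \<and> Y \<in> A \<and> Z \<in> B" by auto
  then show "X' \<in> A \<box> B" unfolding disj_occ_def mem_Collect_eq by (intro exI)
qed

text \<open>Stated for complements of increasing events, the form in which "no tree starts at any
  clause of this literal" is used later.\<close>

lemma harris:
  assumes "finite E" "0 \<le> p" "p \<le> 1" "upclosed A" "upclosed B"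
  shows "measure_pmf.prob (rsub p E) (- A) * measure_pmf.prob (rsub p E) (- B)
      \<le> measure_pmf.prob (rsub p E) (- A \<inter> - B)"
  using assms(1,4,5)
proof (induction E arbitrary: A B rule: finite_induct)
  case empty
  then show ?case by (simp add: rsub_empty indicator_def)
next
  case (insert e E)
  let ?P = "measure_pmf.prob (rsub p E)"
  let ?s = "\<lambda>A. {X. insert e X \<in> A}"
  define a0 a1 b0 b1 where "a0 = ?P (- A)" "a1 = ?P (- ?s A)" "b0 = ?P (- B)" "b1 = ?P (- ?s B)"
  have s: "{X. insert e X \<in> - A} = - ?s A" for A by auto
  have sub: "A \<subseteq> ?s A" "B \<subseteq> ?s B"
    using upclosedD[OF insert.prems(1) _ subset_insertI] upclosedD[OF insert.prems(2) _ subset_insertI] by auto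
  have le: "a1 \<le> a0" "b1 \<le> b0"
    unfolding a0_a1_b0_b1_def using sub by (auto intro!: measure_pmf.finite_measure_mono)
  have "((1 - p) * a0 + p * a1) * ((1 - p) * b0 + p * b1)
      = (1 - p) * (a0 * b0) + p * (a1 * b1) - p * (1 - p) * ((a0 - a1) * (b0 - b1))"
    by (simp add: algebra_simps)
  also have "\<dots> \<le> (1 - p) * (a0 * b0) + p * (a1 * b1)"
    using le assms by simp
  also have "\<dots> \<le> (1 - p) * ?P (- A \<inter> - B) + p * ?P (- ?s A \<inter> - ?s B)"
    unfolding a0_a1_b0_b1_def using assms insert.prems
    by (intro add_mono mult_left_mono insert.IH upclosed_section) auto
  also have "- ?s A \<inter> - ?s B = ?s (- A \<inter> - B)" by auto
  finally show ?case
    unfolding prob_rsub_insert[OF insert.hyps(1,2) assms(2,3)] a0_a1_b0_b1_def s .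
qed

lemma harris_INT:
  assumes "finite E" "0 \<le> p" "p \<le> 1" "finite J" "\<And>j. j \<in> J \<Longrightarrow> upclosed (A j)"
  shows "(\<Prod>j\<in>J. 1 - measure_pmf.prob (rsub p E) (A j)) \<le> 1 - measure_pmf.prob (rsub p E) (\<Union>j\<in>J. A j)"
  using assms(4,5)
proof (induction J rule: finite_induct)
  case empty
  then show ?case by simp
next
  case (insert j J)
  let ?P = "measure_pmf.prob (rsub p E)"
  have c: "1 - ?P A = ?P (- A)" for A
    using measure_pmf.prob_compl[of A "rsub p E"] by (simp add: Compl_eq_Diff_UNIV)
  have "(\<Prod>j\<in>insert j J. 1 - ?P (A j)) \<le> ?P (- A j) * ?P (- (\<Union>j\<in>J. A j))"
    using insert.IH[OF insert.prems] insert.hyps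
      unfolding c[symmetric] by (simp del: Compl_UN) (intro mult_left_mono; simp)
  also have "\<dots> \<le> ?P (- A j \<inter> - (\<Union>j\<in>J. A j))"
    using insert.prems assms by (intro harris upclosed_UN) auto
  also have "- A j \<inter> - (\<Union>j\<in>J. A j) = - (\<Union>j\<in>insert j J. A j)" by auto
  finally show ?case by (simp only: c)
qed

text \<open>For \<open>p \<le> 1/2\<close> the coefficient \<open>1 - 2 p\<close> that arises in the induction on \<open>E\<close> is nonnegative, so that
  the induction hypothesis can be applied to it.\<close>

lemma van_den_Berg_Kesten:
  assumes "finite E" "0 \<le> p" "p \<le> 1/2" "upclosed A" "upclosed B"
  shows "measure_pmf.prob (rsub p E) (A \<box> B)
      \<le> measure_pmf.prob (rsub p E) A * measure_pmf.prob (rsub p E) B"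
  using assms(1,4,5)
proof (induction E arbitrary: A B rule: finite_induct)
  case empty
  have "{} \<in> A \<box> B \<Longrightarrow> {} \<in> A \<and> {} \<in> B"
    by (simp add: disj_occ_def)
  then show ?case by (simp add: rsub_empty indicator_def)
next
  case (insert e E)
  let ?P = "measure_pmf.prob (rsub p E)"
  let ?s = "\<lambda>A. {X. insert e X \<in> A}"
  define a0 a1 b0 b1 where "a0 = ?P A" "a1 = ?P (?s A)" "b0 = ?P B" "b1 = ?P (?s B)"
  note ab = this
  have sub: "A \<subseteq> ?s A" "B \<subseteq> ?s B"
    using upclosedD[OF insert.prems(1) _ subset_insertI] upclosedD[OF insert.prems(2) _ subset_insertI] by auto
  have le: "a0 \<le> a1" "b0 \<le> b1"
    unfolding ab using sub by (auto intro!: measure_pmf.finite_measure_mono)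
  have IH: "?P (A \<box> B) \<le> a0 * b0" "?P (?s A \<box> B) \<le> a1 * b0" "?P (A \<box> ?s B) \<le> a0 * b1"
    unfolding ab using insert.prems by (auto intro!: insert.IH upclosed_section)
  \<comment> \<open>The certificates are disjoint, so at most one of them uses
    \<open>e\<close>.\<close>
  have "?s (A \<box> B) \<subseteq> (?s A \<box> B) \<union> (A \<box> ?s B)"
  proof
    fix X assume "X \<in> ?s (A \<box> B)"
    then obtain Y Z where YZ: "Y \<subseteq> insert e X" "Z \<subseteq> insert e X" "Y \<inter> Z = {}" "Y \<in> A" "Z \<in> B"
      by (auto simp: disj_occ_def)
    show "X \<in> (?s A \<box> B) \<union> (A \<box> ?s B)"
    proof (cases "e \<in> Y")
      case True
      then have "Y - {e} \<subseteq> X" "Z \<subseteq> X" "(Y - {e}) \<inter> Z = {}" "Y - {e} \<in> ?s A" "Z \<in> B"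
        using YZ by (auto simp: insert_absorb)
      then show ?thesis unfolding disj_occ_def by blast
    next
      case False
      then have "Z - {e} \<subseteq> X" "Y \<subseteq> X" "Y \<inter> (Z - {e}) = {}" "Y \<in> A" "Z - {e} \<in> ?s B"
        using YZ upclosedD[OF insert.prems(2), of Z "insert e (Z - {e})"] by auto
      then show ?thesis unfolding disj_occ_def by blast
    qed
  qed
  then have "?P (?s (A \<box> B)) \<le> ?P ((?s A \<box> B) \<union> (A \<box> ?s B))"
    by (intro measure_pmf.finite_measure_mono) auto
  also have "\<dots> = ?P (?s A \<box> B) + ?P (A \<box> ?s B) - ?P ((?s A \<box> B) \<inter> (A \<box> ?s B))"
    using measure_Un3[of "?s A \<box> B" "measure_pmf (rsub p E)" "A \<box> ?s B"]
    by (simp add: fmeasurable_def measure_pmf.emeasure_eq_measure)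
  also have "\<dots> \<le> a1 * b0 + a0 * b1 - ?P (A \<box> B)"
  proof -
    \<comment> \<open>Keeping the intersection instead of a plain union bound is essential: the
      subtracted term is what produces the coefficient \<open>1 - 2 * p\<close>.\<close>
    have "?P (A \<box> B) \<le> ?P ((?s A \<box> B) \<inter> (A \<box> ?s B))"
      using disj_occ_mono[OF sub(1) order_refl] disj_occ_mono[OF order_refl sub(2)]
      by (intro measure_pmf.finite_measure_mono) auto
    then show ?thesis using IH by linarith
  qed
  finally have s: "?P (?s (A \<box> B)) \<le> a1 * b0 + a0 * b1 - ?P (A \<box> B)" .
  have "(1 - p) * ?P (A \<box> B) + p * ?P (?s (A \<box> B))
      \<le> (1 - p) * ?P (A \<box> B) + p * (a1 * b0 + a0 * b1 - ?P (A \<box> B))"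
    using s assms by (intro add_mono mult_left_mono) auto
  also have "\<dots> = (1 - 2 * p) * ?P (A \<box> B) + p * (a1 * b0 + a0 * b1)"
    by (simp add: algebra_simps)
  also have "\<dots> \<le> (1 - 2 * p) * (a0 * b0) + p * (a1 * b0 + a0 * b1)"
    using IH(1) assms by (intro add_right_mono mult_left_mono) auto
  \<comment> \<open>The added nonnegative term completes the expression to the product of the two
    averaged probabilities.\<close>
  also have "\<dots> \<le> (1 - 2 * p) * (a0 * b0) + p * (a1 * b0 + a0 * b1) + p\<^sup>2 * ((a1 - a0) * (b1 - b0))"
    using le by simp
  also have "\<dots> = ((1 - p) * a0 + p * a1) * ((1 - p) * b0 + p * b1)"
    by (simp add: algebra_simps power2_eq_square)
  finally show ?case
    unfolding prob_rsub_insert[OF insert.hyps(1,2) \<open>0 \<le> p\<close> order_trans[OF \<open>p \<le> 1/2\<close>, of 1, simplified]] ab .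
qed

section \<open>Disjoint occurrence of finitely many events\<close>

definition disj_occ_family :: "'i set \<Rightarrow> ('i \<Rightarrow> 'a set set) \<Rightarrow> 'a set set" where
  "disj_occ_family J A =
    {X. \<exists>Y. disjoint_family_on Y J \<and> (\<forall>j\<in>J. Y j \<subseteq> X \<and> Y j \<in> A j)}"

lemma upclosed_disj_occ_family: "upclosed (disj_occ_family J A)"
  by (rule upclosedI) (simp add: disj_occ_family_def, meson order_trans)

text \<open>Splitting off one index, the union of the remaining certificates is a single certificate
  for the remaining family, so the binary inequality iterates.\<close>

lemma van_den_Berg_Kesten_family:
  assumes "finite E" "0 \<le> p" "p \<le> 1/2" "finite J" "\<And>j. j \<in> J \<Longrightarrow> upclosed (A j)"
  shows "measure_pmf.prob (rsub p E) (disj_occ_family J A) \<le> (\<Prod>j\<in>J. measure_pmf.prob (rsub p E) (A j))"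
  using assms(4,5)
proof (induction J rule: finite_induct)
  case empty
  then show ?case by simp
next
  case (insert j J)
  let ?P = "measure_pmf.prob (rsub p E)"
  have "disj_occ_family (insert j J) A \<subseteq> A j \<box> disj_occ_family J A"
  proof
    fix X assume "X \<in> disj_occ_family (insert j J) A"
    then obtain Y where Y: "disjoint_family_on Y (insert j J)" "\<And>i. i \<in> insert j J \<Longrightarrow> Y i \<subseteq> X \<and> Y i \<in> A i"
      by (auto simp: disj_occ_family_def)
    have "disjoint_family_on Y J" using Y(1) by (auto simp: disjoint_family_on_def)
    then have "(\<Union>i\<in>J. Y i) \<in> disj_occ_family J A" using Y(2) by (auto simp: disj_occ_family_def)
    moreover have "Y j \<inter> (\<Union>i\<in>J. Y i) = {}"
      using Y(1) insert.hyps by (auto simp: disjoint_family_on_def)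
    moreover have "(\<Union>i\<in>J. Y i) \<subseteq> X" "Y j \<subseteq> X" "Y j \<in> A j" using Y(2) by auto
    ultimately show "X \<in> A j \<box> disj_occ_family J A" unfolding disj_occ_def by blast
  qed
  then have "?P (disj_occ_family (insert j J) A) \<le> ?P (A j \<box> disj_occ_family J A)"
    by (intro measure_pmf.finite_measure_mono) auto
  also have "\<dots> \<le> ?P (A j) * ?P (disj_occ_family J A)"
    using insert.prems assms by (intro van_den_Berg_Kesten upclosed_disj_occ_family) auto
  also have "\<dots> \<le> ?P (A j) * (\<Prod>j\<in>J. ?P (A j))"
    using insert by (intro mult_left_mono) auto
  finally show ?case using insert.hyps by simp
qed

lemma prob_rsub_superset:
  assumes "finite E" "0 \<le> p" "p \<le> 1" "Q \<subseteq> E"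
  shows "measure_pmf.prob (rsub p E) {X. Q \<subseteq> X} = p ^ card Q"
  using assms(1,4)
proof (induction E arbitrary: Q rule: finite_induct)
  case empty
  then show ?case by (simp add: rsub_empty)
next
  case (insert e E)
  note rec = prob_rsub_insert[OF insert.hyps(1,2) assms(2,3)]
  show ?case
  proof (cases "e \<in> Q")
    case True
    have "measure_pmf.prob (rsub p E) {X. Q \<subseteq> X} = 0"
      using True insert.hyps by (auto simp: measure_pmf_zero_iff disjoint_iff dest: set_rsub)
    moreover have "{X. insert e X \<in> {X. Q \<subseteq> X}} = {X. Q - {e} \<subseteq> X}" by auto
    moreover have "card Q = Suc (card (Q - {e}))"
      using True insert by (metis card.remove finite.insertI finite_subset)
    ultimately show ?thesis
      using insert.IH[of "Q - {e}"] insert.prems unfolding rec by auto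
  next
    case False
    then have "{X. insert e X \<in> {X. Q \<subseteq> X}} = {X. Q \<subseteq> X}" by auto
    then show ?thesis using insert.IH[of Q] insert.prems False
      unfolding rec by (simp add: subset_insert algebra_simps)
  qed
qed

section \<open>Trees of clauses and the pure literal threshold\<close>

definition neg :: "'v \<times> bool \<Rightarrow> 'v \<times> bool" where
  "neg l = (fst l, \<not> snd l)"

text \<open>Disjoint occurrence makes all clauses of the tree distinct, so the van den Berg--Kesten
  inequality bounds its probability by a product over the branches. Depth 0 is the sure event,
  whence the iteration starts at 1.\<close>

primrec tree_event :: "'v clause set \<Rightarrow> nat \<Rightarrow> 'v \<times> bool \<Rightarrow> 'v clause set set" where
  "tree_event E 0 l = UNIV"
| "tree_event E (Suc t) l = (\<Union>C\<in>{C\<in>E. l \<in> C}. {X. C \<in> X} \<box> disj_occ_family (C - {l}) (\<lambda>z. tree_event E t (neg z)))"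

lemma upclosed_tree_event: "upclosed (tree_event E t l)"
proof (cases t)
  case 0
  then show ?thesis by (simp add: upclosed_def)
next
  case (Suc u)
  then show ?thesis unfolding Suc tree_event.simps by (intro upclosed_UN upclosed_disj_occ)
qed

text \<open>A union bound over the clauses containing \<open>l\<close> would be too weak to reach the threshold; Harris'
  inequality treats these clauses as if they were independent.\<close>

lemma prob_tree_event_Suc:
  fixes E :: "'v clause set"
  assumes E: "finite E" "\<And>C. C \<in> E \<Longrightarrow> card C = r" and r: "r > 0" and p: "0 \<le> p" "p \<le> 1/2"
    and q: "q \<le> 1" and N: "card {C\<in>E. l \<in> C} \<le> N"
    and IH: "\<And>l. measure_pmf.prob (rsub p E) (tree_event E t l) \<le> q"
  shows "measure_pmf.prob (rsub p E) (tree_event E (Suc t) l) \<le> 1 - (1 - p * q ^ (r - 1)) ^ N"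
proof -
  let ?P = "measure_pmf.prob (rsub p E)"
  let ?A = "\<lambda>C. {X. C \<in> X} \<box> disj_occ_family (C - {l}) (\<lambda>z. tree_event E t (neg z))"
  have q0: "0 \<le> q" using IH[of undefined] measure_nonneg order_trans by blast
  have x: "0 \<le> p * q ^ (r - 1)" "p * q ^ (r - 1) \<le> 1"
    using p q q0 mult_mono[of p 1 "q ^ (r - 1)" 1] by (auto simp: power_le_one)
  have A: "?P (?A C) \<le> p * q ^ (r - 1)" if C: "C \<in> E" "l \<in> C" for C
  proof -
    have finC: "finite C" using E(2)[OF C(1)] r card_ge_0_finite by force
    \<comment> \<open>A single clause contributes \<open>p\<close> for its presence and one factor
      \<open>q\<close> for each of its \<open>r - 1\<close> other literals.\<close>
    have "?P (?A C) \<le> ?P {X. C \<in> X} * ?P (disj_occ_family (C - {l}) (\<lambda>z. tree_event E t (neg z)))"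
      using E p by (intro van_den_Berg_Kesten upclosed_disj_occ_family) (auto simp: upclosed_def)
    also have "?P {X. C \<in> X} = p"
      using prob_rsub_superset[of E p "{C}"] E p C by simp
    also have "?P (disj_occ_family (C - {l}) (\<lambda>z. tree_event E t (neg z)))
        \<le> (\<Prod>z\<in>C-{l}. ?P (tree_event E t (neg z)))"
      using E p finC by (intro van_den_Berg_Kesten_family upclosed_tree_event) auto
    also have "\<dots> \<le> (\<Prod>z\<in>C-{l}. q)" by (intro prod_mono) (auto intro: IH)
    also have "\<dots> = q ^ (r - 1)" using finC C E(2)[OF C(1)] by simp
    finally show ?thesis using p by (simp add: mult_left_mono)
  qed
  have "(1 - p * q ^ (r - 1)) ^ N \<le> (1 - p * q ^ (r - 1)) ^ card {C\<in>E. l \<in> C}"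
    using x N by (intro power_decreasing) auto
  also have "\<dots> = (\<Prod>C\<in>{C\<in>E. l \<in> C}. 1 - p * q ^ (r - 1))" by simp
  also have "\<dots> \<le> (\<Prod>C\<in>{C\<in>E. l \<in> C}. 1 - ?P (?A C))"
    using A x by (intro prod_mono) auto
  also have "\<dots> \<le> 1 - ?P (\<Union>C\<in>{C\<in>E. l \<in> C}. ?A C)"
    using E p by (intro harris_INT upclosed_disj_occ) auto
  finally show ?thesis by simp
qed

text \<open>The Poisson version of the recursion for trees: \<open>L\<close> plays the role of the
  mean number of clauses containing a literal, and each such clause survives when its
  \<open>r - 1\<close> other branches do.\<close>

definition survival_map :: "real \<Rightarrow> nat \<Rightarrow> real \<Rightarrow> real" where
  "survival_map L r q = 1 - exp (- L * q ^ (r - 1))"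

lemma survival_iter_bounds:
  assumes "L \<ge> 0"
  shows "0 \<le> (survival_map L r ^^ t) 1" "(survival_map L r ^^ t) 1 \<le> 1"
proof -
  have "0 \<le> (survival_map L r ^^ t) 1 \<and> (survival_map L r ^^ t) 1 \<le> 1"
    using assms by (induction t) (auto simp: survival_map_def)
  then show "0 \<le> (survival_map L r ^^ t) 1" "(survival_map L r ^^ t) 1 \<le> 1" by auto
qed

text \<open>A converse to \<open>1 - x \<le> exp (- x)\<close> for small \<open>x\<close>, at the
  price of a factor \<open>1 + \<eta>\<close> in the exponent. It holds since
  \<open>(1 - x) * (1 + (1 + \<eta>) * x)\<close> is at least 1.\<close>

lemma one_minus_ge_exp:
  fixes x \<eta> :: real
  assumes "0 \<le> x" "x < 1" "x * (1 + \<eta>) \<le> \<eta>"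
  shows "exp (- (1 + \<eta>) * x) \<le> 1 - x"
proof -
  have "1 \<le> 1 + x * (\<eta> - x * (1 + \<eta>))" using assms by simp
  also have "\<dots> = (1 - x) * (1 + (1 + \<eta>) * x)" by (simp add: algebra_simps)
  also have "\<dots> \<le> (1 - x) * exp ((1 + \<eta>) * x)"
    using assms exp_ge_add_one_self by (intro mult_left_mono) auto
  finally have "exp (- (1 + \<eta>) * x) * 1 \<le> exp (- (1 + \<eta>) * x) * ((1 - x) * exp ((1 + \<eta>) * x))"
    by (intro mult_left_mono) auto
  also have "\<dots> = (1 - x) * exp (- (1 + \<eta>) * x + (1 + \<eta>) * x)"
    unfolding exp_add by (simp add: mult_ac)
  also have "- (1 + \<eta>) * x + (1 + \<eta>) * x = 0" by (simp add: algebra_simps)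
  finally show ?thesis by simp
qed

text \<open>Induction on the depth; the slack \<open>\<eta>\<close> in \<open>L\<close> absorbs the
  passage from \<open>(1 - x) ^ N\<close> to an exponential.\<close>

lemma prob_tree_event:
  fixes E :: "'v clause set"
  assumes E: "finite E" "\<And>C. C \<in> E \<Longrightarrow> card C = r" and r: "r > 0" and p: "0 \<le> p" "p \<le> 1/2"
    and N: "\<And>l. card {C\<in>E. l \<in> C} \<le> N"
    and \<eta>: "p * (1 + \<eta>) \<le> \<eta>" "\<eta> \<ge> 0" and L: "(1 + \<eta>) * (p * N) \<le> L"
  shows "measure_pmf.prob (rsub p E) (tree_event E t l) \<le> (survival_map L r ^^ t) 1"
proof (induction t arbitrary: l)
  case 0
  then show ?case by simp
next
  case (Suc t)
  define q where "q = (survival_map L r ^^ t) 1"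
  have L0: "L \<ge> 0" using L \<eta> p by (meson mult_nonneg_nonneg of_nat_0_le_iff order_trans add_nonneg_nonneg zero_le_one)
  have q: "0 \<le> q" "q \<le> 1" unfolding q_def using survival_iter_bounds[OF L0] by auto
  define x where "x = p * q ^ (r - 1)"
  have q1: "0 \<le> q ^ (r - 1)" "q ^ (r - 1) \<le> 1" using q by (auto simp: power_le_one)
  have x: "0 \<le> x" "x \<le> p" unfolding x_def using p q1 mult_left_mono[of "q ^ (r - 1)" 1 p] by auto
  have "x * (1 + \<eta>) \<le> p * (1 + \<eta>)" using x \<eta> by (intro mult_right_mono) auto
  then have e: "exp (- (1 + \<eta>) * x) \<le> 1 - x"
    using order_trans[OF _ \<eta>(1)] x p by (intro one_minus_ge_exp) auto
  have "(1 + \<eta>) * (p * N) * q ^ (r - 1) \<le> L * q ^ (r - 1)"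
    using L q1 by (intro mult_right_mono) auto
  then have "exp (- L * q ^ (r - 1)) \<le> exp (real N * (- (1 + \<eta>) * x))"
    by (simp add: x_def algebra_simps)
  also have "\<dots> = exp (- (1 + \<eta>) * x) ^ N" by (rule exp_of_nat_mult)
  also have "\<dots> \<le> (1 - x) ^ N" using e by (intro power_mono) auto
  finally have "1 - (1 - x) ^ N \<le> survival_map L r q" by (simp add: survival_map_def)
  moreover have "measure_pmf.prob (rsub p E) (tree_event E (Suc t) l) \<le> 1 - (1 - x) ^ N"
    unfolding x_def by (rule prob_tree_event_Suc[OF E r p q(2) N]) (auto simp: q_def Suc.IH)
  ultimately show ?case by (simp add: q_def)
qed

text \<open>The iterates decrease to a fixed point. A positive fixed point \<open>q0\<close> would
  contradict \<open>sub\<close> at \<open>y = L * q0 ^ (r - 1)\<close>, where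
  \<open>1 - exp (- y) = q0\<close> turns both sides into \<open>y\<close>.\<close>

lemma survival_iter_tendsto_0:
  assumes L: "L \<ge> 0" and r: "r \<ge> 2" and sub: "\<And>y. y > 0 \<Longrightarrow> L * (1 - exp (- y)) ^ (r - 1) < y"
  shows "(\<lambda>t. (survival_map L r ^^ t) 1) \<longlonglongrightarrow> 0"
proof -
  define q where "q = (\<lambda>t. (survival_map L r ^^ t) 1)"
  have b: "0 \<le> q t" "q t \<le> 1" for t unfolding q_def using survival_iter_bounds[OF L] by auto
  have mono: "survival_map L r x \<le> survival_map L r y" if "0 \<le> x" "x \<le> y" for x y
    unfolding survival_map_def using that L by (auto intro!: mult_left_mono power_mono)
  have dec: "q (Suc t) \<le> q t" for t
  proof (induction t)
    case 0
    then show ?case using b[of 1] by (simp add: q_def)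
  next
    case (Suc t)
    then show ?case using mono[OF b(1), of "Suc t" "q t"] by (simp add: q_def)
  qed
  have "decseq q" using dec by (simp add: decseq_Suc_iff)
  then obtain q0 where q0: "q \<longlonglongrightarrow> q0"
    using decseq_convergent[of q 0] b by metis
  have q00: "0 \<le> q0" by (rule LIMSEQ_le_const[OF q0]) (use b in auto)
  have "(\<lambda>t. survival_map L r (q t)) \<longlonglongrightarrow> survival_map L r q0"
    unfolding survival_map_def by (intro tendsto_intros q0)
  moreover have "(\<lambda>t. survival_map L r (q t)) = (\<lambda>t. q (Suc t))" by (simp add: q_def)
  ultimately have "(\<lambda>t. q (Suc t)) \<longlonglongrightarrow> survival_map L r q0" by (simp only:)
  then have fixp: "survival_map L r q0 = q0"
    using LIMSEQ_Suc[OF q0] by (rule LIMSEQ_unique)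
  have fix0: "1 - exp (- (L * q0 ^ (r - 1))) = q0" using fixp by (simp add: survival_map_def)
  have "q0 = 0"
  proof (rule ccontr)
    assume "q0 \<noteq> 0"
    then have "q0 > 0" using q00 by simp
    moreover have "L > 0" using \<open>q0 \<noteq> 0\<close> fixp L by (cases "L = 0") (auto simp: survival_map_def)
    ultimately have "L * q0 ^ (r - 1) > 0" by simp
    from sub[OF this] show False unfolding fix0 by simp
  qed
  then show ?thesis using q0 by (simp add: q_def)
qed

text \<open>As \<open>1 - exp (- x) \<le> x\<close> and \<open>r - 1 \<ge> 2\<close>, one iteration
  at least squares \<open>L * q\<close>; once this quantity has fallen below 1/2 the decay is doubly
  exponential.\<close>

lemma survival_iter_doubly_exponential:
  assumes L: "L > 0" and r: "r \<ge> 3" and sub: "\<And>y. y > 0 \<Longrightarrow> L * (1 - exp (- y)) ^ (r - 1) < y"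
  obtains t0 where "\<And>s. L * (survival_map L r ^^ (t0 + s)) 1 \<le> (1/2) ^ 2 ^ s"
proof -
  define q where "q = (\<lambda>t. (survival_map L r ^^ t) 1)"
  have b: "0 \<le> q t" "q t \<le> 1" for t unfolding q_def using survival_iter_bounds[of L] L by auto
  have "q \<longlonglongrightarrow> 0" unfolding q_def using survival_iter_tendsto_0[of L r] L r sub by simp
  then have "(\<lambda>t. L * q t) \<longlonglongrightarrow> L * 0" by (intro tendsto_intros)
  then have "\<forall>\<^sub>F t in sequentially. L * q t < 1/2" by (intro order_tendstoD) auto
  then obtain t0 where t0: "L * q t0 < 1/2" by (auto simp: eventually_sequentially)
  have "L * q (t0 + s) \<le> (1/2) ^ 2 ^ s" for s
  proof (induction s)
    case 0
    then show ?case using t0 by simp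
  next
    case (Suc s)
    have "q (t0 + Suc s) = 1 - exp (- (L * q (t0 + s) ^ (r - 1)))"
      by (simp add: q_def survival_map_def)
    also have "\<dots> \<le> L * q (t0 + s) ^ (r - 1)"
      using exp_ge_add_one_self[of "- (L * q (t0 + s) ^ (r - 1))"] by simp
    also have "\<dots> \<le> L * (q (t0 + s))\<^sup>2"
      using L b r by (intro mult_left_mono power_decreasing) auto
    finally have "L * q (t0 + Suc s) \<le> (L * q (t0 + s))\<^sup>2"
      using L mult_left_mono[of "q (t0 + Suc s)" _ L] by (simp add: power2_eq_square mult_ac)
    also have "\<dots> \<le> ((1/2) ^ 2 ^ s)\<^sup>2"
      using Suc L b by (intro power_mono) auto
    also have "\<dots> = (1/2) ^ 2 ^ Suc s" by (simp flip: power_mult add: mult.commute)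
    finally show ?case .
  qed
  then show ?thesis using that by (auto simp: q_def)
qed

text \<open>A clause through \<open>l\<close> is determined by the set of its other variables and
  the subset of those occurring positively. The factorial stays on the left to avoid division of
  naturals.\<close>

lemma card_clauses_containing:
  assumes V: "finite V" and r: "r > 0"
  shows "card {C \<in> possible_clauses r V. l \<in> C} * fact (r - 1) \<le> 2 ^ (r - 1) * card V ^ (r - 1)"
proof -
  let ?S = "{C \<in> possible_clauses r V. l \<in> C}"
  let ?T = "SIGMA T:{T. T \<subseteq> V \<and> card T = r - 1}. Pow T"
  let ?f = "\<lambda>C. (fst ` (C - {l}), {x. (x, True) \<in> C - {l}})"
  have fT: "finite ?T" using V by (intro finite_SigmaI) (auto intro: finite_subset)
  have inj: "inj_on ?f ?S"
  proof (rule inj_onI)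
    fix C D assume C: "C \<in> ?S" and D: "D \<in> ?S" and eq: "?f C = ?f D"
    have key: "z \<in> D" if "?f C = ?f D" "z \<in> C" "C \<in> ?S" "D \<in> ?S" for z C D
    proof (cases "z = l \<or> snd z")
      case True
      then show ?thesis using that by (cases z) auto
    next
      case False
      then have z: "z = (fst z, False)" "z \<noteq> l" by (cases z; auto)+
      then have "fst z \<in> fst ` (D - {l})" using that by auto
      \<comment> \<open>The variable of the negative literal \<open>z\<close> also occurs in
        \<open>D\<close>. A positive occurrence there would give one in \<open>C\<close> as well,
        and \<open>C\<close> would contain the variable with both signs.\<close>
      then obtain b where b: "(fst z, b) \<in> D - {l}" by force
      show ?thesis
      proof (cases b)
        case True
        then have "(fst z, True) \<in> C" using b that by auto
        then have "(fst z, True) = z"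
          using that by (intro inj_onD[of fst C]) (auto simp: possible_clauses_def)
        then show ?thesis using False by (metis snd_conv)
      next
        case False
        then show ?thesis using b z by auto
      qed
    qed
    show "C = D" using key[OF eq] key[OF eq[symmetric]] C D by blast
  qed
  have "?f ` ?S \<subseteq> ?T"
  proof (rule image_subsetI)
    fix C assume "C \<in> ?S"
    then have C: "C \<in> possible_clauses r V" "l \<in> C" by auto
    then have "card C = r" "inj_on fst C" "C \<subseteq> V \<times> UNIV" by (auto simp: possible_clauses_def)
    moreover from this have "card (fst ` (C - {l})) = r - 1"
      using C r by (subst card_image) (auto intro: inj_on_diff)
    ultimately show "?f C \<in> ?T" by force
  qed
  then have "card ?S \<le> card ?T" using card_inj_on_le[OF inj _ fT] by blast
  also have "card ?T = (\<Sum>T\<in>{T. T \<subseteq> V \<and> card T = r - 1}. 2 ^ (r - 1))"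
  proof (subst card_SigmaI)
    have "finite T \<and> card T = r - 1" if "T \<in> {T. T \<subseteq> V \<and> card T = r - 1}" for T
      using that V finite_subset by auto
    then show "(\<Sum>T\<in>{T. T \<subseteq> V \<and> card T = r - 1}. card (Pow T))
        = (\<Sum>T\<in>{T. T \<subseteq> V \<and> card T = r - 1}. 2 ^ (r - 1))"
      by (intro sum.cong refl) (metis card_Pow)
  qed (use V finite_subset in auto)
  also have "\<dots> = (card V choose (r - 1)) * 2 ^ (r - 1)" using n_subsets[OF V] by simp
  finally have "card ?S * fact (r - 1) \<le> (card V choose (r - 1)) * 2 ^ (r - 1) * fact (r - 1)"
    by (rule mult_right_mono) simp
  also have "\<dots> = 2 ^ (r - 1) * ((card V choose (r - 1)) * fact (r - 1))" by simp
  also have "\<dots> \<le> 2 ^ (r - 1) * card V ^ (r - 1)"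
    using binomial_fact_pow by (intro mult_left_mono) auto
  finally show ?thesis .
qed

lemma finite_possible_clauses: "finite V \<Longrightarrow> finite (possible_clauses r V)"
  unfolding possible_clauses_def by (rule finite_subset[of _ "Pow (V \<times> UNIV)"]) auto

section \<open>Excess and minimal unsatisfiable formulas\<close>

definition cvars :: "'v clause set \<Rightarrow> 'v set" where
  "cvars Q = fst ` \<Union>Q"

text \<open>Only occurring variables count, so excess makes sense for arbitrary unions of clause
  sets; on a MUF it agrees with \<open>excess\<close> by \<open>excess_muf\<close>.\<close>

definition clause_excess :: "nat \<Rightarrow> 'v clause set \<Rightarrow> int" where
  "clause_excess r Q = (int r - 1) * int (card Q) - int (card (cvars Q))"

lemma cvars_simps [simp]: "cvars {} = {}" "cvars (insert C Q) = fst ` C \<union> cvars Q" "cvars (Q \<union> R) = cvars Q \<union> cvars R"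
  by (auto simp: cvars_def)

lemma cvars_mono: "Q \<subseteq> R \<Longrightarrow> cvars Q \<subseteq> cvars R"
  by (auto simp: cvars_def)

lemma cvars_memI: "l \<in> C \<Longrightarrow> C \<in> Q \<Longrightarrow> fst l \<in> cvars Q"
  by (auto simp: cvars_def)

section \<open>Structure of minimal unsatisfiable formulas\<close>

lemma muf_finite:
  assumes "muf r F"
  shows "finite (vars F)" "finite (clauses F)" "clauses F \<subseteq> possible_clauses r (vars F)"
proof -
  show a: "finite (vars F)" "clauses F \<subseteq> possible_clauses r (vars F)"
    using assms by (auto simp: muf_def sat_formula_def)
  show "finite (clauses F)" using finite_subset[OF a(2) finite_possible_clauses[OF a(1)]] .
qed

lemma possible_clauses_mono: "V \<subseteq> W \<Longrightarrow> possible_clauses r V \<subseteq> possible_clauses r W"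
  by (auto simp: possible_clauses_def)

lemma possible_clauses_cvars: "Q \<subseteq> possible_clauses r V \<Longrightarrow> Q \<subseteq> possible_clauses r (cvars Q)"
proof
  fix C assume Q: "Q \<subseteq> possible_clauses r V" and C: "C \<in> Q"
  have "C \<subseteq> cvars Q \<times> UNIV" using C cvars_memI by fastforce
  then show "C \<in> possible_clauses r (cvars Q)" using Q C by (auto simp: possible_clauses_def)
qed

lemma cvars_subset: "Q \<subseteq> possible_clauses r V \<Longrightarrow> cvars Q \<subseteq> V"
proof
  fix x assume Q: "Q \<subseteq> possible_clauses r V" and "x \<in> cvars Q"
  then obtain C l where l: "C \<in> Q" "l \<in> C" "x = fst l" by (auto simp: cvars_def)
  then have "C \<subseteq> V \<times> UNIV" using Q by (auto simp: possible_clauses_def)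
  then show "x \<in> V" using l by auto
qed

lemma muf_subset_satisfiable:
  assumes "muf r F" "Q \<subset> clauses F"
  obtains A where "\<And>C. C \<in> Q \<Longrightarrow> \<exists>(x, b)\<in>C. A x = b"
proof -
  have "subformula r (Formula (vars F) Q) F"
    using assms muf_finite[OF assms(1)] by (auto simp: subformula_def sat_formula_def)
  moreover have "Formula (vars F) Q \<noteq> F" using assms(2) by (cases F) auto
  ultimately have "satisfiable (Formula (vars F) Q)" using assms(1) by (auto simp: muf_def)
  then show ?thesis using that by (auto simp: satisfiable_def)
qed

text \<open>Discarding variables that occur in no clause keeps a formula unsatisfiable, so
  minimality forbids them. A MUF is thus determined by its clauses.\<close>

lemma muf_vars: 
  assumes "muf r F"
  shows "vars F = cvars (clauses F)"
proof -
  note fin = muf_finite[OF assms]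
  let ?H = "Formula (cvars (clauses F)) (clauses F)"
  have "cvars (clauses F) \<subseteq> vars F" using fin by (intro cvars_subset)
  then have "subformula r ?H F"
    using fin possible_clauses_cvars[OF fin(3)] by (auto simp: subformula_def sat_formula_def intro: finite_subset)
  moreover have "\<not> satisfiable ?H" using assms by (auto simp: muf_def satisfiable_def)
  ultimately have "?H = F" using assms by (auto simp: muf_def)
  then show ?thesis by (metis formula.sel(1))
qed

lemma excess_muf: "muf r F \<Longrightarrow> excess r F = clause_excess r (clauses F)"
  by (simp add: excess_def clause_excess_def muf_vars[of r F])

lemma muf_eqI: "muf r F \<Longrightarrow> muf r G \<Longrightarrow> clauses F = clauses G \<Longrightarrow> F = G"
  using muf_vars[of r F] muf_vars[of r G] by (cases F; cases G) simp

text \<open>The clause sets of MUFs form an antichain, because a proper subset of one is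
  satisfiable.\<close>

lemma muf_clauses_subset_eq:
  assumes "muf r F" "muf r G" "clauses F \<subseteq> clauses G"
  shows "F = G"
proof (rule muf_eqI[OF assms(1,2)], rule ccontr)
  assume "clauses F \<noteq> clauses G"
  then have "clauses F \<subset> clauses G" using assms by auto
  from muf_subset_satisfiable[OF assms(2) this] have "satisfiable F" unfolding satisfiable_def by metis
  then show False using assms by (auto simp: muf_def)
qed

text \<open>If \<open>x\<close> occurred with one sign only, the clauses containing \<open>x\<close>
  could all be satisfied by its value, and the others, a proper subset, by minimality.\<close>

lemma muf_literal_occurs:
  assumes F: "muf r F" and x: "x \<in> vars F"
  obtains C where "C \<in> clauses F" "(x, b) \<in> C"
proof -
  have "\<exists>C\<in>clauses F. (x, b) \<in> C"
  proof (rule ccontr)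
    assume no: "\<not> ?thesis"
    obtain C0 c where C0: "C0 \<in> clauses F" "(x, c) \<in> C0"
      using x unfolding muf_vars[OF F] cvars_def by fastforce
    then have c: "c = (\<not> b)" using no by (cases c; cases b) auto
    let ?Q = "{C \<in> clauses F. (x, \<not> b) \<notin> C}"
    have "?Q \<subset> clauses F" using C0 c by blast
    from muf_subset_satisfiable[OF F this] obtain A
      where A: "\<And>C. C \<in> ?Q \<Longrightarrow> \<exists>(x, b)\<in>C. A x = b" by blast
    have sat: "\<exists>(y, d)\<in>C. (A(x := \<not> b)) y = d" if C: "C \<in> clauses F" for C
    proof (cases "(x, \<not> b) \<in> C")
      case True
      then show ?thesis by (intro bexI[of _ "(x, \<not> b)"]) auto
    next
      case False
      then obtain y d where y: "(y, d) \<in> C" "A y = d" using A[of C] C by auto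
      then have "y \<noteq> x" using no False C by (cases d; cases b) auto
      then show ?thesis using y by (intro bexI[of _ "(y, d)"]) auto
    qed
    have "satisfiable F" unfolding satisfiable_def by (intro exI[of _ "A(x := \<not> b)"] ballI sat)
    then show False using F by (auto simp: muf_def)
  qed
  then show ?thesis using that by blast
qed

lemma muf_clauses_nonempty:
  assumes "muf r F"
  shows "clauses F \<noteq> {}"
proof
  assume "clauses F = {}"
  then have "satisfiable F" by (simp add: satisfiable_def)
  then show False using assms by (simp add: muf_def)
qed

lemma possible_clausesD:
  assumes "C \<in> possible_clauses r V" "r > 0"
  shows "finite C" "inj_on fst C" "card C = r" "card (fst ` C) = r" "fst ` C \<subseteq> V"
proof -
  have C: "C \<subseteq> V \<times> UNIV" "inj_on fst C" "card C = r" using assms(1) by (simp_all add: possible_clauses_def)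
  then show "finite C" "inj_on fst C" "card C = r" "card (fst ` C) = r"
    using card_ge_0_finite[of C] assms(2) by (simp_all add: card_image)
  show "fst ` C \<subseteq> V" using C(1) by auto
qed

text \<open>Every variable of \<open>G\<close> outside \<open>Q\<close> occurs with both signs in clauses outside \<open>Q\<close>.\<close>

lemma clause_excess_Un_muf:
  assumes r: "r \<ge> 3" and G: "muf r G" and Q: "finite Q" "finite (cvars Q)" and sub: "\<not> clauses G \<subseteq> Q"
  shows "clause_excess r Q < clause_excess r (Q \<union> clauses G)"
    "card (clauses G - Q) \<le> 2 * (clause_excess r (Q \<union> clauses G) - clause_excess r Q)"
proof -
  note fin = muf_finite[OF G]
  define D U where "D = clauses G - Q" and "U = vars G - cvars Q"
  have finD: "finite D" and finU: "finite U" using fin by (auto simp: D_def U_def)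
  have D0: "card D > 0" using sub finD by (auto simp: D_def card_gt_0_iff)
  \<comment> \<open>Both literals of every new variable lie in new clauses, which gives
    \<open>2 * card U \<le> r * card D\<close>.\<close>
  have "U \<times> UNIV \<subseteq> \<Union>D"
  proof
    fix l assume l: "l \<in> U \<times> (UNIV :: bool set)"
    obtain x b where xb: "l = (x, b)" by (cases l)
    from l have x: "x \<in> vars G" "x \<notin> cvars Q" by (auto simp: xb U_def)
    from muf_literal_occurs[OF G x(1)] obtain C where "C \<in> clauses G" "(x, b) \<in> C" by blast
    moreover then have "C \<notin> Q" using x cvars_memI by fastforce
    ultimately show "l \<in> \<Union>D" by (auto simp: xb D_def)
  qed
  moreover have "card (\<Union>D) \<le> (\<Sum>C\<in>D. card C)" by (rule card_Union_le_sum_card)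
  moreover have CD: "finite C \<and> card C = r" if "C \<in> D" for C
    using that fin possible_clausesD[of C r "vars G"] r by (auto simp: D_def)
  moreover have "finite (\<Union>D)" using CD finD by auto
  ultimately have "card (U \<times> (UNIV :: bool set)) \<le> r * card D"
    using card_mono[of "\<Union>D" "U \<times> UNIV"] by (simp add: mult.commute)
  then have U: "2 * card U \<le> r * card D" by (simp add: card_cartesian_product mult.commute)
  have "card (Q \<union> clauses G) = card Q + card D"
    unfolding D_def using Q fin by (subst card_Un_disjoint[symmetric]) auto
  moreover have "card (cvars (Q \<union> clauses G)) = card (cvars Q) + card U"
    unfolding U_def using Q fin muf_vars[OF G] by (subst card_Un_disjoint[symmetric]) auto
  ultimately have d: "clause_excess r (Q \<union> clauses G) - clause_excess r Q = (int r - 1) * card D - card U"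
    by (simp add: clause_excess_def algebra_simps)
  have "int (2 * card U) \<le> int (r * card D)" using U by (simp only: of_nat_le_iff)
  moreover have "3 * int (card D) \<le> int r * card D" using r by (intro mult_right_mono) auto
  \<comment> \<open>Twice the gain in excess is at least \<open>(2 * (r - 1) - r) * card D\<close>,
    and \<open>r - 2\<close> is at least 1.\<close>
  ultimately have "card D \<le> 2 * ((int r - 1) * card D - card U)" by (simp add: algebra_simps)
  then show "card (clauses G - Q) \<le> 2 * (clause_excess r (Q \<union> clauses G) - clause_excess r Q)"
    "clause_excess r Q < clause_excess r (Q \<union> clauses G)"
    using D0 unfolding d D_def[symmetric] by auto (use d in linarith)
qed

text \<open>Otherwise \<open>H\<close> and the remaining clauses have no common variable; both are
  satisfiable by minimality, and the two assignments can be glued.\<close>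

lemma muf_connected:
  assumes G: "muf r G" and H: "H \<subseteq> clauses G" "H \<noteq> {}" "H \<noteq> clauses G"
  obtains C where "C \<in> clauses G - H" "fst ` C \<inter> cvars H \<noteq> {}"
proof -
  have "\<exists>C\<in>clauses G - H. fst ` C \<inter> cvars H \<noteq> {}"
  proof (rule ccontr)
    assume no: "\<not> ?thesis"
    have "H \<subset> clauses G" "clauses G - H \<subset> clauses G" using H by auto
    from muf_subset_satisfiable[OF G this(1)] muf_subset_satisfiable[OF G this(2)]
    obtain A B where A: "\<And>C. C \<in> H \<Longrightarrow> \<exists>(x, b)\<in>C. A x = b"
      and B: "\<And>C. C \<in> clauses G - H \<Longrightarrow> \<exists>(x, b)\<in>C. B x = b" by metis
    let ?A = "\<lambda>x. if x \<in> cvars H then A x else B x"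
    have sat: "\<exists>(x, b)\<in>C. ?A x = b" if C: "C \<in> clauses G" for C
    proof (cases "C \<in> H")
      case True
      then obtain x b where "(x, b) \<in> C" "A x = b" using A by fastforce
      moreover then have "x \<in> cvars H" using cvars_memI True by fastforce
      ultimately show ?thesis by (intro bexI[of _ "(x, b)"]) auto
    next
      case False
      then obtain x b where "(x, b) \<in> C" "B x = b" using B C by fastforce
      moreover then have "x \<notin> cvars H" using no C False by force
      ultimately show ?thesis by (intro bexI[of _ "(x, b)"]) auto
    qed
    have "satisfiable G" unfolding satisfiable_def by (intro exI[of _ ?A] ballI sat)
    then show False using G by (auto simp: muf_def)
  qed
  then show ?thesis using that by blast
qed

section \<open>Walks that leave a clause set of locally maximal excess\<close>

locale literal_cover =
  fixes r :: nat and \<G> :: "'v clause set" and f :: "'v \<times> bool \<Rightarrow> 'v clause"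
  assumes r_pos: "r > 0" and finite_cover: "finite \<G>"
    and cover_clause: "C \<in> \<G> \<Longrightarrow> finite C \<and> inj_on fst C \<and> card C = r"
    and f_cover: "fst l \<in> cvars \<G> \<Longrightarrow> f l \<in> \<G> \<and> l \<in> f l"
begin

text \<open>The number \<open>b\<close> is a budget of clauses that a walk may still absorb into
  \<open>H\<close> before the maximality of the excess is exhausted.\<close>

definition tight :: "'v clause set \<Rightarrow> nat \<Rightarrow> bool" where
  "tight H b \<longleftrightarrow> H \<subseteq> \<G> \<and> (\<forall>Q\<subseteq>\<G>. card Q \<le> b \<longrightarrow> clause_excess r (H \<union> Q) \<le> clause_excess r H)"

lemma tight_mono: "tight H b \<Longrightarrow> b' \<le> b \<Longrightarrow> tight H b'"
  unfolding tight_def by (metis order_trans)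

text \<open>The clause adds \<open>r - 1\<close> for itself and removes one for each new variable.
  Sharing one variable is therefore neutral, sharing two raises the excess.\<close>

lemma clause_excess_insert:
  assumes "H \<subseteq> \<G>" "C \<in> \<G>" "C \<notin> H"
  shows "clause_excess r (insert C H) = clause_excess r H - 1 + int (card (fst ` C \<inter> cvars H))"
proof -
  have fH: "finite H" using assms finite_cover finite_subset by blast
  have fc: "finite (cvars H)" using fH assms cover_clause by (auto simp: cvars_def)
  have fC: "finite (fst ` C)" "card (fst ` C) = r" using cover_clause[OF assms(2)] by (auto simp: card_image)
  have "card (fst ` C \<union> cvars H) + card (fst ` C \<inter> cvars H) = r + card (cvars H)"
    using card_Un_Int[OF fC(1) fc] fC(2) by simp
  then have "int (card (fst ` C \<union> cvars H)) = int r + card (cvars H) - card (fst ` C \<inter> cvars H)" by linarith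
  then show ?thesis using assms fH by (simp add: clause_excess_def algebra_simps)
qed

text \<open>Two shared variables would raise the excess, so exactly one is shared; then the excess
  is unchanged and tightness survives with one unit of budget spent.\<close>

lemma tight_insert:
  assumes t: "tight H (Suc b)" and C: "C \<in> \<G>" "C \<notin> H" and x: "x \<in> fst ` C" "x \<in> cvars H"
  shows "fst ` C \<inter> cvars H = {x}" "tight (insert C H) b"
proof -
  have H: "H \<subseteq> \<G>" using t by (auto simp: tight_def)
  have "clause_excess r (H \<union> {C}) \<le> clause_excess r H" using t C by (auto simp: tight_def)
  then have c: "card (fst ` C \<inter> cvars H) \<le> 1" using clause_excess_insert[OF H C] by simp
  have fin: "finite (fst ` C \<inter> cvars H)" using cover_clause[OF C(1)] by auto
  show eq: "fst ` C \<inter> cvars H = {x}"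
    using card_le_Suc0_iff_eq[OF fin] c x by auto
  have ex: "clause_excess r (insert C H) = clause_excess r H"
    using clause_excess_insert[OF H C] eq by simp
  show "tight (insert C H) b"
    unfolding tight_def
  proof (intro conjI allI impI)
    show "insert C H \<subseteq> \<G>" using H C by auto
    fix Q assume Q: "Q \<subseteq> \<G>" "card Q \<le> b"
    have "card (insert C Q) \<le> Suc b" using Q card_insert_le_m1 finite_cover
      by (metis card.infinite card_insert_if finite_subset le_SucI Suc_le_mono)
    moreover have "insert C Q \<subseteq> \<G>" using Q C by simp
    ultimately have "clause_excess r (H \<union> insert C Q) \<le> clause_excess r H"
      using t unfolding tight_def by blast
    then show "clause_excess r (insert C H \<union> Q) \<le> clause_excess r (insert C H)" by (simp add: ex)
  qed
qed

text \<open>The invariant that lets the walk continue at \<open>neg z\<close> with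
  \<open>insert C H\<close> in place of \<open>H\<close>. The next clause is not in \<open>H\<close>
  because its variable is new, and it is not \<open>C\<close> because \<open>C\<close> contains that
  variable only as \<open>z\<close>.\<close>

lemma child_outside:
  assumes t: "tight H (Suc b)" and C: "C \<in> \<G>" "C \<notin> H" and x: "x \<in> fst ` C" "x \<in> cvars H"
    and z: "z \<in> C" "fst z \<noteq> x"
  shows "fst z \<notin> cvars H" "fst (neg z) \<in> cvars (insert C H)" "f (neg z) \<notin> insert C H"
proof -
  show n: "fst z \<notin> cvars H" using tight_insert(1)[OF t C x] z by auto
  show "fst (neg z) \<in> cvars (insert C H)" using z by (auto simp: neg_def)
  have H: "insert C H \<subseteq> \<G>" using t C by (auto simp: tight_def)
  have "fst (neg z) \<in> cvars \<G>" using cvars_memI[OF z(1) C(1)] by (simp add: neg_def)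
  then have fz: "neg z \<in> f (neg z)" using f_cover by blast
  show "f (neg z) \<notin> insert C H"
  proof
    assume "f (neg z) \<in> insert C H"
    moreover have "f (neg z) \<notin> H" using fz n cvars_memI[of "neg z" "f (neg z)" H] by (auto simp: neg_def)
    ultimately have "neg z \<in> C" using fz by auto
    then have "neg z = z"
      using z cover_clause[OF C(1)] inj_on_eq_iff[of fst C "neg z" z] by (simp add: neg_def)
    then show False by (cases z) (auto simp: neg_def)
  qed
qed

text \<open>The clauses met when walking up to \<open>j\<close> steps from \<open>l\<close>. The
  fixed choice \<open>f\<close> makes the walk deterministic at each literal, so the tree is a
  function of its root.\<close>

primrec witness :: "nat \<Rightarrow> 'v \<times> bool \<Rightarrow> 'v clause set" where
  "witness 0 l = {}"
| "witness (Suc j) l = insert (f l) (\<Union>z\<in>f l - {l}. witness j (neg z))"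

lemma root_clause:
  assumes "tight H b" "fst l \<in> cvars H"
  shows "f l \<in> \<G>" "l \<in> f l" "fst l \<in> fst ` f l" "\<And>z. z \<in> f l - {l} \<Longrightarrow> fst z \<noteq> fst l"
proof -
  have "fst l \<in> cvars \<G>" using assms cvars_mono[of H \<G>] by (auto simp: tight_def)
  then show a: "f l \<in> \<G>" "l \<in> f l" using f_cover by auto
  then show "fst l \<in> fst ` f l" by auto
  show "fst z \<noteq> fst l" if "z \<in> f l - {l}" for z
    using that a cover_clause[OF a(1)] by (auto dest: inj_onD)
qed

text \<open>Only the clauses on the path to the current position are absorbed into \<open>H\<close>,
  not the whole tree. Hence a budget linear in the depth suffices, although the tree grows
  exponentially.\<close>

lemma witness_avoids:
  "tight H j \<Longrightarrow> fst l \<in> cvars H \<Longrightarrow> f l \<notin> H \<Longrightarrow> witness j l \<inter> H = {}"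
proof (induction j arbitrary: H l)
  case 0
  then show ?case by simp
next
  case (Suc j)
  note rc = root_clause[OF Suc.prems(1,2)]
  have "witness j (neg z) \<inter> insert (f l) H = {}" if z: "z \<in> f l - {l}" for z
    using child_outside[OF Suc.prems(1) rc(1) Suc.prems(3) rc(3) Suc.prems(2), of z]
      tight_insert(2)[OF Suc.prems(1) rc(1) Suc.prems(3) rc(3) Suc.prems(2)] z rc(4)[OF z]
    by (intro Suc.IH) auto
  then show ?case using Suc.prems(3) by auto
qed

text \<open>\<open>H'\<close> is \<open>H\<close> together with the path from \<open>l\<close> to
  \<open>D\<close>, which costs at most \<open>j\<close> units of budget. The last conjunct records
  that the path meets the old part only at its root variable, which keeps sibling branches away from
  it.\<close>

lemma witness_absorb:
  "tight H (b + j) \<Longrightarrow> fst l \<in> cvars H \<Longrightarrow> f l \<notin> H \<Longrightarrow> D \<in> witness j l \<Longrightarrow>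
    \<exists>H'. insert D H \<subseteq> H' \<and> tight H' b \<and> (\<forall>D'\<in>H'-H. fst ` D' \<inter> cvars H \<subseteq> {fst l})"
proof (induction j arbitrary: H l)
  case 0
  then show ?case by simp
next
  case (Suc j)
  have t: "tight H (Suc (b + j))" using Suc.prems(1) by simp
  note rc = root_clause[OF Suc.prems(1,2)]
  note ti = tight_insert[OF t rc(1) Suc.prems(3) rc(3) Suc.prems(2)]
  show ?case
  proof (cases "D = f l")
    case True
    have "tight (insert (f l) H) b" using ti(2) by (rule tight_mono) simp
    then show ?thesis using ti(1) True by (intro exI[of _ "insert (f l) H"]) auto
  next
    case False
    then obtain z where z: "z \<in> f l - {l}" "D \<in> witness j (neg z)" using Suc.prems(4) by auto
    note co = child_outside[OF t rc(1) Suc.prems(3) rc(3) Suc.prems(2) _ rc(4)[OF z(1)]]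
    have zf: "z \<in> f l" using z by auto
    from Suc.IH[OF ti(2) co(2,3)[OF zf] z(2)] obtain H' where
      H': "insert D (insert (f l) H) \<subseteq> H'" "tight H' b"
        "\<forall>D'\<in>H'-insert (f l) H. fst ` D' \<inter> cvars (insert (f l) H) \<subseteq> {fst (neg z)}" by blast
    have "fst ` D' \<inter> cvars H \<subseteq> {fst l}" if D': "D' \<in> H' - H" for D'
    proof (cases "D' = f l")
      case True
      then show ?thesis using ti(1) by auto
    next
      case False
      then have "fst ` D' \<inter> cvars (insert (f l) H) \<subseteq> {fst z}" using H'(3) D' by (auto simp: neg_def)
      then show ?thesis using co(1)[OF zf] by auto
    qed
    then show ?thesis using H' by (intro exI[of _ H']) auto
  qed
qed

text \<open>A clause common to two branches would close a cycle: after absorbing the path through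
  \<open>z1\<close> to it, the walk from \<open>z2\<close> must avoid it. The budget is 1 for the
  root clause and \<open>j\<close> for each of the two paths.\<close>

lemma witness_branches_disjoint:
  assumes t: "tight H (Suc (j + j))" and l: "fst l \<in> cvars H" "f l \<notin> H"
    and z: "z1 \<in> f l - {l}" "z2 \<in> f l - {l}" "z1 \<noteq> z2"
  shows "witness j (neg z1) \<inter> witness j (neg z2) = {}"
proof (rule ccontr)
  assume "witness j (neg z1) \<inter> witness j (neg z2) \<noteq> {}"
  then obtain D where D: "D \<in> witness j (neg z1)" "D \<in> witness j (neg z2)" by auto
  note rc = root_clause[OF t l(1)]
  let ?H = "insert (f l) H"
  note ti = tight_insert[OF t rc(1) l(2) rc(3) l(1)]
  note co1 = child_outside[OF t rc(1) l(2) rc(3) l(1) _ rc(4)[OF z(1)]]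
  note co2 = child_outside[OF t rc(1) l(2) rc(3) l(1) _ rc(4)[OF z(2)]]
  have zf: "z1 \<in> f l" "z2 \<in> f l" using z by auto
  from witness_absorb[OF ti(2) co1(2,3)[OF zf(1)] D(1)] obtain H' where
    H': "insert D ?H \<subseteq> H'" "tight H' j" "\<forall>D'\<in>H' - ?H. fst ` D' \<inter> cvars ?H \<subseteq> {fst (neg z1)}" by blast
  have ne: "fst z1 \<noteq> fst z2"
    using z zf cover_clause[OF rc(1)] inj_on_eq_iff[of fst "f l" z1 z2] by simp
  have v2: "fst (neg z2) \<in> cvars ?H" by (rule co2(2)[OF zf(2)])
  \<comment> \<open>The absorbed clauses meet the old part only in the variable of
    \<open>z1\<close>, whereas this clause meets it in that of \<open>z2\<close>.\<close>
  have "f (neg z2) \<notin> H'"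
  proof
    assume "f (neg z2) \<in> H'"
    then have "fst ` f (neg z2) \<inter> cvars ?H \<subseteq> {fst (neg z1)}" using H'(3) co2(3)[OF zf(2)] by auto
    moreover have "fst (neg z2) \<in> fst ` f (neg z2)" using root_clause(3)[OF ti(2) v2] .
    ultimately show False using v2 ne by (auto simp: neg_def)
  qed
  moreover have "fst (neg z2) \<in> cvars H'" using v2 cvars_mono[of ?H H'] H'(1) by auto
  ultimately have "witness j (neg z2) \<inter> H' = {}" using witness_avoids[OF H'(2)] by blast
  then show False using D H' by auto
qed

text \<open>Avoidance separates the root clause from its subtrees and the previous lemma separates
  the subtrees. A cycle can consist of two paths of length up to \<open>t\<close>, which explains
  the budget of twice the depth.\<close>

lemma witness_tree_event:
  "tight H (2 * t) \<Longrightarrow> fst l \<in> cvars H \<Longrightarrow> f l \<notin> H \<Longrightarrow> \<G> \<subseteq> E \<Longrightarrow> witness t l \<in> tree_event E t l"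
proof (induction t arbitrary: H l)
  case 0
  then show ?case by simp
next
  case (Suc t)
  have ti1: "tight H (Suc (Suc (2 * t)))" using Suc.prems(1) by simp
  have ti2: "tight H (Suc (t + t))" using ti1 by (rule tight_mono) simp
  note rc = root_clause[OF Suc.prems(1,2)]
  note ti = tight_insert[OF ti1 rc(1) Suc.prems(3) rc(3) Suc.prems(2)]
  have ti3: "tight (insert (f l) H) (2 * t)" "tight (insert (f l) H) t"
    using ti(2) by (rule tight_mono, simp)+
  note co = child_outside[OF ti1 rc(1) Suc.prems(3) rc(3) Suc.prems(2) _ rc(4)]
  let ?Z = "\<Union>z\<in>f l - {l}. witness t (neg z)"
  have "?Z \<in> disj_occ_family (f l - {l}) (\<lambda>z. tree_event E t (neg z))"
    unfolding disj_occ_family_def mem_Collect_eq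
  proof (intro exI conjI ballI)
    show "disjoint_family_on (\<lambda>z. witness t (neg z)) (f l - {l})"
      unfolding disjoint_family_on_def
      using witness_branches_disjoint[OF ti2 Suc.prems(2,3)] by blast
    fix z assume z: "z \<in> f l - {l}"
    show "witness t (neg z) \<subseteq> ?Z" using z by auto
    show "witness t (neg z) \<in> tree_event E t (neg z)"
      using co(2,3)[OF _ z] z Suc.prems(4) by (intro Suc.IH[OF ti3(1)]) auto
  qed
  moreover have "f l \<notin> ?Z"
  proof
    assume "f l \<in> ?Z"
    then obtain z where z: "z \<in> f l - {l}" "f l \<in> witness t (neg z)" by auto
    have "witness t (neg z) \<inter> insert (f l) H = {}"
      using co(2,3)[OF _ z(1)] z by (intro witness_avoids[OF ti3(2)]) auto
    then show False using z by auto
  qed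
  ultimately have "{f l} \<subseteq> witness (Suc t) l \<and> ?Z \<subseteq> witness (Suc t) l \<and> {f l} \<inter> ?Z = {} \<and>
      {f l} \<in> {X. f l \<in> X} \<and> ?Z \<in> disj_occ_family (f l - {l}) (\<lambda>z. tree_event E t (neg z))" by auto
  then have "witness (Suc t) l \<in> {X. f l \<in> X} \<box> disj_occ_family (f l - {l}) (\<lambda>z. tree_event E t (neg z))"
    unfolding disj_occ_def mem_Collect_eq[of _ "\<lambda>X. \<exists>Y Z. _ X Y Z"] by (intro exI)
  then show ?case using rc Suc.prems(4) by auto
qed

end

text \<open>Among clause sets of size at most linear in their excess, one of maximal excess is
  tight, since a bounded enlargement that raised the excess would qualify too. Its excess is below
  \<open>K\<close>, so it is not all of \<open>G\<close>, and connectivity provides a clause from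
  which the tree starts.\<close>

lemma muf_sparse_imp_tree_event:
  fixes G :: "'v formula"
  assumes r: "r \<ge> 3" and G: "muf r G" and K: "excess r G \<ge> int K" and E: "clauses G \<subseteq> E"
    and sparse: "\<And>Q. Q \<subseteq> clauses G \<Longrightarrow> card Q \<le> 1 + (K + 1) * (2 * t + 1) \<Longrightarrow> clause_excess r Q < int K"
  obtains l where "fst l \<in> vars G" "clauses G \<in> tree_event E t l"
proof -
  note fin = muf_finite[OF G]
  define f where "f l = (SOME C. C \<in> clauses G \<and> l \<in> C)" for l :: "'v \<times> bool"
  have f: "f l \<in> clauses G \<and> l \<in> f l" if l: "fst l \<in> cvars (clauses G)" for l
  proof -
    obtain C where "C \<in> clauses G" "(fst l, snd l) \<in> C"
      by (rule muf_literal_occurs[OF G]) (use l in \<open>simp add: muf_vars[OF G]\<close>)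
    then have "\<exists>C. C \<in> clauses G \<and> l \<in> C" by auto
    then show ?thesis unfolding f_def by (rule someI_ex)
  qed
  interpret literal_cover r "clauses G" f
  proof
    show "r > 0" "finite (clauses G)" using r fin by auto
    show "finite C \<and> inj_on fst C \<and> card C = r" if "C \<in> clauses G" for C
      using possible_clausesD[of C r "vars G"] subsetD[OF fin(3) that] r by simp
    show "f l \<in> clauses G \<and> l \<in> f l" if "fst l \<in> cvars (clauses G)" for l
      using that by (rule f)
  qed
  \<comment> \<open>One clause to leave \<open>H\<close>, and \<open>2 * t\<close> for a tree of
    depth \<open>t\<close>.\<close>
  define b where "b = 2 * t + 1"
  \<comment> \<open>A single clause has excess -1, and each further unit of excess may cost
    \<open>b\<close> clauses. With excess below \<open>K\<close>, adding another \<open>b\<close>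
    clauses still respects the size limit in \<open>sparse\<close>.\<close>
  define S where "S = {H. H \<subseteq> clauses G \<and> H \<noteq> {} \<and> clause_excess r H < int K \<and>
    int (card H) \<le> 1 + (clause_excess r H + 1) * int b}"
  obtain C0 where C0: "C0 \<in> clauses G" using muf_clauses_nonempty[OF G] by auto
  have ce0: "clause_excess r {C0} = -1"
    using clause_excess_insert[of "{}" C0] C0 by (simp add: clause_excess_def)
  have "{C0} \<in> S" using C0 by (simp add: S_def ce0)
  moreover have "finite S" unfolding S_def using fin(2) by auto
  ultimately obtain H where H: "H \<in> S" "\<And>H'. H' \<in> S \<Longrightarrow> clause_excess r H' \<le> clause_excess r H"
    using obtains_MAX[of S "clause_excess r"] by (metis Max_ge empty_iff finite_imageI imageI)
  from H(1) have HG: "H \<subseteq> clauses G" "H \<noteq> {}" "clause_excess r H < int K"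
    "int (card H) \<le> 1 + (clause_excess r H + 1) * int b" by (auto simp: S_def)
  have tight: "tight H b"
    unfolding tight_def
  proof (intro conjI allI impI HG(1))
    fix Q assume Q: "Q \<subseteq> clauses G" "card Q \<le> b"
    show "clause_excess r (H \<union> Q) \<le> clause_excess r H"
    proof (rule ccontr)
      assume gt: "\<not> ?thesis"
      have "int (card (H \<union> Q)) \<le> int (card H) + int b" using card_Un_le[of H Q] Q by linarith
      also have "\<dots> \<le> 1 + (clause_excess r H + 2) * int b" using HG(4) by (simp add: algebra_simps)
      finally have c: "int (card (H \<union> Q)) \<le> 1 + (clause_excess r H + 2) * int b" .
      have "(clause_excess r H + 2) * int b \<le> (int K + 1) * int b" using HG(3) by (intro mult_right_mono) auto
      then have "int (card (H \<union> Q)) \<le> int (1 + (K + 1) * b)" using c by (simp add: algebra_simps)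
      then have "clause_excess r (H \<union> Q) < int K"
        using HG Q unfolding of_nat_le_iff b_def by (intro sparse) auto
      moreover have "(clause_excess r H + 2) * int b \<le> (clause_excess r (H \<union> Q) + 1) * int b"
        using gt by (intro mult_right_mono) auto
      ultimately have "H \<union> Q \<in> S" using HG Q c by (auto simp: S_def)
      then show False using H(2) gt by auto
    qed
  qed
  have "H \<noteq> clauses G" using K HG(3) excess_muf[OF G] by auto
  then obtain C where "C \<in> clauses G - H" "fst ` C \<inter> cvars H \<noteq> {}"
    by (rule muf_connected[OF G HG(1,2)])
  then obtain x where C: "C \<in> clauses G" "C \<notin> H" and x: "x \<in> fst ` C" "x \<in> cvars H" by auto
  have t1: "tight H (Suc (2 * t))" using tight by (simp add: b_def)
  note ti = tight_insert[OF t1 C(1,2) x]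
  have "\<not> fst ` C \<subseteq> {x}"
  proof
    assume "fst ` C \<subseteq> {x}"
    then have "card (fst ` C) \<le> 1" using card_mono[of "{x}" "fst ` C"] by simp
    then show False using cover_clause[OF C(1)] r by (simp add: card_image)
  qed
  then obtain z where z: "z \<in> C" "fst z \<noteq> x" by auto
  note co = child_outside[OF t1 C(1,2) x z]
  have wit: "witness t (neg z) \<in> tree_event E t (neg z)"
    using E by (intro witness_tree_event[OF ti(2) co(2,3)])
  have "witness t l \<subseteq> clauses G" if "fst l \<in> cvars (clauses G)" for l
    using that
  proof (induction t arbitrary: l)
    case 0
    then show ?case by simp
  next
    case (Suc t)
    then have fl: "f l \<in> clauses G" using f by blast
    have "witness t (neg z) \<subseteq> clauses G" if "z \<in> f l" for z
      using cvars_memI[OF that fl] by (intro Suc.IH) (simp add: neg_def)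
    then show ?case using fl by auto
  qed
  moreover have zv: "fst (neg z) \<in> cvars (clauses G)" using cvars_memI[OF z(1) C(1)] by (simp add: neg_def)
  ultimately have "clauses G \<in> tree_event E t (neg z)"
    using upclosedD[OF upclosed_tree_event wit] by blast
  then show ?thesis using that zv muf_vars[OF G] by blast
qed

section \<open>Counting clause sets of large excess\<close>

definition dense_sets :: "nat \<Rightarrow> 'v clause set \<Rightarrow> nat \<Rightarrow> nat \<Rightarrow> 'v clause set set" where
  "dense_sets r E s0 K = {Q. Q \<subseteq> E \<and> card Q \<le> s0 \<and> clause_excess r Q \<ge> int K}"

text \<open>The first two factors count the pairs (size, number of variables); the rest bounds the
  ways to place the clauses on given variables, times the power of \<open>A\<close>.\<close>

definition dense_bound :: "nat \<Rightarrow> real \<Rightarrow> nat \<Rightarrow> real" where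
  "dense_bound r A s = (real s + 1) * (real (r * s) + 1) * ((2 * real (r * s) + 1) ^ (r * s) * A ^ s)"

lemma binomial_le_power: "n choose k \<le> n ^ k"
  by (cases "k \<le> n") (simp_all add: binomial_le_pow binomial_eq_0)

lemma card_possible_clauses_le:
  assumes "finite V"
  shows "card (possible_clauses r V) \<le> (2 * card V) ^ r"
proof -
  have fin: "finite (V \<times> (UNIV :: bool set))" using assms by simp
  have "card (possible_clauses r V) \<le> card {C. C \<subseteq> V \<times> (UNIV :: bool set) \<and> card C = r}"
    using fin by (intro card_mono) (auto simp: possible_clauses_def intro: finite_subset[of _ "Pow (V \<times> UNIV)"])
  also have "\<dots> = (2 * card V) choose r"
    using n_subsets[OF fin] by (simp add: card_cartesian_product mult.commute)
  also have "\<dots> \<le> (2 * card V) ^ r"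
    by (rule binomial_le_power)
  finally show ?thesis .
qed

lemma card_cvars_le:
  assumes "Q \<subseteq> possible_clauses r V" "r > 0"
  shows "card (cvars Q) \<le> r * card Q"
proof (cases "finite Q")
  case True
  have "card (cvars Q) \<le> (\<Sum>C\<in>Q. card (fst ` C))"
    unfolding cvars_def using True card_UN_le[of Q "\<lambda>C. fst ` C"] by (simp add: image_Union)
  also have "\<dots> = (\<Sum>C\<in>Q. r)"
    using assms possible_clausesD(4) by (intro sum.cong) blast+
  finally show ?thesis by (simp add: mult.commute)
next
  case False
  \<comment> \<open>For infinite \<open>Q\<close> the right-hand side is 0 by the convention for
    \<open>card\<close>, so the left-hand side must be 0 too.\<close>
  have "infinite (cvars Q)"
  proof
    assume "finite (cvars Q)"
    then have "finite (possible_clauses r (cvars Q))" by (rule finite_possible_clauses)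
    then show False using False finite_subset[OF possible_clauses_cvars[OF assms(1)]] by blast
  qed
  then show ?thesis by simp
qed

text \<open>Choose the \<open>v\<close> variables first, then \<open>s\<close> of the clauses on
  them; powers replace both binomial coefficients.\<close>

lemma card_sets_with_cvars_le:
  "card {Q. Q \<subseteq> possible_clauses r {..<n} \<and> card Q = s \<and> card (cvars Q) = v} \<le> n ^ v * ((2 * v) ^ r) ^ s"
proof -
  let ?U = "{U. U \<subseteq> {..<n} \<and> card U = v}"
  have finU: "finite ?U" by simp
  have "{Q. Q \<subseteq> possible_clauses r {..<n} \<and> card Q = s \<and> card (cvars Q) = v}
      \<subseteq> (\<Union>U\<in>?U. {Q. Q \<subseteq> possible_clauses r U \<and> card Q = s})" (is "?L \<subseteq> ?R")
  proof
    fix Q assume "Q \<in> ?L"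
    then have Q: "Q \<subseteq> possible_clauses r {..<n}" "card Q = s" "card (cvars Q) = v" by auto
    show "Q \<in> ?R" using cvars_subset[OF Q(1)] possible_clauses_cvars[OF Q(1)] Q
      by (intro UN_I[of "cvars Q"]) auto
  qed
  moreover have fin: "finite (possible_clauses r U)" if "U \<in> ?U" for U :: "nat set"
    using that by (intro finite_possible_clauses) (auto intro: finite_subset)
  then have "finite {Q. Q \<subseteq> possible_clauses r U \<and> card Q = s}" if "U \<in> ?U" for U :: "nat set"
    using finite_subset[of _ "Pow (possible_clauses r U)"] that by simp
  then have "finite ?R" using finU by blast
  ultimately have "card ?L \<le> card ?R" by (rule card_mono[rotated])
  also have "\<dots> \<le> (\<Sum>U\<in>?U. card {Q. Q \<subseteq> possible_clauses r U \<and> card Q = s})"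
    using finU by (rule card_UN_le)
  also have "\<dots> \<le> (\<Sum>U\<in>?U. ((2 * v) ^ r) ^ s)"
  proof (rule sum_mono)
    fix U assume U: "U \<in> ?U"
    then have fU: "finite U" by (auto intro: finite_subset)
    have "card {Q. Q \<subseteq> possible_clauses r U \<and> card Q = s} = card (possible_clauses r U) choose s"
      by (rule n_subsets[OF fin[OF U]])
    also have "\<dots> \<le> card (possible_clauses r U) ^ s"
      by (rule binomial_le_power)
    also have "\<dots> \<le> ((2 * v) ^ r) ^ s"
      using card_possible_clauses_le[OF fU, of r] U by (intro power_mono) auto
    finally show "card {Q. Q \<subseteq> possible_clauses r U \<and> card Q = s} \<le> ((2 * v) ^ r) ^ s" .
  qed
  also have "\<dots> = (n choose v) * ((2 * v) ^ r) ^ s" using n_subsets[of "{..<n}" v] by simp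
  also have "\<dots> \<le> n ^ v * ((2 * v) ^ r) ^ s"
    by (intro mult_right_mono binomial_le_power) simp
  finally show ?thesis .
qed

text \<open>First-moment estimate: sets with \<open>s\<close> clauses and \<open>v\<close> variables
  contribute about \<open>n ^ v / n ^ ((r - 1) * s)\<close>, and the power of \<open>n\<close> saved
  is exactly the excess.\<close>

lemma sum_dense_sets_le:
  fixes a A :: real
  assumes r: "r > 0" and n: "n > 0" and a: "0 \<le> a" "a \<le> A" "1 \<le> A"
  shows "(\<Sum>Q\<in>dense_sets r (possible_clauses r {..<n}) s0 K. (a / real n ^ (r - 1)) ^ card Q)
    \<le> dense_bound r A s0 / real n ^ K"
proof -
  let ?E = "possible_clauses r {..<n}"
  let ?S = "dense_sets r ?E s0 K"
  let ?p = "a / real n ^ (r - 1)"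
  let ?g = "\<lambda>Q. (card Q, card (cvars Q))"
  let ?T = "{..s0} \<times> {..r * s0}"
  let ?M = "(2 * real (r * s0) + 1) ^ (r * s0) * A ^ s0"
  have finS: "finite ?S"
    unfolding dense_sets_def using finite_possible_clauses[of "{..<n}" r]
    by (auto intro: finite_subset[of _ "Pow ?E"])
  have gT: "?g ` ?S \<subseteq> ?T"
  proof (rule image_subsetI)
    fix Q assume "Q \<in> ?S"
    then have Q: "Q \<subseteq> ?E" "card Q \<le> s0" by (auto simp: dense_sets_def)
    have "card (cvars Q) \<le> r * s0"
      using card_cvars_le[OF Q(1) r] Q(2) mult_le_mono2[OF Q(2), of r] by linarith
    then show "?g Q \<in> ?T" using Q by simp
  qed
  have fib: "(\<Sum>Q | Q \<in> ?S \<and> ?g Q = t. ?p ^ card Q) \<le> ?M / real n ^ K" if t: "t \<in> ?T" for t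
  proof -
    obtain s v where sv: "t = (s, v)" "s \<le> s0" "v \<le> r * s0" using t by auto
    have M0: "0 \<le> ?M / real n ^ K" using a by simp
    show ?thesis
    proof (cases "{Q. Q \<in> ?S \<and> ?g Q = t} = {}")
      case True
      then show ?thesis using M0 by (simp only: True sum.empty)
    next
      case False
      then obtain Q0 where "Q0 \<in> ?S" "card Q0 = s" "card (cvars Q0) = v" using sv by auto
      then have Q0: "(int r - 1) * int s - int v \<ge> int K" "v \<le> r * s"
        using card_cvars_le[OF _ r, of Q0 "{..<n}"] by (auto simp: dense_sets_def clause_excess_def)
      \<comment> \<open>The lower bound on the excess, rewritten in natural numbers so that the
        powers of \<open>n\<close> can be compared.\<close>
      have "int (v + K) \<le> int ((r - 1) * s)" using Q0(1) r by (simp add: of_nat_diff)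
      then have vK: "v + K \<le> (r - 1) * s" by (simp only: of_nat_le_iff)
      have "(\<Sum>Q | Q \<in> ?S \<and> ?g Q = t. ?p ^ card Q) = (\<Sum>Q | Q \<in> ?S \<and> ?g Q = t. ?p ^ s)"
        by (intro sum.cong refl) (auto simp: sv)
      also have "\<dots> = real (card {Q. Q \<in> ?S \<and> ?g Q = t}) * ?p ^ s" by simp
      also have "\<dots> \<le> real (n ^ v * ((2 * v) ^ r) ^ s) * ?p ^ s"
      proof (intro mult_right_mono)
        have "card {Q. Q \<in> ?S \<and> ?g Q = t} \<le> card {Q. Q \<subseteq> ?E \<and> card Q = s \<and> card (cvars Q) = v}"
          using finite_possible_clauses[of "{..<n}" r]
          by (intro card_mono) (auto simp: dense_sets_def sv intro: finite_subset[of _ "Pow ?E"])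
        also have "\<dots> \<le> n ^ v * ((2 * v) ^ r) ^ s" by (rule card_sets_with_cvars_le)
        finally show "real (card {Q. Q \<in> ?S \<and> ?g Q = t}) \<le> real (n ^ v * ((2 * v) ^ r) ^ s)"
          by (simp only: of_nat_le_iff)
      qed (use a in simp)
      also have "\<dots> = (real n ^ v / real n ^ ((r - 1) * s)) * (real (2 * v) ^ (r * s) * a ^ s)"
        unfolding of_nat_mult of_nat_power power_mult power_divide by simp
      also have "\<dots> \<le> (1 / real n ^ K) * ((2 * real (r * s0) + 1) ^ (r * s0) * A ^ s0)"
      proof (intro mult_mono)
        have "real n ^ v * real n ^ K \<le> 1 * real n ^ ((r - 1) * s)"
          using n vK by (simp flip: power_add add: power_increasing)
        then show "real n ^ v / real n ^ ((r - 1) * s) \<le> 1 / real n ^ K"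
          using n by (simp add: field_simps)
        have "real v \<le> real (r * s0)" using sv(3) by (simp only: of_nat_le_iff)
        then have "real (2 * v) ^ (r * s) \<le> (2 * real (r * s0) + 1) ^ (r * s)"
          by (intro power_mono) auto
        \<comment> \<open>The extra 1 keeps the base at least 1, so the power is monotone in the
          exponent; for the other factor \<open>1 \<le> A\<close> does the same.\<close>
        also have "\<dots> \<le> (2 * real (r * s0) + 1) ^ (r * s0)"
          using sv by (intro power_increasing) auto
        finally show "real (2 * v) ^ (r * s) \<le> (2 * real (r * s0) + 1) ^ (r * s0)" .
        have "a ^ s \<le> A ^ s" using a by (intro power_mono) auto
        also have "\<dots> \<le> A ^ s0" using a sv by (intro power_increasing) auto
        finally show "a ^ s \<le> A ^ s0" .
      qed (use a in auto)
      finally show ?thesis by simp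
    qed
  qed
  have "(\<Sum>Q\<in>?S. ?p ^ card Q) = (\<Sum>t\<in>?T. \<Sum>Q | Q \<in> ?S \<and> ?g Q = t. ?p ^ card Q)"
    using finS gT by (intro sum.group[symmetric]) auto
  also have "\<dots> \<le> (\<Sum>t\<in>?T. ?M / real n ^ K)" by (intro sum_mono fib)
  also have "\<dots> = real (card ?T) * (?M / real n ^ K)" by simp
  also have "\<dots> = dense_bound r A s0 / real n ^ K"
    by (simp add: dense_bound_def card_cartesian_product algebra_simps)
  finally show ?thesis .
qed

lemma prob_dense_le:
  fixes E :: "'v clause set"
  assumes "finite E" "0 \<le> p" "p \<le> 1"
  shows "measure_pmf.prob (rsub p E) {X. \<exists>Q\<in>dense_sets r E s0 K. Q \<subseteq> X}
    \<le> (\<Sum>Q\<in>dense_sets r E s0 K. p ^ card Q)"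
proof -
  have fin: "finite (dense_sets r E s0 K)"
    unfolding dense_sets_def using assms by (auto intro: finite_subset[of _ "Pow E"])
  have "measure_pmf.prob (rsub p E) (\<Union>Q\<in>dense_sets r E s0 K. {X. Q \<subseteq> X})
      \<le> (\<Sum>Q\<in>dense_sets r E s0 K. measure_pmf.prob (rsub p E) {X. Q \<subseteq> X})"
    using fin by (intro measure_pmf.finite_measure_subadditive_finite) auto
  also have "\<dots> = (\<Sum>Q\<in>dense_sets r E s0 K. p ^ card Q)"
    using assms by (intro sum.cong refl prob_rsub_superset) (auto simp: dense_sets_def)
  also have "(\<Union>Q\<in>dense_sets r E s0 K. {X. Q \<subseteq> X}) = {X. \<exists>Q\<in>dense_sets r E s0 K. Q \<subseteq> X}" by auto
  finally show ?thesis .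
qed

section \<open>Isomorphisms and copies\<close>

abbreviation clause_map :: "('v \<Rightarrow> 'w) \<Rightarrow> 'v set \<Rightarrow> 'v clause \<Rightarrow> 'w clause" where
  "clause_map \<pi> S \<equiv> \<lambda>C. lit_map \<pi> S ` C"

section \<open>Composition, inversion and invariants of isomorphisms\<close>

definition wf_formula :: "'v formula \<Rightarrow> bool" where
  "wf_formula F \<longleftrightarrow> finite (vars F) \<and> (\<forall>C\<in>clauses F. C \<subseteq> vars F \<times> UNIV)"

lemma sat_formula_imp_wf: "sat_formula r F \<Longrightarrow> wf_formula F"
  by (auto simp: sat_formula_def wf_formula_def possible_clauses_def)

text \<open>Two sign flips cancel, so the flipped variables form a symmetric difference; restriction
  keeps the bijection extensional, as \<open>isos\<close> demands.\<close>

definition iso_comp :: "'v set \<Rightarrow> (('w \<Rightarrow> 'u) \<times> 'w set) \<Rightarrow> (('v \<Rightarrow> 'w) \<times> 'v set) \<Rightarrow> (('v \<Rightarrow> 'u) \<times> 'v set)" where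
  "iso_comp V = (\<lambda>(\<rho>, T) (\<pi>, S). (restrict (\<rho> \<circ> \<pi>) V, {x \<in> V. (x \<in> S) \<noteq> (\<pi> x \<in> T)}))"

definition iso_inv :: "'v set \<Rightarrow> 'w set \<Rightarrow> (('v \<Rightarrow> 'w) \<times> 'v set) \<Rightarrow> (('w \<Rightarrow> 'v) \<times> 'w set)" where
  "iso_inv V W = (\<lambda>(\<pi>, S). (restrict (inv_into V \<pi>) W, \<pi> ` S))"

lemma lit_map_comp:
  assumes "l \<in> V \<times> UNIV"
  shows "lit_map \<rho> T (lit_map \<pi> S l) = lit_map (restrict (\<rho> \<circ> \<pi>) V) {x \<in> V. (x \<in> S) \<noteq> (\<pi> x \<in> T)} l"
  using assms by (cases l) (auto simp: lit_map_def)

lemma inj_on_lit_map: "inj_on \<pi> V \<Longrightarrow> inj_on (lit_map \<pi> S) (V \<times> UNIV)"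
  by (auto simp: inj_on_def lit_map_def)

lemma iso_comp_isos:
  assumes F: "wf_formula F" and a: "(\<pi>, S) \<in> isos F G" and b: "(\<rho>, T) \<in> isos G H"
  shows "iso_comp (vars F) (\<rho>, T) (\<pi>, S) \<in> isos F H"
proof -
  let ?\<sigma> = "restrict (\<rho> \<circ> \<pi>) (vars F)" and ?U = "{x \<in> vars F. (x \<in> S) \<noteq> (\<pi> x \<in> T)}"
  have "bij_betw (\<rho> \<circ> \<pi>) (vars F) (vars H)"
    using a b by (auto simp: isos_def intro: bij_betw_trans)
  then have bij: "bij_betw ?\<sigma> (vars F) (vars H)" by (simp add: bij_betw_restrict_eq)
  have "clause_map ?\<sigma> ?U C = clause_map \<rho> T (clause_map \<pi> S C)" if "C \<in> clauses F" for C
  proof -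
    have "C \<subseteq> vars F \<times> UNIV" using F that by (auto simp: wf_formula_def)
    then show ?thesis
      unfolding image_image using lit_map_comp[of _ "vars F" \<rho> T \<pi> S] by (intro image_cong refl) auto
  qed
  then have "clause_map ?\<sigma> ?U ` clauses F = clause_map \<rho> T ` clause_map \<pi> S ` clauses F"
    by (simp add: image_image)
  also have "\<dots> = clauses H" using a b by (simp add: isos_def)
  finally show ?thesis using bij by (simp add: isos_def iso_comp_def)
qed

lemma iso_inv_isos:
  assumes F: "wf_formula F" and a: "(\<pi>, S) \<in> isos F G"
  shows "iso_inv (vars F) (vars G) (\<pi>, S) \<in> isos G F"
proof -
  let ?\<rho> = "restrict (inv_into (vars F) \<pi>) (vars G)" and ?T = "\<pi> ` S"
  have bij: "bij_betw \<pi> (vars F) (vars G)" and S: "S \<subseteq> vars F"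
    and cl: "clause_map \<pi> S ` clauses F = clauses G" using a by (auto simp: isos_def)
  have bij': "bij_betw ?\<rho> (vars G) (vars F)"
    using bij_betw_inv_into[OF bij] by (simp add: bij_betw_restrict_eq)
  have l: "lit_map ?\<rho> ?T (lit_map \<pi> S l) = l" if "l \<in> vars F \<times> UNIV" for l
  proof -
    obtain x b where xb: "l = (x, b)" "x \<in> vars F" using \<open>l \<in> vars F \<times> UNIV\<close> by auto
    have inj: "inj_on \<pi> (vars F)" using bij by (simp add: bij_betw_def)
    have "\<pi> x \<in> vars G" using bij xb by (auto simp: bij_betw_def)
    moreover have "\<pi> x \<in> \<pi> ` S \<longleftrightarrow> x \<in> S" using inj S xb by (auto simp: inj_on_def)
    moreover have "inv_into (vars F) \<pi> (\<pi> x) = x" using inj xb by simp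
    ultimately show ?thesis using xb by (auto simp: lit_map_def)
  qed
  have "clause_map ?\<rho> ?T (clause_map \<pi> S C) = C" if "C \<in> clauses F" for C
  proof -
    have "C \<subseteq> vars F \<times> UNIV" using F that by (auto simp: wf_formula_def)
    then have "clause_map ?\<rho> ?T (clause_map \<pi> S C) = (\<lambda>l. l) ` C"
      unfolding image_image using l by (intro image_cong refl) auto
    then show ?thesis by simp
  qed
  then have "clause_map ?\<rho> ?T ` clause_map \<pi> S ` clauses F = (\<lambda>C. C) ` clauses F"
    unfolding image_image by (intro image_cong refl) auto
  then have "clause_map ?\<rho> ?T ` clauses G = clauses F" unfolding cl by simp
  moreover have "?T \<subseteq> vars G" using S bij by (auto simp: bij_betw_def)
  ultimately show ?thesis using bij' by (simp add: isos_def iso_inv_def)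
qed

lemma isomorphic_refl:
  assumes "wf_formula F"
  shows "isomorphic F F"
proof -
  let ?i = "restrict id (vars F)"
  have "clause_map ?i {} C = C" if "C \<in> clauses F" for C
  proof -
    have "C \<subseteq> vars F \<times> UNIV" using assms that by (auto simp: wf_formula_def)
    then have "clause_map ?i {} C = (\<lambda>l. l) ` C"
      by (intro image_cong refl) (auto simp: lit_map_def)
    then show ?thesis by simp
  qed
  then have "clause_map ?i {} ` clauses F = (\<lambda>C. C) ` clauses F" by (intro image_cong refl) auto
  moreover have "bij_betw ?i (vars F) (vars F)" by (simp add: bij_betw_restrict_eq)
  ultimately have "(?i, {}) \<in> isos F F" by (simp add: isos_def)
  then show ?thesis unfolding isomorphic_def by blast
qed

lemma isomorphicE:
  assumes "isomorphic F G"
  obtains \<pi> S where "(\<pi>, S) \<in> isos F G"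
  using assms unfolding isomorphic_def by auto

lemma isomorphicI: "i \<in> isos F G \<Longrightarrow> isomorphic F G"
  unfolding isomorphic_def by blast

lemma isomorphic_trans: "wf_formula F \<Longrightarrow> isomorphic F G \<Longrightarrow> isomorphic G H \<Longrightarrow> isomorphic F H"
  by (elim isomorphicE) (rule isomorphicI, rule iso_comp_isos)

lemma isomorphic_sym: "wf_formula F \<Longrightarrow> isomorphic F G \<Longrightarrow> isomorphic G F"
  by (elim isomorphicE) (rule isomorphicI, rule iso_inv_isos)

lemma clause_map_inj:
  assumes "wf_formula F" "(\<pi>, S) \<in> isos F G"
  shows "inj_on (clause_map \<pi> S) (Pow (vars F \<times> UNIV))"
  using inj_on_image_Pow[OF inj_on_lit_map[of \<pi> "vars F" S]] assms by (simp add: isos_def bij_betw_def)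

lemma isomorphic_card:
  assumes F: "wf_formula F" and iso: "isomorphic F G"
  shows "card (vars G) = card (vars F)" "card (clauses G) = card (clauses F)" "excess r G = excess r F"
proof -
  obtain \<pi> S where i: "(\<pi>, S) \<in> isos F G" using iso by (rule isomorphicE)
  show v: "card (vars G) = card (vars F)" using i by (auto simp: isos_def dest: bij_betw_same_card)
  have "clauses F \<subseteq> Pow (vars F \<times> UNIV)" using F by (auto simp: wf_formula_def)
  then have "inj_on (clause_map \<pi> S) (clauses F)"
    using clause_map_inj[OF F i] inj_on_subset by blast
  then show "card (clauses G) = card (clauses F)"
    using i card_image by (fastforce simp: isos_def)
  then show "excess r G = excess r F" using v by (simp add: excess_def)
qed

lemma clause_map_possible_clauses:
  assumes "inj_on \<pi> V" "C \<in> possible_clauses r V"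
  shows "clause_map \<pi> S C \<in> possible_clauses r (\<pi> ` V)"
proof -
  have C: "C \<subseteq> V \<times> UNIV" "inj_on fst C" "card C = r" using assms(2) by (simp_all add: possible_clauses_def)
  have "inj_on (lit_map \<pi> S) C" using inj_on_lit_map[OF assms(1)] C(1) inj_on_subset by blast
  then have "card (clause_map \<pi> S C) = r" using C(3) card_image by blast
  moreover have "clause_map \<pi> S C \<subseteq> \<pi> ` V \<times> UNIV" using C(1) by (auto simp: lit_map_def)
  moreover have "inj_on fst (clause_map \<pi> S C)"
  proof (rule inj_onI)
    fix k l assume "k \<in> clause_map \<pi> S C" "l \<in> clause_map \<pi> S C" and eq: "fst k = fst l"
    then obtain k' l' where kl: "k' \<in> C" "l' \<in> C" "k = lit_map \<pi> S k'" "l = lit_map \<pi> S l'" by blast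
    then have "fst k' \<in> V" "fst l' \<in> V" "\<pi> (fst k') = \<pi> (fst l')"
      using C(1) eq by (auto simp: lit_map_def split: prod.splits)
    then have "fst k' = fst l'" using assms(1) by (simp add: inj_on_eq_iff)
    then show "k = l" using kl C(2) inj_onD by fastforce
  qed
  ultimately show ?thesis by (simp add: possible_clauses_def)
qed

definition apply_iso :: "('v \<Rightarrow> 'w) \<Rightarrow> 'v set \<Rightarrow> 'v formula \<Rightarrow> 'w formula" where
  "apply_iso \<pi> S F = Formula (\<pi> ` vars F) (clause_map \<pi> S ` clauses F)"

lemma sat_formula_apply_iso:
  assumes "inj_on \<pi> (vars F)" "sat_formula r F"
  shows "sat_formula r (apply_iso \<pi> S F)"
  using assms clause_map_possible_clauses[OF assms(1)] by (auto simp: sat_formula_def apply_iso_def)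

lemma isos_apply_iso: "(\<pi>, S) \<in> isos F G \<Longrightarrow> apply_iso \<pi> S F = G"
  by (cases G) (auto simp: isos_def apply_iso_def bij_betw_def)

lemma isomorphic_sat_formula:
  assumes F: "sat_formula r F" and iso: "isomorphic F G"
  shows "sat_formula r G"
proof -
  obtain \<pi> S where i: "(\<pi>, S) \<in> isos F G" using iso by (rule isomorphicE)
  then have "inj_on \<pi> (vars F)" by (simp add: isos_def bij_betw_def)
  then show ?thesis using sat_formula_apply_iso[OF _ F, of \<pi> S] isos_apply_iso[OF i] by simp
qed

lemma satisfiable_apply_iso:
  assumes "satisfiable (apply_iso \<pi> S F)"
  shows "satisfiable F"
proof -
  from assms obtain A where A: "\<And>C. C \<in> clauses F \<Longrightarrow> \<exists>(x, b)\<in>clause_map \<pi> S C. A x = b"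
    by (auto simp: satisfiable_def apply_iso_def)
  have *: "\<exists>(x, b)\<in>C. (A (\<pi> x) \<noteq> (x \<in> S)) = b" if "C \<in> clauses F" for C
  proof -
    from A[OF that] obtain y c where "(y, c) \<in> C" "A (\<pi> y) = (c \<noteq> (y \<in> S))"
      by (auto simp: lit_map_def)
    then show ?thesis by (intro bexI[of _ "(y, c)"]) auto
  qed
  show ?thesis unfolding satisfiable_def by (intro exI[of _ "\<lambda>x. A (\<pi> x) \<noteq> (x \<in> S)"] ballI *)
qed

text \<open>A proper subformula of \<open>G\<close> is carried back by an inverse isomorphism to a
  proper subformula of \<open>F\<close>, and satisfiability of the image passes to the original by
  \<open>satisfiable_apply_iso\<close>.\<close>

lemma isomorphic_muf:
  assumes F: "muf r F" and iso: "isomorphic F G"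
  shows "muf r G"
proof -
  have satF: "sat_formula r F" and wfF: "wf_formula F"
    using F sat_formula_imp_wf by (auto simp: muf_def)
  obtain \<pi> S where i: "(\<pi>, S) \<in> isos F G" using iso by (rule isomorphicE)
  have satG: "sat_formula r G" using satF iso by (rule isomorphic_sat_formula)
  have wfG: "wf_formula G" using satG by (rule sat_formula_imp_wf)
  obtain \<rho> T where j: "(\<rho>, T) \<in> isos G F" using isomorphic_sym[OF wfF iso] by (rule isomorphicE)
  have aj: "apply_iso \<rho> T G = F" using isos_apply_iso[OF j] .
  have injr: "inj_on \<rho> (vars G)" using j by (auto simp: isos_def bij_betw_def)
  have unsat: "\<not> satisfiable G"
    using satisfiable_apply_iso[of \<pi> S F] F isos_apply_iso[OF i] by (auto simp: muf_def)
  have "satisfiable H" if H: "subformula r H G" "H \<noteq> G" for H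
  proof -
    let ?H = "apply_iso \<rho> T H"
    have sub: "vars H \<subseteq> vars G" "clauses H \<subseteq> clauses G" "sat_formula r H" using H by (auto simp: subformula_def)
    have "inj_on \<rho> (vars H)" using injr sub(1) by (rule inj_on_subset)
    then have "sat_formula r ?H" using sub by (intro sat_formula_apply_iso)
    moreover have "vars ?H \<subseteq> vars F" "clauses ?H \<subseteq> clauses F"
      unfolding aj[symmetric] using sub by (auto simp: apply_iso_def)
    ultimately have s: "subformula r ?H F" by (simp add: subformula_def)
    \<comment> \<open>Properness survives because the inverse isomorphism is injective on variables
      and on clauses.\<close>
    have "?H \<noteq> F"
    proof
      assume eq: "?H = F"
      have "\<rho> ` vars H = \<rho> ` vars G" using eq aj by (metis apply_iso_def formula.sel(1))
      then have v: "vars H = vars G" using inj_on_image_eq_iff[OF injr sub(1) order_refl] by simp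
      have "clause_map \<rho> T ` clauses H = clause_map \<rho> T ` clauses G"
        using eq aj by (metis apply_iso_def formula.sel(2))
      moreover have "clauses H \<subseteq> Pow (vars G \<times> UNIV)" "clauses G \<subseteq> Pow (vars G \<times> UNIV)"
        using wfG sub(2) by (auto simp: wf_formula_def)
      ultimately have "clauses H = clauses G"
        using inj_on_image_eq_iff[OF clause_map_inj[OF wfG j]] by simp
      then show False using v H(2) by (cases H; cases G) simp
    qed
    then have "satisfiable ?H" using F s by (simp add: muf_def)
    then show ?thesis by (rule satisfiable_apply_iso)
  qed
  then show ?thesis using satG unsat by (simp add: muf_def)
qed

lemma finite_isos:
  assumes "finite (vars F)" "finite (vars G)"
  shows "finite (isos F G)"
proof -
  have "isos F G \<subseteq> (vars F \<rightarrow>\<^sub>E vars G) \<times> Pow (vars F)"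
    by (auto simp: isos_def PiE_def bij_betw_def)
  moreover have "finite ((vars F \<rightarrow>\<^sub>E vars G) \<times> Pow (vars F))"
    using assms by (intro finite_cartesian_product finite_PiE) auto
  ultimately show ?thesis by (rule finite_subset)
qed

text \<open>Composition with the fixed isomorphism from \<open>G\<close> to \<open>H\<close> is
  injective. Used in both directions, this shows that every nonempty \<open>isos F G\<close> is as
  large as \<open>aut F\<close>.\<close>

lemma card_isos_le:
  assumes F: "wf_formula F" and fin: "finite (vars H)" and j: "(\<rho>, T) \<in> isos G H"
  shows "card (isos F G) \<le> card (isos F H)"
proof (rule card_inj_on_le)
  show "finite (isos F H)" using F fin by (intro finite_isos) (auto simp: wf_formula_def)
  show "iso_comp (vars F) (\<rho>, T) ` isos F G \<subseteq> isos F H"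
    using iso_comp_isos[OF F _ j] by auto
  show "inj_on (iso_comp (vars F) (\<rho>, T)) (isos F G)"
  proof (rule inj_onI)
    fix i k assume ik: "i \<in> isos F G" "k \<in> isos F G" and eq: "iso_comp (vars F) (\<rho>, T) i = iso_comp (vars F) (\<rho>, T) k"
    obtain \<pi> S \<sigma> U where i: "i = (\<pi>, S)" and k: "k = (\<sigma>, U)" by (cases i; cases k)
    have ext: "\<pi> \<in> extensional (vars F)" "\<sigma> \<in> extensional (vars F)"
      and sub: "S \<subseteq> vars F" "U \<subseteq> vars F"
      and im: "\<pi> ` vars F = vars G" "\<sigma> ` vars F = vars G"
      using ik by (auto simp: i k isos_def bij_betw_def)
    have inj: "inj_on \<rho> (vars G)" using j by (auto simp: isos_def bij_betw_def)
    from eq have e1: "restrict (\<rho> \<circ> \<pi>) (vars F) = restrict (\<rho> \<circ> \<sigma>) (vars F)"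
      and e2: "{x \<in> vars F. (x \<in> S) \<noteq> (\<pi> x \<in> T)} = {x \<in> vars F. (x \<in> U) \<noteq> (\<sigma> x \<in> T)}"
      by (auto simp: i k iso_comp_def)
    have pt: "\<pi> x = \<sigma> x" if "x \<in> vars F" for x
    proof -
      have "\<rho> (\<pi> x) = \<rho> (\<sigma> x)" using fun_cong[OF e1, of x] that by simp
      moreover have "\<pi> x \<in> vars G" "\<sigma> x \<in> vars G" using im that by auto
      ultimately show ?thesis using inj by (simp add: inj_on_eq_iff)
    qed
    then have "\<pi> = \<sigma>" using ext by (intro extensionalityI)
    moreover have "S = U"
    proof (intro set_eqI)
      fix x
      show "x \<in> S \<longleftrightarrow> x \<in> U"
      proof (cases "x \<in> vars F")
        case True
        then have "((x \<in> S) \<noteq> (\<pi> x \<in> T)) = ((x \<in> U) \<noteq> (\<sigma> x \<in> T))"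
          using e2 by blast
        then show ?thesis using pt[OF True] by auto
      qed (use sub in auto)
    qed
    ultimately show "i = k" by (simp add: i k)
  qed
qed

lemma card_isos_eq_aut:
  assumes F: "wf_formula F" and G: "wf_formula G" and iso: "isomorphic F G"
  shows "card (isos F G) = card (aut F)"
proof -
  obtain \<pi> S where i: "(\<pi>, S) \<in> isos F G" using iso by (rule isomorphicE)
  obtain \<rho> T where j: "(\<rho>, T) \<in> isos G F" using isomorphic_sym[OF F iso] by (rule isomorphicE)
  show ?thesis unfolding aut_def
    using card_isos_le[OF F _ i] card_isos_le[OF F _ j] F G by (intro antisym) (auto simp: wf_formula_def)
qed

lemma card_aut_pos:
  assumes "wf_formula F"
  shows "card (aut F) > 0"
  using isomorphic_refl[OF assms] finite_isos[of F F] assms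
  by (auto simp: aut_def isomorphic_def wf_formula_def card_gt_0_iff)

section \<open>Counting labelled copies\<close>

definition copies :: "nat \<Rightarrow> 'v formula \<Rightarrow> nat formula set" where
  "copies n F = {G. vars G \<subseteq> {..<n} \<and> isomorphic F G}"

text \<open>Orbit counting: pairs of an injection into \<open>{..<n}\<close> and a sign set map onto
  the copies, and the pairs over a copy \<open>G\<close> form \<open>isos F G\<close>, which has
  \<open>card (aut F)\<close> elements. Truncated subtraction makes the product 0 when
  \<open>n\<close> is less than the order of \<open>F\<close>.\<close>

lemma card_copies:
  assumes F: "sat_formula r F"
  shows "finite (copies n F)"
    "card (copies n F) * card (aut F) = (\<Prod>j<card (vars F). n - j) * 2 ^ card (vars F)"
proof -
  have wf: "wf_formula F" and fin: "finite (vars F)"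
    using F sat_formula_imp_wf by (auto simp: sat_formula_def)
  let ?I = "{\<pi> \<in> vars F \<rightarrow>\<^sub>E {..<n}. inj_on \<pi> (vars F)} \<times> Pow (vars F)"
  have "finite (vars F \<rightarrow>\<^sub>E {..<n})" using fin by (intro finite_PiE) auto
  then have finI: "finite ?I" using fin by (intro finite_cartesian_product) auto
  have cop: "copies n F = (\<lambda>(\<pi>, S). apply_iso \<pi> S F) ` ?I" (is "_ = ?R")
  proof (intro set_eqI iffI)
    fix G assume "G \<in> copies n F"
    then have G: "vars G \<subseteq> {..<n}" "isomorphic F G" by (auto simp: copies_def)
    obtain \<pi> S where i: "(\<pi>, S) \<in> isos F G" using G(2) by (rule isomorphicE)
    then have "(\<pi>, S) \<in> ?I" using G(1) by (auto simp: isos_def PiE_def bij_betw_def)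
    then show "G \<in> ?R" using isos_apply_iso[OF i] by (intro image_eqI[of _ _ "(\<pi>, S)"]) auto
  next
    fix G assume "G \<in> ?R"
    then obtain \<pi> S where p: "G = apply_iso \<pi> S F" "\<pi> \<in> vars F \<rightarrow>\<^sub>E {..<n}" "inj_on \<pi> (vars F)" "S \<subseteq> vars F"
      by auto
    then have "(\<pi>, S) \<in> isos F G" by (auto simp: isos_def PiE_def apply_iso_def bij_betw_def)
    then show "G \<in> copies n F"
      using p isomorphicI by (auto simp: copies_def apply_iso_def)
  qed
  then show finc: "finite (copies n F)" using finI by simp
  have wfG: "wf_formula G" if "G \<in> copies n F" for G
    using isomorphic_sat_formula[OF F] that sat_formula_imp_wf unfolding copies_def by auto
  have "?I = (\<Union>G\<in>copies n F. isos F G)"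
  proof (intro set_eqI iffI)
    fix i assume i: "i \<in> ?I"
    obtain \<pi> S where pi: "i = (\<pi>, S)" by (cases i)
    have "i \<in> isos F (apply_iso \<pi> S F)"
      using i by (auto simp: pi isos_def PiE_def apply_iso_def bij_betw_def)
    moreover have "apply_iso \<pi> S F \<in> copies n F" unfolding cop using i pi by (intro image_eqI[of _ _ i]) auto
    ultimately show "i \<in> (\<Union>G\<in>copies n F. isos F G)" by blast
  next
    fix i assume "i \<in> (\<Union>G\<in>copies n F. isos F G)"
    then show "i \<in> ?I" by (auto simp: copies_def isos_def PiE_def bij_betw_def)
  qed
  then have "card ?I = (\<Sum>G\<in>copies n F. card (isos F G))"
  proof (simp only:, intro card_UN_disjoint finc ballI impI)
    fix G assume "G \<in> copies n F"
    then show "finite (isos F G)" using fin by (intro finite_isos) (auto simp: copies_def intro: finite_subset)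
  next
    fix G H :: "nat formula" assume "G \<noteq> H"
    show "isos F G \<inter> isos F H = {}"
    proof (rule ccontr)
      assume "isos F G \<inter> isos F H \<noteq> {}"
      then obtain \<pi> S where "(\<pi>, S) \<in> isos F G" "(\<pi>, S) \<in> isos F H" by auto
      then have "G = H" using isos_apply_iso by metis
      then show False using \<open>G \<noteq> H\<close> by simp
    qed
  qed
  also have "\<dots> = (\<Sum>G\<in>copies n F. card (aut F))"
    using card_isos_eq_aut[OF wf wfG] by (intro sum.cong refl) (auto simp: copies_def)
  also have "\<dots> = card (copies n F) * card (aut F)" by simp
  finally have "card (copies n F) * card (aut F) = card ?I" by simp
  also have "\<dots> = (\<Prod>j<card (vars F). n - j) * 2 ^ card (vars F)"
    using card_inj_on_subset_funcset[OF fin, of "{..<n}" "vars F"] fin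
    by (simp add: card_cartesian_product card_Pow lessThan_atLeast0)
  finally show "card (copies n F) * card (aut F) = (\<Prod>j<card (vars F). n - j) * 2 ^ card (vars F)" .
qed

section \<open>Levels of minimal unsatisfiable formulas\<close>

lemma unsat_contains_muf:
  assumes "sat_formula r F" "\<not> satisfiable F"
  obtains G where "subformula r G F" "muf r G"
proof -
  define P where "P G \<longleftrightarrow> subformula r G F \<and> \<not> satisfiable G" for G
  define \<mu> where "\<mu> G = card (vars G) + card (clauses G)" for G :: "'a formula"
  have "P F" using assms by (simp add: P_def subformula_def)
  then obtain G where G: "P G" "\<And>H. P H \<Longrightarrow> \<mu> G \<le> \<mu> H" using ex_has_least_nat[of P F \<mu>] by auto
  then have sub: "sat_formula r G" "vars G \<subseteq> vars F" "clauses G \<subseteq> clauses F" "\<not> satisfiable G"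
    by (auto simp: P_def subformula_def)
  have fin: "finite (vars G)" "finite (clauses G)"
    using sub(1) finite_possible_clauses by (auto simp: sat_formula_def intro: finite_subset)
  have "satisfiable H" if H: "subformula r H G" "H \<noteq> G" for H
  proof (rule ccontr)
    assume "\<not> satisfiable H"
    then have "P H" using H sub by (auto simp: P_def subformula_def)
    then have le: "\<mu> G \<le> \<mu> H" by (rule G(2))
    have HG: "vars H \<subseteq> vars G" "clauses H \<subseteq> clauses G" using H by (auto simp: subformula_def)
    then have "card (vars H) \<le> card (vars G)" "card (clauses H) \<le> card (clauses G)"
      using fin by (auto intro: card_mono)
    then have "card (vars H) = card (vars G)" "card (clauses H) = card (clauses G)"
      using le by (auto simp: \<mu>_def)
    then have "vars H = vars G" "clauses H = clauses G" 
      using card_subset_eq[OF fin(1) HG(1)] card_subset_eq[OF fin(2) HG(2)] by simp_all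
    then show False using H(2) by (cases H; cases G) simp
  qed
  then have "muf r G" using sub by (auto simp: muf_def)
  then show ?thesis using that G(1) by (auto simp: P_def)
qed

text \<open>The case \<open>Q = {}\<close> of \<open>clause_excess_Un_muf\<close>. Bounding the size
  by the excess makes each level finite up to isomorphism.\<close>

lemma muf_card_clauses_le:
  assumes "r \<ge> 3" "muf r G"
  shows "int (card (clauses G)) \<le> 2 * excess r G" "0 < excess r G"
  using clause_excess_Un_muf[OF assms, of "{}"] muf_clauses_nonempty[OF assms(2)]
  by (auto simp: excess_muf[OF assms(2)] clause_excess_def)

lemma muf_card_vars_le:
  assumes r: "r \<ge> 3" and G: "muf r G"
  shows "card (vars G) \<le> r * card (clauses G)"
  unfolding muf_vars[OF G] using card_cvars_le[OF muf_finite(3)[OF G]] r by simp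

text \<open>The clauses below encode \<open>x\<^sub>0\<close>, \<open>x\<^sub>i \<longrightarrow> x\<^sub>i\<^sub>+\<^sub>1\<close> and \<open>\<not> x\<^sub>M\<close>, padded with
  further literals in all possible ways; no implication of the chain can be dropped.\<close>

definition chain_formula :: "nat \<Rightarrow> nat \<Rightarrow> nat formula" where
  "chain_formula r M = Formula {..M + r}
     {C \<in> possible_clauses r {..M + r}. (0, True) \<in> C \<or> (M, False) \<in> C \<or> (\<exists>i<M. (i, False) \<in> C \<and> (Suc i, True) \<in> C)}"

text \<open>Every assignment fails at the start, at the end, or at an implication where it drops
  from true to false. The one or two false literals responsible extend to a clause of
  \<open>r\<close> literals all false under it; the \<open>M + r + 1\<close> variables leave enough
  room.\<close>

lemma chain_formula_unsat:
  assumes r: "r \<ge> 2"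
  shows "\<not> satisfiable (chain_formula r M)"
proof
  assume "satisfiable (chain_formula r M)"
  then obtain A where A: "\<And>C. C \<in> clauses (chain_formula r M) \<Longrightarrow> \<exists>(x, b)\<in>C. A x = b"
    by (auto simp: satisfiable_def)
  let ?l = "\<lambda>x. (x, \<not> A x)"
  have core: False if D: "D \<subseteq> {..M + r}" "card D \<le> 2"
    and w: "\<And>C. ?l ` D \<subseteq> C \<Longrightarrow> (0, True) \<in> C \<or> (M, False) \<in> C \<or> (\<exists>i<M. (i, False) \<in> C \<and> (Suc i, True) \<in> C)"
      for D
  proof -
    obtain T where T: "D \<subseteq> T" "T \<subseteq> {..M + r}" "card T = r"
      using exists_subset_between[of D r "{..M + r}"] D r by auto
    have "inj_on ?l T" by (auto simp: inj_on_def)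
    then have "?l ` T \<in> possible_clauses r {..M + r}"
      using T by (auto simp: possible_clauses_def card_image inj_on_def)
    moreover have "?l ` D \<subseteq> ?l ` T" using T(1) by (rule image_mono)
    ultimately have "?l ` T \<in> clauses (chain_formula r M)" using w by (simp add: chain_formula_def)
    from A[OF this] show False by auto
  qed
  have step: "\<exists>i<m. A i \<and> \<not> A (Suc i)" if "A 0" "\<not> A m" for m
    using that
  proof (induction m)
    case (Suc m)
    then show ?case by (cases "A m") (auto simp: less_Suc_eq)
  qed simp
  consider "\<not> A 0" | "A M" | "A 0" "\<not> A M" by blast
  then show False
  proof cases
    case 1
    then show ?thesis by (intro core[of "{0}"]) auto
  next
    case 2
    then show ?thesis by (intro core[of "{M}"]) auto
  next
    case 3
    from step[OF this] obtain i where i: "i < M" "A i" "\<not> A (Suc i)" by blast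
    show ?thesis
    proof (rule core[of "{i, Suc i}"])
      fix C assume "?l ` {i, Suc i} \<subseteq> C"
      then have "(i, False) \<in> C \<and> (Suc i, True) \<in> C" using i by auto
      then show "(0, True) \<in> C \<or> (M, False) \<in> C \<or> (\<exists>i<M. (i, False) \<in> C \<and> (Suc i, True) \<in> C)"
        using i(1) by blast
    qed (use i in auto)
  qed
qed

text \<open>If the negation of variable \<open>i\<close> were absent, the assignment that is true
  exactly up to \<open>i\<close> would satisfy all clauses, as only the implication from
  \<open>i\<close> to \<open>Suc i\<close> fails under it.\<close>

lemma chain_muf_vars:
  assumes sub: "subformula r G (chain_formula r M)" and G: "muf r G"
  shows "{..<M} \<subseteq> vars G"
proof
  fix i assume "i \<in> {..<M}"
  then have i: "i < M" by simp
  have GC: "clauses G \<subseteq> clauses (chain_formula r M)" using sub by (simp add: subformula_def)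
  have "\<exists>C\<in>clauses G. (i, False) \<in> C"
  proof (rule ccontr)
    assume no: "\<not> ?thesis"
    have "\<exists>(x, b)\<in>C. (x \<le> i) = b" if C: "C \<in> clauses G" for C
    proof -
      from C GC have "(0, True) \<in> C \<or> (M, False) \<in> C \<or> (\<exists>j<M. (j, False) \<in> C \<and> (Suc j, True) \<in> C)"
        by (auto simp: chain_formula_def)
      then consider "(0, True) \<in> C" | "(M, False) \<in> C" | j where "(j, False) \<in> C" "(Suc j, True) \<in> C" by blast
      then show ?thesis
      proof cases
        case 1 then show ?thesis by (intro bexI[of _ "(0, True)"]) auto
      next
        case 2 then show ?thesis using i by (intro bexI[of _ "(M, False)"]) auto
      next
        case (3 j)
        have "j \<noteq> i" using 3 no C by blast
        then consider "j > i" | "Suc j \<le> i" by linarith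
        then show ?thesis
        proof cases
          case 1 then show ?thesis using 3 by (intro bexI[of _ "(j, False)"]) auto
        next
          case 2 then show ?thesis using 3 by (intro bexI[of _ "(Suc j, True)"]) auto
        qed
      qed
    qed
    then have "satisfiable G" unfolding satisfiable_def by (intro exI[of _ "\<lambda>x. x \<le> i"] ballI)
    then show False using G by (simp add: muf_def)
  qed
  then show "i \<in> vars G" unfolding muf_vars[OF G] using cvars_memI by fastforce
qed

text \<open>Infinitude makes \<open>enumerate\<close> in \<open>muf_excess\<close> return genuine
  excess values at every index. Long chains force many variables, hence many clauses, hence large
  excess.\<close>

lemma infinite_muf_excess:
  assumes r: "r \<ge> 3"
  shows "infinite {k. \<exists>F :: nat formula. muf r F \<and> excess r F = int k}"
  unfolding infinite_nat_iff_unbounded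
proof
  fix m :: nat
  \<comment> \<open>The factor \<open>r\<close> is lost from variables to clauses and the factor 2
    from clauses to excess.\<close>
  define M where "M = 2 * r * Suc m"
  have "sat_formula r (chain_formula r M)" by (auto simp: sat_formula_def chain_formula_def)
  moreover have "\<not> satisfiable (chain_formula r M)" using r by (intro chain_formula_unsat) simp
  ultimately obtain G where G: "subformula r G (chain_formula r M)" "muf r G" by (rule unsat_contains_muf)
  have "M = card {..<M}" by simp
  also have "\<dots> \<le> card (vars G)" using chain_muf_vars[OF G] muf_finite(1)[OF G(2)] by (rule card_mono[rotated])
  also have "\<dots> \<le> r * card (clauses G)" by (rule muf_card_vars_le[OF r G(2)])
  finally have "r * (2 * Suc m) \<le> r * card (clauses G)" by (simp add: M_def mult_ac)
  then have "2 * Suc m \<le> card (clauses G)" using r unfolding mult_le_cancel1 by auto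
  then have "int (2 * Suc m) \<le> int (card (clauses G))" by (simp only: of_nat_le_iff)
  then have "int (Suc m) \<le> excess r G" using muf_card_clauses_le(1)[OF r G(2)] by simp
  then show "\<exists>n>m. n \<in> {k. \<exists>F :: nat formula. muf r F \<and> excess r F = int k}"
    using G(2) by (intro exI[of _ "nat (excess r G)"]) auto
qed

lemma muf_level_nonempty:
  assumes "r \<ge> 3"
  shows "muf_level r s \<noteq> {}"
  using enumerate_in_set[OF infinite_muf_excess[OF assms], of "s - 1"]
  by (auto simp: muf_level_def muf_excess_def)

section \<open>Minimal unsatisfiable formulas of large excess\<close>

lemma prob_rsub_mono:
  assumes "\<And>X. X \<subseteq> E \<Longrightarrow> X \<in> A \<Longrightarrow> X \<in> B"
  shows "measure_pmf.prob (rsub p E) A \<le> measure_pmf.prob (rsub p E) B"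
proof (rule measure_pmf.finite_measure_mono_AE)
  show "AE X in measure_pmf (rsub p E). X \<in> A \<longrightarrow> X \<in> B"
    unfolding AE_measure_pmf_iff using assms by (intro ballI impI) (simp add: set_rsub)
qed auto

text \<open>Clearing denominators in \<open>a < pure_literal_fun r y\<close> gives exactly the
  subcriticality required of the survival map with
  \<open>L = a * 2 ^ (r - 1) / fact (r - 1)\<close>.\<close>

lemma below_threshold:
  assumes r: "r \<ge> 3" and a: "a < pure_literal_threshold r" and y: "y > 0"
  shows "a * 2 ^ (r - 1) / fact (r - 1) * (1 - exp (- y)) ^ (r - 1) < y"
proof -
  obtain y0 where "pure_literal_threshold r = pure_literal_fun r y0" "\<forall>z>0. pure_literal_fun r y0 \<le> pure_literal_fun r z"
    using pure_literal_threshold_attained[OF r] by auto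
  then have "a < pure_literal_fun r y" using a y by force
  moreover have "(1 - exp (- y)) ^ (r - 1) > 0" using y by simp
  ultimately show ?thesis by (simp add: pure_literal_fun_def field_simps)
qed

text \<open>The bound is the exponential of at most a quadratic in \<open>s\<close>, and
  \<open>s\<close> is of order log log \<open>n\<close>, so a single factor \<open>n\<close>
  dominates it.\<close>

lemma dense_bound_eventually_le:
  fixes s :: "nat \<Rightarrow> nat" and c1 c2 c3 A :: real
  assumes c: "c1 > 0" "c2 > 0" "c3 > 0" and A: "A \<ge> 1" and r: "r > 0"
    and s: "\<forall>\<^sub>F n in sequentially. real (s n) \<le> c1 + c2 * log 2 (c3 * log 2 (real n))"
  shows "\<forall>\<^sub>F n in sequentially. dense_bound r A (s n) \<le> real n"
proof -
  \<comment> \<open>The fourth root of \<open>ln n\<close> eventually exceeds any multiple of log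
    log \<open>n\<close>, while a quadratic in it stays below its fourth power
    \<open>ln n\<close>.\<close>
  define y where "y n = ln (real n) powr (1/4)" for n :: nat
  have e1: "\<forall>\<^sub>F n in sequentially. c1 + c2 * log 2 (c3 * log 2 (real n)) \<le> y n"
    unfolding y_def using c by real_asymp
  define R where "R = real r"
  have R: "R \<ge> 1" using r by (simp add: R_def)
  have "\<forall>\<^sub>F x in at_top. (R * x + x + 2) * (2 * R * x + 2 + A) \<le> (x::real) ^ 4"
    using R A by real_asymp
  moreover have "filterlim y at_top sequentially" unfolding y_def by real_asymp
  ultimately have e2: "\<forall>\<^sub>F n in sequentially. (R * y n + y n + 2) * (2 * R * y n + 2 + A) \<le> y n ^ 4"
    by (rule eventually_compose_filterlim)
  have e3: "\<forall>\<^sub>F n in sequentially. n \<ge> (3::nat)" by (rule eventually_ge_at_top)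
  show ?thesis using s e1 e2 e3
  proof eventually_elim
    case (elim n)
    define x where "x = real (s n)"
    define u where "u = 2 * R * x + 2 + A"
    have x: "0 \<le> x" "x \<le> y n" using elim by (auto simp: x_def)
    have Rx: "0 \<le> R * x" "x \<le> R * x" using x R mult_right_mono[of 1 R x] by auto
    have u: "u \<ge> 1" "x + 1 \<le> u" "R * x + 1 \<le> u" "2 * (R * x) + 1 \<le> u" "A \<le> u"
      using Rx A by (auto simp: u_def)
    have "dense_bound r A (s n) = (x + 1) * (R * x + 1) * ((2 * (R * x) + 1) ^ (r * s n) * A ^ s n)"
      by (simp add: dense_bound_def x_def R_def)
    also have "\<dots> \<le> u * u * (u ^ (r * s n) * u ^ s n)"
      using u x Rx A by (intro mult_mono power_mono mult_nonneg_nonneg) auto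
    also have "\<dots> = u ^ (r * s n + s n + 2)" by (simp add: power_add power2_eq_square)
    also have "\<dots> = exp (real (r * s n + s n + 2) * ln u)"
      using u by (subst exp_of_nat_mult) simp
    also have "real (r * s n + s n + 2) = R * x + x + 2" by (simp add: x_def R_def)
    also have "exp ((R * x + x + 2) * ln u) \<le> exp ((R * x + x + 2) * u)"
      unfolding exp_le_cancel_iff using u(1) Rx x ln_le_minus_one[of u] by (intro mult_left_mono) auto
    also have "(R * x + x + 2) * u \<le> (R * y n + y n + 2) * (2 * R * y n + 2 + A)"
      unfolding u_def using x R A by (intro mult_mono add_mono mult_left_mono) auto
    also have "\<dots> \<le> y n ^ 4" by (rule elim)
    also have "y n ^ 4 = ln (real n)"
      using \<open>n \<ge> 3\<close> by (simp add: y_def powr_power)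
    finally show ?case using \<open>n \<ge> 3\<close> by simp
  qed
qed

text \<open>Such a MUF contains a small dense set or yields a deep tree. One power of
  \<open>n\<close> is given away to \<open>dense_bound\<close>, so excess at least
  \<open>Suc K\<close> produces only the exponent \<open>K\<close>.\<close>

lemma prob_large_muf:
  fixes \<alpha> p :: "nat \<Rightarrow> real"
  assumes r: "r \<ge> 3" and \<alpha>: "\<And>n. n \<ge> 1 \<Longrightarrow> 0 \<le> \<alpha> n" "\<And>n. n \<ge> 1 \<Longrightarrow> \<alpha> n \<le> a"
    and a: "a < pure_literal_threshold r" and p: "\<And>n. p n = \<alpha> n / real n ^ (r - 1)"
  obtains c where "c > 0" "\<forall>\<^sub>F n in sequentially.
    measure_pmf.prob (rsub (p n) (possible_clauses r {..<n}))
      {X. \<exists>G. muf r G \<and> clauses G \<subseteq> X \<and> excess r G \<ge> int (Suc K)} \<le> c / real n ^ K"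
proof -
  \<comment> \<open>The gap between \<open>a\<close> and \<open>a'\<close> pays for the factor
    \<open>1 + \<eta>\<close>; the gap above \<open>a'\<close> keeps the iteration strictly
    subcritical.\<close>
  define a' where "a' = (a + pure_literal_threshold r) / 2"
  define L where "L = a' * 2 ^ (r - 1) / fact (r - 1)"
  have a0: "0 \<le> a" using \<alpha>[of 1] by simp
  have a': "a < a'" "a' < pure_literal_threshold r" using a by (auto simp: a'_def)
  have L: "L > 0" using a0 a' by (simp add: L_def)
  obtain t0 where t0: "\<And>s. L * (survival_map L r ^^ (t0 + s)) 1 \<le> (1/2) ^ 2 ^ s"
    using survival_iter_doubly_exponential[OF L r] below_threshold[OF r a'(2)] unfolding L_def by blast
  define \<eta> where "\<eta> = (a' - a) / (a + 1)"
  have \<eta>: "\<eta> > 0" using a0 a' by (simp add: \<eta>_def)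
  have "(1 + \<eta>) * a = a + (a' - a) * (a / (a + 1))" using a0 by (simp add: \<eta>_def field_simps)
  also have "\<dots> \<le> a + (a' - a) * 1" using a0 a' by (intro add_left_mono mult_left_mono) auto
  finally have \<eta>a: "(1 + \<eta>) * a \<le> a'" by simp
  \<comment> \<open>Chosen so that \<open>2 ^ s n\<close> is at least
    \<open>(K + 2) * log 2 n\<close>, which pushes the doubly exponential bound below
    \<open>1 / n ^ (K + 2)\<close>.\<close>
  define s where "s n = nat \<lceil>log 2 (real (K + 2) * log 2 (real n))\<rceil>" for n :: nat
  define t where "t n = t0 + s n" for n
  \<comment> \<open>The size up to which \<open>muf_sparse_imp_tree_event\<close> needs sparseness,
    for excess \<open>Suc K\<close> and depth \<open>t n\<close>.\<close>
  define s0 where "s0 n = 1 + (Suc K + 1) * (2 * t n + 1)" for n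
  define A where "A = max 1 a"
  have p_le: "p n \<le> a / real n" if "n \<ge> 1" for n
  proof -
    have "p n \<le> a / real n ^ (r - 1)" unfolding p using \<alpha>[OF that] by (intro divide_right_mono) auto
    also have "\<dots> \<le> a / real n ^ 1"
      using that a0 r by (intro divide_left_mono power_increasing) auto
    finally show ?thesis by simp
  qed
  have ev_p: "\<forall>\<^sub>F n in sequentially. a / real n \<le> min (1/2) (\<eta> / (1 + \<eta>))"
  proof -
    have "(\<lambda>n. a / real n) \<longlonglongrightarrow> 0" by real_asymp
    moreover have "0 < min (1/2) (\<eta> / (1 + \<eta>))" using \<eta> by simp
    ultimately have "\<forall>\<^sub>F n in sequentially. a / real n < min (1/2) (\<eta> / (1 + \<eta>))"
      by (rule order_tendstoD)
    then show ?thesis by (rule eventually_mono) simp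
  qed
  have ev_log: "\<forall>\<^sub>F n in sequentially. real (K + 2) * log 2 (real n) \<ge> 1"
    by real_asymp
  have s_bounds: "log 2 (real (K + 2) * log 2 (real n)) \<le> real (s n)"
    "real (s n) \<le> log 2 (real (K + 2) * log 2 (real n)) + 1" if "real (K + 2) * log 2 (real n) \<ge> 1" for n
  proof -
    have "0 \<le> log 2 (real (K + 2) * log 2 (real n))" using that by simp
    then show "log 2 (real (K + 2) * log 2 (real n)) \<le> real (s n)"
      "real (s n) \<le> log 2 (real (K + 2) * log 2 (real n)) + 1"
      unfolding s_def by linarith+
  qed
  have ev_dense: "\<forall>\<^sub>F n in sequentially. dense_bound r A (s0 n) \<le> real n"
  proof (rule dense_bound_eventually_le)
    let ?k = "real (Suc K + 1)"
    show "\<forall>\<^sub>F n in sequentially. real (s0 n) \<le> (1 + ?k * (2 * real t0 + 3)) + 2 * ?k * log 2 (real (K + 2) * log 2 (real n))"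
      using ev_log
    proof eventually_elim
      case (elim n)
      have "real (s0 n) = 1 + ?k * (2 * real t0 + 1 + 2 * real (s n))" by (simp add: s0_def t_def algebra_simps)
      also have "\<dots> \<le> 1 + ?k * (2 * real t0 + 1 + 2 * (log 2 (real (K + 2) * log 2 (real n)) + 1))"
        using s_bounds(2)[OF elim] by (intro add_left_mono mult_left_mono) auto
      also have "\<dots> = (1 + ?k * (2 * real t0 + 3)) + 2 * ?k * log 2 (real (K + 2) * log 2 (real n))"
        by (simp add: algebra_simps)
      finally show ?case .
    qed
  qed (use r in \<open>auto simp: A_def add_pos_nonneg\<close>)
  have main: "measure_pmf.prob (rsub (p n) (possible_clauses r {..<n}))
      {X. \<exists>G. muf r G \<and> clauses G \<subseteq> X \<and> excess r G \<ge> int (Suc K)} \<le> (1 + 2 / L) / real n ^ K"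
    if n: "n \<ge> 1" and hp: "a / real n \<le> min (1/2) (\<eta> / (1 + \<eta>))"
      and hl: "real (K + 2) * log 2 (real n) \<ge> 1" and hd: "dense_bound r A (s0 n) \<le> real n" for n
  proof -
    let ?E = "possible_clauses r {..<n}"
    let ?P = "measure_pmf.prob (rsub (p n) ?E)"
    let ?lits = "{..<n} \<times> (UNIV :: bool set)"
    have finE: "finite ?E" by (intro finite_possible_clauses) simp
    have pb: "0 \<le> p n" "p n \<le> 1/2" "p n \<le> \<eta> / (1 + \<eta>)"
    proof -
      show "0 \<le> p n" using \<alpha>(1)[OF n] by (simp add: p)
      show "p n \<le> 1/2" "p n \<le> \<eta> / (1 + \<eta>)" using p_le[OF n] hp by linarith+
    qed
    define N where "N = 2 ^ (r - 1) * n ^ (r - 1) div fact (r - 1)"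
    have N: "card {C \<in> ?E. l \<in> C} \<le> N" for l
      using card_clauses_containing[of "{..<n}" r l] r by (simp add: N_def less_eq_div_iff_mult_less_eq)
    have "real N \<le> real (2 ^ (r - 1) * n ^ (r - 1)) / real (fact (r - 1))"
      unfolding N_def by (rule of_nat_div_le_of_nat)
    then have "p n * N \<le> p n * (2 ^ (r - 1) * real n ^ (r - 1) / fact (r - 1))"
      using pb by (intro mult_left_mono) auto
    also have "\<dots> = \<alpha> n * 2 ^ (r - 1) / fact (r - 1)" using n by (simp add: p)
    also have "\<dots> \<le> a * 2 ^ (r - 1) / fact (r - 1)"
      using \<alpha>(2)[OF n] by (intro divide_right_mono mult_right_mono) auto
    finally have "(1 + \<eta>) * (p n * N) \<le> (1 + \<eta>) * (a * 2 ^ (r - 1) / fact (r - 1))"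
      using \<eta> by (intro mult_left_mono) auto
    also have "\<dots> = ((1 + \<eta>) * a) * 2 ^ (r - 1) / fact (r - 1)" by simp
    also have "\<dots> \<le> L" unfolding L_def using \<eta>a by (intro divide_right_mono mult_right_mono) auto
    finally have LN: "(1 + \<eta>) * (p n * N) \<le> L" .
    have tree: "?P (tree_event ?E (t n) l) \<le> 1 / (L * real n ^ (K + 2))" for l
    proof -
      have "?P (tree_event ?E (t n) l) \<le> (survival_map L r ^^ t n) 1"
        using pb \<eta> r LN N finE
        by (intro prob_tree_event) (auto simp: possible_clauses_def field_simps)
      moreover have "L * (survival_map L r ^^ t n) 1 \<le> 1 / real n ^ (K + 2)"
      proof -
        have "real (K + 2) * log 2 (real n) = 2 powr log 2 (real (K + 2) * log 2 (real n))"
          using hl by simp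
        also have "\<dots> \<le> 2 powr real (s n)" using s_bounds(1)[OF hl] by simp
        also have "\<dots> = real (2 ^ s n)" by (simp add: powr_realpow)
        finally have "2 powr (real (K + 2) * log 2 (real n)) \<le> 2 powr real (2 ^ s n)" by simp
        also have "\<dots> = 2 ^ 2 ^ s n" by (subst powr_realpow) auto
        also have "2 powr (real (K + 2) * log 2 (real n)) = real n ^ (K + 2)"
        proof -
          have "2 powr (real (K + 2) * log 2 (real n)) = (2 powr log 2 (real n)) powr real (K + 2)"
            by (simp add: powr_powr mult.commute)
          also have "2 powr log 2 (real n) = real n" using n by simp
          also have "real n powr real (K + 2) = real n ^ (K + 2)" using n by (intro powr_realpow) simp
          finally show ?thesis .
        qed
        finally have "1 / 2 ^ 2 ^ s n \<le> 1 / real n ^ (K + 2)"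
          using n by (intro divide_left_mono) auto
        then show ?thesis using t0[of "s n"] by (simp add: t_def power_one_over)
      qed
      ultimately have "L * ?P (tree_event ?E (t n) l) \<le> 1 / real n ^ (K + 2)"
        using L by (meson mult_left_mono order_trans less_imp_le)
      then show ?thesis using L n by (simp add: field_simps)
    qed
    have "?P {X. \<exists>G. muf r G \<and> clauses G \<subseteq> X \<and> excess r G \<ge> int (Suc K)}
        \<le> ?P ({X. \<exists>Q\<in>dense_sets r ?E (s0 n) (Suc K). Q \<subseteq> X} \<union> (\<Union>l\<in>?lits. tree_event ?E (t n) l))"
    proof (rule prob_rsub_mono)
      fix X assume X: "X \<subseteq> ?E" and "X \<in> {X. \<exists>G. muf r G \<and> clauses G \<subseteq> X \<and> excess r G \<ge> int (Suc K)}"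
      then obtain G where G: "muf r G" "clauses G \<subseteq> X" "excess r G \<ge> int (Suc K)" by blast
      show "X \<in> {X. \<exists>Q\<in>dense_sets r ?E (s0 n) (Suc K). Q \<subseteq> X} \<union> (\<Union>l\<in>?lits. tree_event ?E (t n) l)"
      proof (cases "\<exists>Q. Q \<subseteq> clauses G \<and> card Q \<le> s0 n \<and> clause_excess r Q \<ge> int (Suc K)")
        case True
        then obtain Q where Q: "Q \<subseteq> clauses G" "card Q \<le> s0 n" "clause_excess r Q \<ge> int (Suc K)" by blast
        then have "Q \<subseteq> ?E" "Q \<subseteq> X" using G(2) X by auto
        then show ?thesis using Q by (auto simp: dense_sets_def)
      next
        case False
        have GE: "clauses G \<subseteq> ?E" using G(2) X by simp
        obtain l where l: "fst l \<in> vars G" "clauses G \<in> tree_event ?E (t n) l"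
        proof (rule muf_sparse_imp_tree_event[OF r G(1,3) GE])
          fix Q assume "Q \<subseteq> clauses G" "card Q \<le> 1 + (Suc K + 1) * (2 * t n + 1)"
          then show "clause_excess r Q < int (Suc K)" using False by (auto simp: s0_def)
        qed
        have "vars G \<subseteq> {..<n}" unfolding muf_vars[OF G(1)] using GE by (rule cvars_subset)
        then have "l \<in> ?lits" using l(1) by (cases l) auto
        moreover have "X \<in> tree_event ?E (t n) l" using upclosedD[OF upclosed_tree_event l(2) G(2)] .
        ultimately show ?thesis by blast
      qed
    qed
    also have "\<dots> \<le> ?P {X. \<exists>Q\<in>dense_sets r ?E (s0 n) (Suc K). Q \<subseteq> X} + ?P (\<Union>l\<in>?lits. tree_event ?E (t n) l)"
      by (rule measure_Un_le) auto
    also have "?P {X. \<exists>Q\<in>dense_sets r ?E (s0 n) (Suc K). Q \<subseteq> X} \<le> 1 / real n ^ K"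
    proof -
      have "?P {X. \<exists>Q\<in>dense_sets r ?E (s0 n) (Suc K). Q \<subseteq> X} \<le> (\<Sum>Q\<in>dense_sets r ?E (s0 n) (Suc K). p n ^ card Q)"
        using pb finE by (intro prob_dense_le) auto
      also have "\<dots> \<le> dense_bound r A (s0 n) / real n ^ Suc K"
        unfolding p using r n \<alpha>[OF n] by (intro sum_dense_sets_le) (auto simp: A_def)
      also have "\<dots> \<le> real n / real n ^ Suc K" using hd by (intro divide_right_mono) auto
      also have "\<dots> = 1 / real n ^ K" using n by simp
      finally show ?thesis .
    qed
    \<comment> \<open>The union over the \<open>2 * n\<close> literals costs one of the
      \<open>K + 2\<close> powers; another is discarded.\<close>
    also have "?P (\<Union>l\<in>?lits. tree_event ?E (t n) l) \<le> (2 / L) / real n ^ K"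
    proof -
      have "?P (\<Union>l\<in>?lits. tree_event ?E (t n) l) \<le> (\<Sum>l\<in>?lits. ?P (tree_event ?E (t n) l))"
        by (intro measure_pmf.finite_measure_subadditive_finite) auto
      also have "\<dots> \<le> (\<Sum>l\<in>?lits. 1 / (L * real n ^ (K + 2)))" by (intro sum_mono tree)
      also have "\<dots> = 2 * real n / (L * real n ^ (K + 2))" by (simp add: card_cartesian_product)
      also have "\<dots> = (2 / L) / (real n ^ K * real n)" using n L by (simp add: field_simps)
      also have "\<dots> \<le> (2 / L) / (real n ^ K * 1)"
        using n L by (intro divide_left_mono mult_left_mono) auto
      finally show ?thesis by simp
    qed
    finally show ?thesis by (simp add: add_divide_distrib)
  qed
  have "\<forall>\<^sub>F n in sequentially. measure_pmf.prob (rsub (p n) (possible_clauses r {..<n}))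
      {X. \<exists>G. muf r G \<and> clauses G \<subseteq> X \<and> excess r G \<ge> int (Suc K)} \<le> (1 + 2 / L) / real n ^ K"
    using eventually_ge_at_top[of 1] ev_p ev_log ev_dense
    by eventually_elim (rule main)
  moreover have "1 + 2 / L > 0" using L by (simp add: add_pos_pos)
  ultimately show ?thesis using that by blast
qed

section \<open>Uniqueness outside a bad event\<close>

definition mufs :: "nat \<Rightarrow> nat clause set \<Rightarrow> nat formula set" where
  "mufs r X = {G. muf r G \<and> clauses G \<subseteq> X}"

lemma random_sat_eq:
  "random_sat r n p = map_pmf (Formula {..<n}) (rsub p (possible_clauses r {..<n}))"
  by (simp add: random_sat_def rsub_def pmf.map_comp o_def)

lemma cond_prob_random_sat:
  "\<P>(F in measure_pmf (random_sat r n p). \<Phi> F \<bar> \<Psi> F) =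
    measure_pmf.prob (rsub p (possible_clauses r {..<n})) {X. \<Phi> (Formula {..<n} X) \<and> \<Psi> (Formula {..<n} X)} /
    measure_pmf.prob (rsub p (possible_clauses r {..<n})) {X. \<Psi> (Formula {..<n} X)}"
  by (simp add: cond_prob_def random_sat_eq vimage_def)

lemma prob_rsub_cong:
  assumes "\<And>X. X \<subseteq> E \<Longrightarrow> X \<in> A \<longleftrightarrow> X \<in> B"
  shows "measure_pmf.prob (rsub p E) A = measure_pmf.prob (rsub p E) B"
  using assms by (intro antisym prob_rsub_mono) auto

lemma mufs_in_eq:
  assumes "X \<subseteq> possible_clauses r {..<n}"
  shows "mufs_in r (Formula {..<n} X) = mufs r X"
proof -
  have "vars G \<subseteq> {..<n}" if "muf r G" "clauses G \<subseteq> X" for G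
    unfolding muf_vars[OF that(1)] using that(2) assms by (intro cvars_subset) auto
  then show ?thesis by (auto simp: mufs_in_def mufs_def subformula_def muf_def)
qed

text \<open>Excess and being a MUF are isomorphism invariants, so containing a copy of a MUF of
  small excess means having such a MUF inside \<open>X\<close>. This turns the conditioning event
  into a condition on \<open>mufs r X\<close>.\<close>

lemma unsat_from_level_iff:
  assumes X: "X \<subseteq> possible_clauses r {..<n}"
  shows "unsat_from_level r i (Formula {..<n} X) \<longleftrightarrow>
    mufs r X \<noteq> {} \<and> (\<forall>G\<in>mufs r X. int (muf_excess r i) \<le> excess r G)"
proof -
  let ?F = "Formula {..<n} X"
  have sat: "sat_formula r ?F" using X by (simp add: sat_formula_def)
  have unsat: "\<not> satisfiable ?F \<longleftrightarrow> mufs r X \<noteq> {}"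
  proof
    assume "\<not> satisfiable ?F"
    with sat obtain G where "subformula r G ?F" "muf r G" by (rule unsat_contains_muf)
    then show "mufs r X \<noteq> {}" unfolding mufs_in_eq[OF X, symmetric] mufs_in_def by blast
  next
    assume "mufs r X \<noteq> {}"
    then obtain G where G: "muf r G" "clauses G \<subseteq> X" by (auto simp: mufs_def)
    show "\<not> satisfiable ?F"
    proof
      assume "satisfiable ?F"
      then obtain A where "\<forall>C\<in>X. \<exists>(x, b)\<in>C. A x = b" by (auto simp: satisfiable_def)
      then have "satisfiable G" unfolding satisfiable_def using G(2) by (intro exI[of _ A]) auto
      then show False using G(1) by (simp add: muf_def)
    qed
  qed
  have "(\<exists>F' :: nat formula. muf r F' \<and> excess r F' < int k \<and> contains_copy r ?F F')
      \<longleftrightarrow> (\<exists>G\<in>mufs r X. excess r G < int k)" (is "?l \<longleftrightarrow> ?r") for k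
  proof
    assume ?l
    then obtain F' :: "nat formula" and G where F': "muf r F'" "excess r F' < int k"
      and G: "subformula r G ?F" "isomorphic G F'" unfolding contains_copy_def by blast
    have wf: "wf_formula F'" "wf_formula G"
      using F'(1) G(1) sat_formula_imp_wf by (auto simp: muf_def subformula_def)
    have iso: "isomorphic F' G" by (rule isomorphic_sym[OF wf(2) G(2)])
    have "muf r G" by (rule isomorphic_muf[OF F'(1) iso])
    moreover have "excess r G < int k" using isomorphic_card(3)[OF wf(1) iso, of r] F'(2) by simp
    ultimately show ?r using G(1) unfolding mufs_in_eq[OF X, symmetric] mufs_in_def by blast
  next
    assume ?r
    then obtain G where G: "muf r G" "excess r G < int k" "subformula r G ?F"
      unfolding mufs_in_eq[OF X, symmetric] mufs_in_def by blast
    then have "isomorphic G G" using sat_formula_imp_wf by (intro isomorphic_refl) (auto simp: muf_def)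
    then show ?l using G unfolding contains_copy_def by blast
  qed
  then show ?thesis unfolding unsat_from_level_def unsat by (auto simp: not_less)
qed

text \<open>Two MUFs of excess at most \<open>k\<close> have at most \<open>4 * k\<close> clauses
  together, and one MUF of excess \<open>k + 1\<close> has at most \<open>2 * k + 2\<close>, so
  \<open>4 * k + 2\<close> covers both. Excess \<open>k + 1\<close> is left to the dense sets
  because \<open>prob_large_muf\<close> reaches the exponent \<open>k + 1\<close> only from excess
  \<open>k + 2\<close> on.\<close>

definition bad_event :: "nat \<Rightarrow> nat \<Rightarrow> nat \<Rightarrow> nat clause set set" where
  "bad_event r n k =
    {X. \<exists>Q\<in>dense_sets r (possible_clauses r {..<n}) (4 * k + 2) (Suc k). Q \<subseteq> X} \<union>
    {X. \<exists>G. muf r G \<and> clauses G \<subseteq> X \<and> excess r G \<ge> int (Suc (Suc k))}"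

lemma muf_excess_le_if_not_bad:
  assumes r: "r \<ge> 3" and X: "X \<subseteq> possible_clauses r {..<n}" "X \<notin> bad_event r n k" and G: "G \<in> mufs r X"
  shows "excess r G \<le> int k"
proof (rule ccontr)
  assume gt: "\<not> ?thesis"
  have G': "muf r G" "clauses G \<subseteq> X" using G by (auto simp: mufs_def)
  have "\<not> excess r G \<ge> int (Suc (Suc k))" using X(2) G' unfolding bad_event_def by blast
  then have "excess r G = int (Suc k)" using gt by linarith
  moreover from this have "card (clauses G) \<le> 4 * k + 2" using muf_card_clauses_le(1)[OF r G'(1)] by simp
  ultimately have "clauses G \<in> dense_sets r (possible_clauses r {..<n}) (4 * k + 2) (Suc k)"
    using G' X(1) by (auto simp: dense_sets_def excess_muf[OF G'(1)])
  then show False using X(2) G' by (auto simp: bad_event_def)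
qed

text \<open>By the antichain property \<open>H\<close> contributes a clause outside
  \<open>G\<close>, and adding a MUF not already contained raises the excess beyond
  \<open>k\<close>.\<close>

lemma union_dense:
  assumes r: "r \<ge> 3" and X: "X \<subseteq> possible_clauses r {..<n}"
    and G: "G \<in> mufs r X" "excess r G = int k" and H: "H \<in> mufs r X" "excess r H \<le> int k" "H \<noteq> G"
  shows "clauses G \<union> clauses H \<in> dense_sets r (possible_clauses r {..<n}) (4 * k + 2) (Suc k)"
proof -
  have G': "muf r G" "clauses G \<subseteq> X" and H': "muf r H" "clauses H \<subseteq> X" using G H by (auto simp: mufs_def)
  have "\<not> clauses H \<subseteq> clauses G" using muf_clauses_subset_eq[OF H'(1) G'(1)] H(3) by blast
  moreover have "finite (cvars (clauses G))" using muf_vars[OF G'(1)] muf_finite(1)[OF G'(1)] by simp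
  ultimately have "clause_excess r (clauses G) < clause_excess r (clauses G \<union> clauses H)"
    using muf_finite(2)[OF G'(1)] by (intro clause_excess_Un_muf[OF r H'(1)])
  moreover have "card (clauses G \<union> clauses H) \<le> 4 * k + 2"
    using muf_card_clauses_le(1)[OF r G'(1)] muf_card_clauses_le(1)[OF r H'(1)] G(2) H(2)
      card_Un_le[of "clauses G" "clauses H"] by linarith
  ultimately show ?thesis
    using G' H' G(2) X by (auto simp: dense_sets_def excess_muf[OF G'(1)])
qed

lemma unique_muf_if_not_bad:
  assumes r: "r \<ge> 3" and X: "X \<subseteq> possible_clauses r {..<n}" "X \<notin> bad_event r n k"
    and G: "G \<in> mufs r X" "excess r G = int k"
  shows "mufs r X = {G}"
proof -
  have "H = G" if H: "H \<in> mufs r X" for H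
  proof (rule ccontr)
    assume "H \<noteq> G"
    then have "clauses G \<union> clauses H \<in> dense_sets r (possible_clauses r {..<n}) (4 * k + 2) (Suc k)"
      using union_dense[OF r X(1) G H] muf_excess_le_if_not_bad[OF r X H] by simp
    moreover have "clauses G \<union> clauses H \<subseteq> X" using G H by (auto simp: mufs_def)
    ultimately show False using X(2) by (auto simp: bad_event_def)
  qed
  then show ?thesis using G(1) by blast
qed

text \<open>The second Bonferroni inequality with each pair counted in both orders, which is weaker
  but simpler to sum.\<close>

lemma prob_UN_ge:
  assumes "finite I"
  shows "(\<Sum>i\<in>I. measure_pmf.prob M (A i)) - (\<Sum>i\<in>I. \<Sum>j\<in>I - {i}. measure_pmf.prob M (A i \<inter> A j))
    \<le> measure_pmf.prob M (\<Union>i\<in>I. A i)"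
  using assms
proof (induction I rule: finite_induct)
  case empty
  then show ?case by simp
next
  case (insert i I)
  let ?P = "measure_pmf.prob M"
  let ?U = "\<Union>j\<in>I. A j"
  have "?P (A i \<inter> ?U) = ?P (\<Union>j\<in>I. A i \<inter> A j)" by (simp only: Int_UN_distrib)
  also have "\<dots> \<le> (\<Sum>j\<in>I. ?P (A i \<inter> A j))"
    using insert.hyps by (intro measure_pmf.finite_measure_subadditive_finite) auto
  finally have 1: "?P (A i \<inter> ?U) \<le> (\<Sum>j\<in>I. ?P (A i \<inter> A j))" .
  have 2: "?P (A i \<union> ?U) = ?P (A i) + ?P ?U - ?P (A i \<inter> ?U)"
    by (rule measure_Un3) (auto simp: fmeasurable_def measure_pmf.emeasure_eq_measure)
  have "(\<Sum>j\<in>insert i I - {i}. ?P (A i \<inter> A j)) = (\<Sum>j\<in>I. ?P (A i \<inter> A j))"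
    using insert.hyps by (intro sum.cong) auto
  moreover have "(\<Sum>k\<in>I. \<Sum>j\<in>I - {k}. ?P (A k \<inter> A j)) \<le> (\<Sum>k\<in>I. \<Sum>j\<in>insert i I - {k}. ?P (A k \<inter> A j))"
    using insert.hyps by (intro sum_mono sum_mono2) auto
  ultimately show ?case using insert 1 2 by simp
qed

text \<open>Union bound from above, Bonferroni from below. Two distinct members force a dense set by
  \<open>union_dense\<close>, so all pairs together cost only the order of
  \<open>1 / n ^ Suc k\<close>.\<close>

lemma prob_some_muf:
  fixes \<G> :: "nat formula set"
  assumes r: "r \<ge> 3" and n: "n > 0" and a: "0 \<le> a" "a \<le> A" "1 \<le> A" and p: "p = a / real n ^ (r - 1)" "p \<le> 1"
    and \<G>: "\<And>G. G \<in> \<G> \<Longrightarrow> muf r G \<and> excess r G = int k \<and> vars G \<subseteq> {..<n}"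
  shows "measure_pmf.prob (rsub p (possible_clauses r {..<n})) {X. \<exists>G\<in>\<G>. clauses G \<subseteq> X} \<le> (\<Sum>G\<in>\<G>. p ^ card (clauses G))"
    "(\<Sum>G\<in>\<G>. p ^ card (clauses G)) - 4 ^ (4 * k + 2) * dense_bound r A (4 * k + 2) / real n ^ Suc k
      \<le> measure_pmf.prob (rsub p (possible_clauses r {..<n})) {X. \<exists>G\<in>\<G>. clauses G \<subseteq> X}"
proof -
  let ?E = "possible_clauses r {..<n}"
  let ?P = "measure_pmf.prob (rsub p ?E)"
  let ?A = "\<lambda>G. {X. clauses G \<subseteq> X}"
  let ?D = "dense_sets r ?E (4 * k + 2) (Suc k)"
  have p0: "0 \<le> p" using a p by simp
  have finE: "finite ?E" by (intro finite_possible_clauses) simp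
  have GE: "clauses G \<subseteq> ?E" if "G \<in> \<G>" for G
    using \<G>[OF that] muf_finite(3)[of r G] possible_clauses_mono[of "vars G" "{..<n}" r] by auto
  have inj: "inj_on clauses \<G>"
  proof (rule inj_onI)
    fix G H assume "G \<in> \<G>" "H \<in> \<G>" "clauses G = clauses H"
    then show "G = H" using muf_eqI[of r G H] \<G> by simp
  qed
  have fin: "finite \<G>"
    by (rule inj_on_finite[OF inj, of "Pow ?E"]) (use GE finE in auto)
  have P: "?P (?A G) = p ^ card (clauses G)" if "G \<in> \<G>" for G
    using prob_rsub_superset[OF finE p0 p(2) GE[OF that]] .
  have UN: "{X. \<exists>G\<in>\<G>. clauses G \<subseteq> X} = (\<Union>G\<in>\<G>. ?A G)" by auto
  have "?P (\<Union>G\<in>\<G>. ?A G) \<le> (\<Sum>G\<in>\<G>. ?P (?A G))"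
    using fin by (intro measure_pmf.finite_measure_subadditive_finite) auto
  then show "?P {X. \<exists>G\<in>\<G>. clauses G \<subseteq> X} \<le> (\<Sum>G\<in>\<G>. p ^ card (clauses G))"
    unfolding UN using P by simp
  let ?S = "SIGMA G:\<G>. \<G> - {G}"
  let ?u = "\<lambda>(G, H). clauses G \<union> clauses H"
  have finS: "finite ?S" using fin by (intro finite_SigmaI) auto
  have finD: "finite ?D" unfolding dense_sets_def using finE by (auto intro: finite_subset[of _ "Pow ?E"])
  have uD: "?u ` ?S \<subseteq> ?D"
  proof (rule image_subsetI)
    fix x assume "x \<in> ?S"
    then obtain G H where x: "x = (G, H)" "G \<in> \<G>" "H \<in> \<G>" "H \<noteq> G" by auto
    then have "G \<in> mufs r ?E" "H \<in> mufs r ?E" using GE \<G> by (auto simp: mufs_def)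
    then show "?u x \<in> ?D" using union_dense[OF r order_refl, of G n k H] x \<G> by auto
  qed
  \<comment> \<open>An ordered pair with union \<open>Q\<close> is determined by two subsets of
    \<open>Q\<close>, since clause sets determine MUFs.\<close>
  have fib: "real (card {x \<in> ?S. ?u x = Q}) \<le> 4 ^ (4 * k + 2)" if Q: "Q \<in> ?D" for Q
  proof -
    have Qf: "finite Q" "card Q \<le> 4 * k + 2" using Q finE by (auto simp: dense_sets_def intro: finite_subset)
    have "inj_on (\<lambda>(G, H). (clauses G, clauses H)) {x \<in> ?S. ?u x = Q}"
      using inj by (auto simp: inj_on_def)
    then have "card {x \<in> ?S. ?u x = Q} \<le> card (Pow Q \<times> Pow Q)"
      by (rule card_inj_on_le) (use Qf in auto)
    also have "\<dots> = 4 ^ card Q"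
      using Qf by (simp add: card_cartesian_product card_Pow flip: power_mult_distrib)
    also have "\<dots> \<le> 4 ^ (4 * k + 2)" using Qf by (intro power_increasing) auto
    finally have "card {x \<in> ?S. ?u x = Q} \<le> 4 ^ (4 * k + 2)" .
    then have "real (card {x \<in> ?S. ?u x = Q}) \<le> real (4 ^ (4 * k + 2))" by (simp only: of_nat_le_iff)
    then show ?thesis by simp
  qed
  have "(\<Sum>G\<in>\<G>. \<Sum>H\<in>\<G> - {G}. ?P (?A G \<inter> ?A H)) = (\<Sum>x\<in>?S. p ^ card (?u x))"
  proof -
    have "?P (?A G \<inter> ?A H) = p ^ card (clauses G \<union> clauses H)" if "G \<in> \<G>" "H \<in> \<G>" for G H
    proof -
      have "?A G \<inter> ?A H = {X. clauses G \<union> clauses H \<subseteq> X}" by auto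
      then show ?thesis using prob_rsub_superset[OF finE p0 p(2), of "clauses G \<union> clauses H"] GE that by auto
    qed
    then show ?thesis using fin by (subst sum.Sigma) (auto intro!: sum.cong)
  qed
  also have "\<dots> = (\<Sum>Q\<in>?D. \<Sum>x\<in>{x \<in> ?S. ?u x = Q}. p ^ card (?u x))"
    by (rule sum.group[OF finS finD uD, symmetric])
  also have "\<dots> = (\<Sum>Q\<in>?D. real (card {x \<in> ?S. ?u x = Q}) * p ^ card Q)"
    by (intro sum.cong refl) (simp add: sum.cong)
  also have "\<dots> \<le> (\<Sum>Q\<in>?D. 4 ^ (4 * k + 2) * p ^ card Q)"
    using fib p0 by (intro sum_mono mult_right_mono) auto
  also have "\<dots> = 4 ^ (4 * k + 2) * (\<Sum>Q\<in>?D. p ^ card Q)" by (simp add: sum_distrib_left)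
  also have "(\<Sum>Q\<in>?D. p ^ card Q) \<le> dense_bound r A (4 * k + 2) / real n ^ Suc k"
    unfolding p using r n a by (intro sum_dense_sets_le) auto
  finally have pairs: "(\<Sum>G\<in>\<G>. \<Sum>H\<in>\<G> - {G}. ?P (?A G \<inter> ?A H))
      \<le> 4 ^ (4 * k + 2) * (dense_bound r A (4 * k + 2) / real n ^ Suc k)" by simp
  have "(\<Sum>G\<in>\<G>. p ^ card (clauses G)) = (\<Sum>G\<in>\<G>. ?P (?A G))" using P by simp
  then show "(\<Sum>G\<in>\<G>. p ^ card (clauses G)) - 4 ^ (4 * k + 2) * dense_bound r A (4 * k + 2) / real n ^ Suc k
      \<le> ?P {X. \<exists>G\<in>\<G>. clauses G \<subseteq> X}"
    unfolding UN using prob_UN_ge[OF fin, of "rsub p ?E" ?A] pairs by simp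
qed

section \<open>Isomorphism classes and asymptotics\<close>

lemma muf_imp_wf: "muf r F \<Longrightarrow> wf_formula F"
  using sat_formula_imp_wf by (auto simp: muf_def)

lemma isomorphic_initial_segment:
  assumes F: "wf_formula F"
  obtains G :: "nat formula" where "vars G = {..<card (vars F)}" "isomorphic F G"
proof -
  have "finite (vars F)" using F by (simp add: wf_formula_def)
  from ex_bij_betw_finite_nat[OF this] obtain h where h: "bij_betw h (vars F) {..<card (vars F)}"
    by (auto simp: lessThan_atLeast0)
  let ?\<pi> = "restrict h (vars F)"
  have bij: "bij_betw ?\<pi> (vars F) {..<card (vars F)}" using h by (simp add: bij_betw_restrict_eq)
  then have v: "vars (apply_iso ?\<pi> {} F) = {..<card (vars F)}"
    unfolding apply_iso_def formula.sel by (rule bij_betw_imp_surj_on)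
  have "(?\<pi>, {}) \<in> isos F (apply_iso ?\<pi> {} F)"
    using bij unfolding isos_def by (simp add: v) (simp add: apply_iso_def)
  then show ?thesis using that[OF v] isomorphicI by blast
qed

lemma muf_levelD:
  assumes "F \<in> muf_level r i"
  shows "muf r F" "excess r F = int (muf_excess r i)"
  using assms by (simp_all add: muf_level_def)

lemma isomorphic_muf_level:
  assumes "F \<in> muf_level r i" "isomorphic F G"
  shows "G \<in> muf_level r i"
  using isomorphic_muf[OF muf_levelD(1)[OF assms(1)] assms(2)]
    isomorphic_card(3)[OF muf_imp_wf[OF muf_levelD(1)[OF assms(1)]] assms(2), of r] muf_levelD(2)[OF assms(1)]
  by (simp add: muf_level_def)

section \<open>The finite set of isomorphism classes of a level\<close>

definition muf_iso_rel :: "nat \<Rightarrow> nat \<Rightarrow> (nat formula \<times> nat formula) set" where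
  "muf_iso_rel r i = {(F, G). F \<in> muf_level r i \<and> G \<in> muf_level r i \<and> isomorphic F G}"

lemma muf_level_wf: "F \<in> muf_level r i \<Longrightarrow> wf_formula F"
  using muf_imp_wf muf_levelD(1) by blast

lemma equiv_muf_iso_rel: "equiv (muf_level r i) (muf_iso_rel r i)"
proof (rule equivI)
  show "muf_iso_rel r i \<subseteq> muf_level r i \<times> muf_level r i" by (auto simp: muf_iso_rel_def)
  show "refl_on (muf_level r i) (muf_iso_rel r i)"
    using isomorphic_refl muf_level_wf by (auto simp: refl_on_def muf_iso_rel_def)
  show "sym (muf_iso_rel r i)"
  proof (rule symI)
    fix F G assume "(F, G) \<in> muf_iso_rel r i"
    then show "(G, F) \<in> muf_iso_rel r i"
      using isomorphic_sym[OF muf_level_wf, of F r i G] by (simp add: muf_iso_rel_def)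
  qed
  show "trans (muf_iso_rel r i)"
  proof (rule transI)
    fix F G H assume "(F, G) \<in> muf_iso_rel r i" "(G, H) \<in> muf_iso_rel r i"
    then show "(F, H) \<in> muf_iso_rel r i"
      using isomorphic_trans[OF muf_level_wf, of F r i G H] by (simp add: muf_iso_rel_def)
  qed
qed

lemma muf_classes_eq: "muf_classes r i = muf_level r i // muf_iso_rel r i"
  by (simp add: muf_classes_def muf_iso_rel_def)

definition class_rep :: "nat formula set \<Rightarrow> nat formula" where
  "class_rep K = (SOME F. F \<in> K)"

lemma class_rep:
  assumes "K \<in> muf_classes r i"
  shows "class_rep K \<in> K" "class_rep K \<in> muf_level r i" "K = {G. isomorphic (class_rep K) G}"
proof -
  note E = equiv_muf_iso_rel[of r i]
  have K: "K \<in> muf_level r i // muf_iso_rel r i" using assms by (simp add: muf_classes_eq)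
  have "K \<noteq> {}" using in_quotient_imp_non_empty[OF E K] .
  then show rep: "class_rep K \<in> K" unfolding class_rep_def by (simp add: some_in_eq)
  then show lv: "class_rep K \<in> muf_level r i" using in_quotient_imp_subset[OF E K] by blast
  have "K = muf_iso_rel r i `` {class_rep K}"
    using K rep E by (metis Image_singleton_iff equiv_class_eq_iff quotientE)
  also have "\<dots> = {G. isomorphic (class_rep K) G}"
    using lv isomorphic_muf_level[OF lv] by (auto simp: muf_iso_rel_def)
  finally show "K = {G. isomorphic (class_rep K) G}" .
qed

lemma muf_level_card_le:
  assumes r: "r \<ge> 3" and F: "F \<in> muf_level r i"
  shows "card (vars F) \<le> r * (2 * muf_excess r i)"
proof -
  have "card (clauses F) \<le> 2 * muf_excess r i"
    using muf_card_clauses_le(1)[OF r muf_levelD(1)[OF F]] muf_levelD(2)[OF F] by linarith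
  then have "r * card (clauses F) \<le> r * (2 * muf_excess r i)" by (rule mult_le_mono2)
  then show ?thesis using muf_card_vars_le[OF r muf_levelD(1)[OF F]] by linarith
qed

lemma finite_muf_level_on:
  "finite {G \<in> muf_level r i. vars G \<subseteq> {..<n}}"
proof (rule inj_on_finite[of clauses])
  show "inj_on clauses {G \<in> muf_level r i. vars G \<subseteq> {..<n}}"
    using muf_eqI muf_levelD(1) by (intro inj_onI) blast
  show "clauses ` {G \<in> muf_level r i. vars G \<subseteq> {..<n}} \<subseteq> Pow (possible_clauses r {..<n})"
  proof (rule image_subsetI)
    fix G assume "G \<in> {G \<in> muf_level r i. vars G \<subseteq> {..<n}}"
    then have "muf r G" "vars G \<subseteq> {..<n}" using muf_levelD(1) by auto
    then show "clauses G \<in> Pow (possible_clauses r {..<n})"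
      using muf_finite(3)[of r G] possible_clauses_mono[of "vars G" "{..<n}" r] by auto
  qed
  show "finite (Pow (possible_clauses r {..<n}))" by (simp add: finite_possible_clauses)
qed

text \<open>The excess bounds the order, so each class has a representative on an initial segment
  inside one fixed finite set of variables.\<close>

lemma finite_muf_classes:
  assumes r: "r \<ge> 3"
  shows "finite (muf_classes r i)"
proof -
  let ?M = "{G \<in> muf_level r i. vars G \<subseteq> {..<r * (2 * muf_excess r i)}}"
  have "muf_classes r i \<subseteq> (\<lambda>G. muf_iso_rel r i `` {G}) ` ?M"
  proof
    fix K assume K: "K \<in> muf_classes r i"
    note rep = class_rep[OF K]
    obtain G :: "nat formula" where G: "vars G = {..<card (vars (class_rep K))}" "isomorphic (class_rep K) G"
      using isomorphic_initial_segment[OF muf_level_wf[OF rep(2)]] by blast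
    have lv: "G \<in> muf_level r i" by (rule isomorphic_muf_level[OF rep(2) G(2)])
    have "G \<in> ?M" using lv G(1) muf_level_card_le[OF r rep(2)] by auto
    moreover have "G \<in> K" using rep(3) G(2) by blast
    then have "K = muf_iso_rel r i `` {G}"
      using K equiv_muf_iso_rel unfolding muf_classes_eq
      by (metis Image_singleton_iff equiv_class_eq_iff quotientE)
    ultimately show "K \<in> (\<lambda>G. muf_iso_rel r i `` {G}) ` ?M" by blast
  qed
  then show ?thesis using finite_muf_level_on by (rule finite_subset[OF _ finite_imageI])
qed

lemma copies_muf_level:
  assumes "F \<in> muf_level r i"
  shows "copies n F \<subseteq> {G \<in> muf_level r i. vars G \<subseteq> {..<n}}"
  using isomorphic_muf_level[OF assms] by (auto simp: copies_def)

text \<open>The labelled MUFs of the level on \<open>{..<n}\<close> are partitioned into the copies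
  of one representative per class.\<close>

lemma sum_muf_level_on:
  fixes f :: "nat formula \<Rightarrow> real"
  assumes r: "r \<ge> 3"
  shows "(\<Sum>G\<in>{G \<in> muf_level r i. vars G \<subseteq> {..<n}}. f G) = (\<Sum>K\<in>muf_classes r i. \<Sum>G\<in>copies n (class_rep K). f G)"
proof -
  let ?M = "{G \<in> muf_level r i. vars G \<subseteq> {..<n}}"
  have cop: "copies n (class_rep K) = K \<inter> ?M" if K: "K \<in> muf_classes r i" for K
    using class_rep(3)[OF K] copies_muf_level[OF class_rep(2)[OF K]] by (auto simp: copies_def)
  have "?M = (\<Union>K\<in>muf_classes r i. copies n (class_rep K))"
  proof (intro set_eqI iffI)
    fix G assume G: "G \<in> ?M"
    let ?K = "muf_iso_rel r i `` {G}"
    have "?K \<in> muf_classes r i" using G unfolding muf_classes_eq by (intro quotientI) simp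
    moreover have "G \<in> ?K" using G equiv_class_self[OF equiv_muf_iso_rel] by blast
    ultimately show "G \<in> (\<Union>K\<in>muf_classes r i. copies n (class_rep K))" using cop G by blast
  next
    fix G assume "G \<in> (\<Union>K\<in>muf_classes r i. copies n (class_rep K))"
    then show "G \<in> ?M" using cop by blast
  qed
  moreover have "(\<Sum>G\<in>(\<Union>K\<in>muf_classes r i. copies n (class_rep K)). f G)
      = (\<Sum>K\<in>muf_classes r i. \<Sum>G\<in>copies n (class_rep K). f G)"
  proof (rule sum.UNION_disjoint[OF finite_muf_classes[OF r]])
    show "\<forall>K\<in>muf_classes r i. finite (copies n (class_rep K))"
      using finite_subset[OF copies_muf_level[OF class_rep(2)] finite_muf_level_on] by blast
    show "\<forall>K\<in>muf_classes r i. \<forall>K'\<in>muf_classes r i. K \<noteq> K' \<longrightarrow>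
        copies n (class_rep K) \<inter> copies n (class_rep K') = {}"
    proof (intro ballI impI)
      fix K K' assume K: "K \<in> muf_classes r i" "K' \<in> muf_classes r i" "K \<noteq> K'"
      then have "K \<inter> K' = {}"
        using quotient_disj[OF equiv_muf_iso_rel, of K r i K'] by (simp add: muf_classes_eq)
      then show "copies n (class_rep K) \<inter> copies n (class_rep K') = {}"
        using cop[OF K(1)] cop[OF K(2)] by blast
    qed
  qed
  ultimately show ?thesis by simp
qed

section \<open>Asymptotics of expected copy counts\<close>

definition falling_ratio :: "nat \<Rightarrow> nat \<Rightarrow> real" where
  "falling_ratio n m = (\<Prod>j<m. real (n - j)) / real n ^ m"

lemma falling_ratio_tendsto: "(\<lambda>n. falling_ratio n m) \<longlonglongrightarrow> 1"
proof -
  have "(\<lambda>n. real (n - j) / real n) \<longlonglongrightarrow> 1" for j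
  proof (rule Lim_transform_eventually)
    show "(\<lambda>n. (real n - real j) / real n) \<longlonglongrightarrow> 1" by real_asymp
    show "\<forall>\<^sub>F n in sequentially. (real n - real j) / real n = real (n - j) / real n"
      using eventually_ge_at_top[of j] by eventually_elim (simp add: of_nat_diff)
  qed
  then have "(\<lambda>n. \<Prod>j<m. real (n - j) / real n) \<longlonglongrightarrow> (\<Prod>j<m. 1)" by (intro tendsto_prod)
  then show ?thesis by (simp add: falling_ratio_def prod_dividef)
qed

text \<open>With \<open>e\<close> clauses, order \<open>m\<close> and excess \<open>k\<close>, the
  identity \<open>(r - 1) * e = k + m\<close> splits the power of \<open>n\<close>:
  \<open>n ^ m\<close> cancels against the number of copies up to \<open>falling_ratio\<close>, and
  \<open>n ^ k\<close> remains.\<close>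

lemma sum_copies:
  assumes r: "r \<ge> 3" and n: "n > 0" and F: "F \<in> muf_level r i"
  shows "(\<Sum>G\<in>copies n F. (a / real n ^ (r - 1)) ^ card (clauses G))
    = weight a F * falling_ratio n (card (vars F)) / real n ^ muf_excess r i"
proof -
  let ?m = "card (vars F)" and ?e = "card (clauses F)" and ?k = "muf_excess r i"
  have sat: "sat_formula r F" using muf_levelD(1)[OF F] by (simp add: muf_def)
  have wf: "wf_formula F" using F by (rule muf_level_wf)
  have "int ((r - 1) * ?e) = int (?k + ?m)"
    using muf_levelD(2)[OF F] r by (simp add: excess_def of_nat_diff)
  then have ex: "(r - 1) * ?e = ?k + ?m" by (simp only: of_nat_eq_iff)
  have "real (card (copies n F) * card (aut F)) = real ((\<Prod>j<?m. n - j) * 2 ^ ?m)"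
    using card_copies(2)[OF sat, of n] by simp
  then have c: "real (card (copies n F)) = (\<Prod>j<?m. real (n - j)) * 2 ^ ?m / real (card (aut F))"
    using card_aut_pos[OF wf] by (simp add: field_simps)
  have "(\<Sum>G\<in>copies n F. (a / real n ^ (r - 1)) ^ card (clauses G)) = (\<Sum>G\<in>copies n F. (a / real n ^ (r - 1)) ^ ?e)"
  proof (rule sum.cong[OF refl])
    fix G assume "G \<in> copies n F"
    then have "card (clauses G) = ?e" using isomorphic_card(2)[OF wf, of G] by (simp add: copies_def)
    then show "(a / real n ^ (r - 1)) ^ card (clauses G) = (a / real n ^ (r - 1)) ^ ?e" by (simp only:)
  qed
  also have "\<dots> = real (card (copies n F)) * (a ^ ?e / (real n ^ ?k * real n ^ ?m))"
    unfolding sum_constant power_divide power_mult[symmetric] ex power_add by simp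
  also have "\<dots> = weight a F * falling_ratio n ?m / real n ^ ?k"
    unfolding c by (simp add: weight_def falling_ratio_def mult_ac)
  finally show ?thesis .
qed

text \<open>The weights depend on \<open>\<alpha> n\<close>, which need not converge, so limits are
  stated for differences; a positive lower bound on \<open>g\<close> converts them into
  ratios.\<close>

lemma asymp_equiv_if_diff_tendsto_0:
  fixes f g :: "nat \<Rightarrow> real"
  assumes d: "(\<lambda>n. f n - g n) \<longlonglongrightarrow> 0" and c: "c > 0" "\<forall>\<^sub>F n in sequentially. g n \<ge> c"
  shows "f \<sim>[sequentially] g"
proof (rule asymp_equivI')
  have "(\<lambda>n. 1 + (f n - g n) / g n) \<longlonglongrightarrow> 1 + 0"
  proof (intro tendsto_intros)
    have "(\<lambda>n. \<bar>f n - g n\<bar> / c) \<longlonglongrightarrow> 0"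
      using tendsto_divide[OF tendsto_rabs_zero[OF d] tendsto_const, of c] c by simp
    then show "(\<lambda>n. (f n - g n) / g n) \<longlonglongrightarrow> 0"
    proof (rule Lim_null_comparison[rotated])
      show "\<forall>\<^sub>F n in sequentially. norm ((f n - g n) / g n) \<le> \<bar>f n - g n\<bar> / c"
        using c(2) by eventually_elim (use c in \<open>auto simp: abs_divide intro!: divide_left_mono\<close>)
    qed
  qed
  then have "(\<lambda>n. 1 + (f n - g n) / g n) \<longlonglongrightarrow> 1" by simp
  then show "(\<lambda>n. f n / g n) \<longlonglongrightarrow> 1"
  proof (rule Lim_transform_eventually)
    show "\<forall>\<^sub>F n in sequentially. 1 + (f n - g n) / g n = f n / g n"
      using c(2) by eventually_elim (use c in \<open>auto simp: field_simps\<close>)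
  qed
qed

lemma weight_falling_ratio_tendsto:
  assumes "\<forall>\<^sub>F n in sequentially. 0 \<le> \<alpha> n \<and> \<alpha> n \<le> A"
  shows "(\<lambda>n. weight (\<alpha> n) F * falling_ratio n m - weight (\<alpha> n) F) \<longlonglongrightarrow> 0"
proof (rule Lim_null_comparison)
  show "\<forall>\<^sub>F n in sequentially. norm (weight (\<alpha> n) F * falling_ratio n m - weight (\<alpha> n) F)
      \<le> weight A F * \<bar>falling_ratio n m - 1\<bar>"
    using assms
  proof eventually_elim
    case (elim n)
    have "0 \<le> weight (\<alpha> n) F" "weight (\<alpha> n) F \<le> weight A F"
      unfolding weight_def using elim by (auto intro!: divide_right_mono mult_right_mono power_mono)
    moreover have "weight (\<alpha> n) F * falling_ratio n m - weight (\<alpha> n) F = weight (\<alpha> n) F * (falling_ratio n m - 1)"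
      by (simp add: algebra_simps)
    ultimately show ?case by (simp add: abs_mult mult_right_mono)
  qed
  have "(\<lambda>n. weight A F * \<bar>falling_ratio n m - 1\<bar>) \<longlonglongrightarrow> weight A F * \<bar>1 - 1\<bar>"
    by (intro tendsto_intros falling_ratio_tendsto)
  then show "(\<lambda>n. weight A F * \<bar>falling_ratio n m - 1\<bar>) \<longlonglongrightarrow> 0" by simp
qed

lemma weight_ge:
  assumes "wf_formula F" "0 < c"
  obtains d where "d > 0" "\<And>a. a \<ge> c \<Longrightarrow> weight a F \<ge> d"
proof
  show "weight c F > 0" using card_aut_pos[OF assms(1)] assms(2) by (simp add: weight_def)
  show "weight a F \<ge> weight c F" if "a \<ge> c" for a
    unfolding weight_def using that assms(2) by (intro divide_right_mono mult_right_mono power_mono) auto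
qed

text \<open>Boundedness is what makes the real supremum in the threshold condition an actual upper
  bound for \<open>\<alpha>\<close>.\<close>

lemma bdd_above_if_bigtheta_1:
  fixes \<alpha> :: "nat \<Rightarrow> real"
  assumes "\<alpha> \<in> \<Theta>(\<lambda>_. 1)"
  shows "bdd_above (\<alpha> ` {1..})"
proof -
  obtain c where "\<forall>\<^sub>F n in sequentially. norm (\<alpha> n) \<le> c * norm (1 :: real)"
    using bigthetaD1[OF assms] by (rule landau_o.bigE)
  then obtain N where N: "\<And>n. n \<ge> N \<Longrightarrow> \<bar>\<alpha> n\<bar> \<le> c" by (auto simp: eventually_sequentially)
  have "bdd_above (\<alpha> ` {..N} \<union> \<alpha> ` {N..})"
  proof (rule bdd_above_Un[THEN iffD2], intro conjI)
    show "bdd_above (\<alpha> ` {..N})" by simp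
    show "bdd_above (\<alpha> ` {N..})" by (rule bdd_aboveI[of _ c]) (use N in force)
  qed
  moreover have "\<alpha> ` {1..} \<subseteq> \<alpha> ` {..N} \<union> \<alpha> ` {N..}" by force
  ultimately show ?thesis by (rule bdd_above_mono)
qed

section \<open>The conditional law of the unique MUF\<close>

theorem theorem10:
  fixes i r :: nat and \<alpha> p :: "nat \<Rightarrow> real"
  assumes "i > 0" and "r \<ge> 3"
    and "\<And>n. n \<ge> 1 \<Longrightarrow> \<alpha> n \<ge> 0"
    and "\<alpha> \<in> \<Theta>(\<lambda>_. 1)"
    and "(SUP n\<in>{1..}. \<alpha> n) < pure_literal_threshold r"
    and "\<And>n. p n = \<alpha> n / real n ^ (r - 1)"
  shows "(\<lambda>n. 1 - \<P>(F in measure_pmf (random_sat r n (p n)).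
              (\<exists>F0. mufs_in r F = {F0} \<and> F0 \<in> muf_level r i) \<bar> unsat_from_level r i F))
           \<in> O(\<lambda>n. 1 / real n) \<and>
         (\<forall>F'\<in>muf_level r i.
            (\<lambda>n. \<P>(F in measure_pmf (random_sat r n (p n)).
              (\<exists>F0. mufs_in r F = {F0} \<and> isomorphic F0 F') \<bar> unsat_from_level r i F))
            \<sim>[sequentially] (\<lambda>n. weight (\<alpha> n) F' / total_weight r i (\<alpha> n)))"
proof -
  note r = assms(2) and p = assms(6)
  define k where "k = muf_excess r i"
  define a where "a = (SUP n\<in>{1..}. \<alpha> n)"
  \<comment> \<open>Still an upper bound for \<open>\<alpha>\<close>, and at least 1 as the
    dense-set estimate requires.\<close>
  define A where "A = max 1 a"
  have \<alpha>0: "0 \<le> \<alpha> n" if "n \<ge> 1" for n using assms(3)[OF that] .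
  have \<alpha>a: "\<alpha> n \<le> a" if "n \<ge> 1" for n
    unfolding a_def using that by (intro cSUP_upper bdd_above_if_bigtheta_1 assms(4)) auto
  have a: "a < pure_literal_threshold r" using assms(5) by (simp add: a_def)
  obtain c0 where c0: "c0 > 0" "\<forall>\<^sub>F n in sequentially. norm (\<alpha> n) \<ge> c0 * norm (1 :: real)"
    using bigthetaD2[OF assms(4)] by (rule landau_omega.bigE)
  have ev1: "\<forall>\<^sub>F n in sequentially. n \<ge> (1 :: nat)" by (rule eventually_ge_at_top)
  have ev\<alpha>: "\<forall>\<^sub>F n in sequentially. c0 \<le> \<alpha> n \<and> 0 \<le> \<alpha> n \<and> \<alpha> n \<le> A"
    using c0(2) ev1
  proof eventually_elim
    case (elim n)
    then show ?case using \<alpha>0[of n] \<alpha>a[of n] by (simp add: A_def)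
  qed
  have evp: "\<forall>\<^sub>F n in sequentially. p n \<le> 1"
  proof -
    have "\<forall>\<^sub>F n in sequentially. a \<le> real n" by real_asymp
    then show ?thesis using ev1
    proof eventually_elim
      case (elim n)
      have "real n ^ 1 \<le> real n ^ (r - 1)" using elim r by (intro power_increasing) auto
      then have "\<alpha> n \<le> real n ^ (r - 1)" using elim(1) \<alpha>a[OF elim(2)] unfolding power_one_right by linarith
      then show ?case using elim by (simp add: p)
    qed
  qed
  obtain cL where cL: "cL > 0" "\<forall>\<^sub>F n in sequentially.
    measure_pmf.prob (rsub (p n) (possible_clauses r {..<n}))
      {X. \<exists>G. muf r G \<and> clauses G \<subseteq> X \<and> excess r G \<ge> int (Suc (Suc k))} \<le> cL / real n ^ Suc k"
    using prob_large_muf[of r \<alpha> a p "Suc k", OF r \<alpha>0 \<alpha>a a p] by blast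
  define D where "D = dense_bound r A (4 * k + 2)"
  define cB where "cB = cL + D"
  define cS where "cS = 4 ^ (4 * k + 2) * D + cB"
  define E where "E n = possible_clauses r {..<n}" for n :: nat
  define P where "P n = measure_pmf.prob (rsub (p n) (E n))" for n
  define U where "U X \<longleftrightarrow> mufs r X \<noteq> {} \<and> (\<forall>G\<in>mufs r X. int k \<le> excess r G)" for X
  define S where "S n \<G> = (\<Sum>G\<in>\<G>. p n ^ card (clauses G))" for n and \<G> :: "nat formula set"
  define lv where "lv n = {G \<in> muf_level r i. vars G \<subseteq> {..<n}}" for n
  define H where "H \<G> = {X. \<exists>G\<in>\<G>. clauses G \<subseteq> X}" for \<G> :: "nat formula set"
  have A1: "A \<ge> 1" by (simp add: A_def)
  have D0: "D \<ge> 0" using A1 by (simp add: D_def dense_bound_def)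
  have finE: "finite (E n)" for n unfolding E_def by (intro finite_possible_clauses) simp
  have Pmono: "P n X \<le> P n Y" if "\<And>Z. Z \<subseteq> E n \<Longrightarrow> Z \<in> X \<Longrightarrow> Z \<in> Y" for n X Y
    unfolding P_def using that by (rule prob_rsub_mono)
  have PUn: "P n (X \<union> Y) \<le> P n X + P n Y" for n X Y
    unfolding P_def by (rule measure_Un_le) auto
  \<comment> \<open>The bad event is smaller by a factor of order \<open>1 / n\<close> than the
    events of interest, whose order is \<open>1 / n ^ k\<close>.\<close>
  define good where "good n \<longleftrightarrow> n \<ge> 1 \<and> p n \<le> 1 \<and> P n (bad_event r n k) \<le> cB / real n ^ Suc k" for n
  have ev_good: "\<forall>\<^sub>F n in sequentially. good n"
    using ev1 ev\<alpha> evp cL(2)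
  proof eventually_elim
    case (elim n)
    have "P n {X. \<exists>Q\<in>dense_sets r (E n) (4 * k + 2) (Suc k). Q \<subseteq> X} \<le> (\<Sum>Q\<in>dense_sets r (E n) (4 * k + 2) (Suc k). p n ^ card Q)"
      unfolding P_def using elim finE by (intro prob_dense_le) (auto simp: p)
    also have "\<dots> \<le> D / real n ^ Suc k"
      unfolding p E_def D_def using r elim A1 by (intro sum_dense_sets_le) auto
    finally have "P n (bad_event r n k) \<le> D / real n ^ Suc k + cL / real n ^ Suc k"
      using PUn[of n "{X. \<exists>Q\<in>dense_sets r (E n) (4 * k + 2) (Suc k). Q \<subseteq> X}"
          "{X. \<exists>G. muf r G \<and> clauses G \<subseteq> X \<and> excess r G \<ge> int (Suc (Suc k))}"] elim(4)
      unfolding bad_event_def P_def E_def by linarith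
    then show ?case using elim by (simp add: good_def cB_def add_divide_distrib add.commute)
  qed
  have unique: "mufs r X = {G} \<and> U X"
    if "X \<subseteq> E n" "X \<notin> bad_event r n k" "G \<in> muf_level r i" "clauses G \<subseteq> X" for X n G
  proof -
    have G: "G \<in> mufs r X" "excess r G = int k"
      using that muf_levelD[OF that(3)] by (auto simp: mufs_def k_def)
    have "mufs r X = {G}" using unique_muf_if_not_bad[OF r _ that(2) G] that(1) by (simp add: E_def)
    then show ?thesis using G by (simp add: U_def)
  qed
  have U_level: "\<exists>G\<in>muf_level r i. mufs r X = {G}" if X: "X \<subseteq> E n" "X \<notin> bad_event r n k" and UX: "U X" for X n
  proof -
    obtain G where G: "G \<in> mufs r X" "int k \<le> excess r G" using UX by (auto simp: U_def)
    have "excess r G \<le> int k" using muf_excess_le_if_not_bad[OF r _ X(2) G(1)] X(1) by (simp add: E_def)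
    then have "excess r G = int k" using G(2) by simp
    then have "G \<in> muf_level r i" "clauses G \<subseteq> X" using G(1) by (auto simp: muf_level_def mufs_def k_def)
    then show ?thesis using unique[OF X] by blast
  qed
  have muf_on: "vars G \<subseteq> {..<n}" if "X \<subseteq> E n" "G \<in> mufs r X" for X n G
    using that cvars_subset[of "clauses G" r "{..<n}"] muf_vars[of r G] by (auto simp: mufs_def E_def)
  have H_bounds: "P n (H \<G>) \<le> S n \<G>" "S n \<G> - 4 ^ (4 * k + 2) * D / real n ^ Suc k \<le> P n (H \<G>)"
    if n: "good n" and G: "\<G> \<subseteq> lv n" for n \<G>
  proof -
    have "muf r G \<and> excess r G = int k \<and> vars G \<subseteq> {..<n}" if "G \<in> \<G>" for G
      using that G by (auto simp: lv_def muf_level_def k_def)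
    then show "P n (H \<G>) \<le> S n \<G>" "S n \<G> - 4 ^ (4 * k + 2) * D / real n ^ Suc k \<le> P n (H \<G>)"
      unfolding P_def H_def S_def D_def E_def
      using n prob_some_muf[OF r _ _ _ A1 p[of n], of \<G> k] \<alpha>0[of n] \<alpha>a[of n] by (auto simp: good_def A_def)
  qed
  \<comment> \<open>An event agreeing with \<open>H \<G>\<close> outside the bad event has the
    expected number of members of \<open>\<G>\<close> present as its probability, up to the stated
    error. This serves the conditioning event and each isomorphism class alike.\<close>
  have sandwich: "\<bar>P n W - S n \<G>\<bar> \<le> cS / real n ^ Suc k"
    if n: "good n" and G: "\<G> \<subseteq> lv n"
      and up: "\<And>X. X \<subseteq> E n \<Longrightarrow> X \<in> W \<Longrightarrow> X \<in> H \<G> \<or> X \<in> bad_event r n k"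
      and low: "\<And>X. X \<subseteq> E n \<Longrightarrow> X \<in> H \<G> \<Longrightarrow> X \<in> W \<or> X \<in> bad_event r n k" for n \<G> W
  proof -
    let ?B = "bad_event r n k"
    have B: "P n ?B \<le> cB / real n ^ Suc k" using n by (simp add: good_def)
    have cS: "cS / real n ^ Suc k = 4 ^ (4 * k + 2) * D / real n ^ Suc k + cB / real n ^ Suc k"
      by (simp add: cS_def add_divide_distrib)
    have D1: "0 \<le> 4 ^ (4 * k + 2) * D / real n ^ Suc k" using D0 by simp
    have "P n W \<le> P n (H \<G> \<union> ?B)" using up by (intro Pmono) auto
    also have "\<dots> \<le> S n \<G> + cB / real n ^ Suc k" using PUn[of n "H \<G>" ?B] H_bounds(1)[OF n G] B by linarith
    finally have 1: "P n W \<le> S n \<G> + cB / real n ^ Suc k" .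
    have "P n (H \<G>) \<le> P n (W \<union> ?B)" using low by (intro Pmono) auto
    also have "\<dots> \<le> P n W + cB / real n ^ Suc k" using PUn[of n W ?B] B by linarith
    finally have "P n (H \<G>) \<le> P n W + cB / real n ^ Suc k" .
    then show ?thesis using 1 H_bounds(2)[OF n G] cS D1 by linarith
  qed
  \<comment> \<open>Multiplication by \<open>n ^ k\<close> leaves the error \<open>cS / n\<close>,
    so probabilities may be replaced by expected counts.\<close>
  have scaled: "(\<lambda>n. real n ^ k * P n (W n) - z n) \<longlonglongrightarrow> 0"
    if W: "\<And>n. good n \<Longrightarrow> \<bar>P n (W n) - S n (\<G> n)\<bar> \<le> cS / real n ^ Suc k"
      and z: "(\<lambda>n. real n ^ k * S n (\<G> n) - z n) \<longlonglongrightarrow> 0" for W \<G> z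
  proof -
    have "(\<lambda>n. real n ^ k * P n (W n) - real n ^ k * S n (\<G> n)) \<longlonglongrightarrow> 0"
    proof (rule Lim_null_comparison)
      show "\<forall>\<^sub>F n in sequentially. norm (real n ^ k * P n (W n) - real n ^ k * S n (\<G> n)) \<le> cS / real n"
        using ev_good
      proof eventually_elim
        case (elim n)
        have "norm (real n ^ k * P n (W n) - real n ^ k * S n (\<G> n)) = real n ^ k * \<bar>P n (W n) - S n (\<G> n)\<bar>"
          by (simp add: abs_mult flip: right_diff_distrib)
        also have "\<dots> \<le> real n ^ k * (cS / real n ^ Suc k)" using W[OF elim] by (intro mult_left_mono) auto
        also have "\<dots> = cS / real n" using elim by (simp add: good_def)
        finally show ?case .
      qed
      show "(\<lambda>n. cS / real n) \<longlonglongrightarrow> 0" by real_asymp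
    qed
    from tendsto_add[OF this z] show ?thesis by simp
  qed
  have S_copies: "(\<lambda>n. real n ^ k * S n (copies n F) - weight (\<alpha> n) F) \<longlonglongrightarrow> 0" if F: "F \<in> muf_level r i" for F
  proof (rule Lim_transform_eventually)
    show "(\<lambda>n. weight (\<alpha> n) F * falling_ratio n (card (vars F)) - weight (\<alpha> n) F) \<longlonglongrightarrow> 0"
      by (rule weight_falling_ratio_tendsto[of _ A]) (use ev\<alpha> in \<open>auto elim: eventually_mono\<close>)
    show "\<forall>\<^sub>F n in sequentially. weight (\<alpha> n) F * falling_ratio n (card (vars F)) - weight (\<alpha> n) F
        = real n ^ k * S n (copies n F) - weight (\<alpha> n) F"
      using ev1
    proof eventually_elim
      case (elim n)
      then show ?case using sum_copies[OF r _ F, of n "\<alpha> n"] by (simp add: S_def p k_def)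
    qed
  qed
  have Z: "total_weight r i b = (\<Sum>K\<in>muf_classes r i. weight b (class_rep K))" for b
    by (simp add: total_weight_def class_rep_def)
  have S_lv: "(\<lambda>n. real n ^ k * S n (lv n) - total_weight r i (\<alpha> n)) \<longlonglongrightarrow> 0"
  proof -
    have "(\<lambda>n. \<Sum>K\<in>muf_classes r i. real n ^ k * S n (copies n (class_rep K)) - weight (\<alpha> n) (class_rep K))
        \<longlonglongrightarrow> (\<Sum>K\<in>muf_classes r i. 0)"
      by (intro tendsto_sum S_copies class_rep(2))
    moreover have "(\<Sum>K\<in>muf_classes r i. real n ^ k * S n (copies n (class_rep K)) - weight (\<alpha> n) (class_rep K))
        = real n ^ k * S n (lv n) - total_weight r i (\<alpha> n)" for n
      unfolding S_def lv_def sum_muf_level_on[OF r] Z by (simp add: sum_subtractf sum_distrib_left)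
    ultimately show ?thesis by simp
  qed
  have w_ge: "\<exists>d>0. \<forall>\<^sub>F n in sequentially. weight (\<alpha> n) F \<ge> d" if F: "F \<in> muf_level r i" for F
  proof -
    obtain d where "d > 0" "\<And>b. b \<ge> c0 \<Longrightarrow> weight b F \<ge> d"
      using weight_ge[OF muf_level_wf[OF F] c0(1)] by blast
    then show ?thesis using ev\<alpha> by (intro exI[of _ d]) (auto elim: eventually_mono)
  qed
  \<comment> \<open>One class suffices, since all weights are nonnegative and
    \<open>\<alpha>\<close> is eventually at least \<open>c0\<close>.\<close>
  obtain \<zeta> where \<zeta>: "\<zeta> > 0" "\<forall>\<^sub>F n in sequentially. total_weight r i (\<alpha> n) \<ge> \<zeta>"
  proof -
    obtain F where F: "F \<in> muf_level r i" using muf_level_nonempty[OF r] by blast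
    define K where "K = muf_iso_rel r i `` {F}"
    have K: "K \<in> muf_classes r i" unfolding K_def muf_classes_eq using F by (rule quotientI)
    obtain d where d: "d > 0" "\<forall>\<^sub>F n in sequentially. weight (\<alpha> n) (class_rep K) \<ge> d"
      using w_ge[OF class_rep(2)[OF K]] by blast
    have "\<forall>\<^sub>F n in sequentially. total_weight r i (\<alpha> n) \<ge> d"
      using d(2) ev\<alpha>
    proof eventually_elim
      case (elim n)
      have "weight (\<alpha> n) (class_rep K) \<le> (\<Sum>K\<in>muf_classes r i. weight (\<alpha> n) (class_rep K))"
        using elim by (intro member_le_sum K finite_muf_classes r) (auto simp: weight_def)
      then show ?case using elim unfolding Z by linarith
    qed
    then show ?thesis using that d(1) by blast
  qed
  \<comment> \<open>Outside the bad event, the conditioning event holds exactly when some MUF of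
    level \<open>i\<close> is present.\<close>
  have evU: "\<bar>P n {X. U X} - S n (lv n)\<bar> \<le> cS / real n ^ Suc k" if "good n" for n
  proof (rule sandwich[OF that order_refl])
    fix X assume X: "X \<subseteq> E n"
    show "X \<in> H (lv n) \<or> X \<in> bad_event r n k" if UX: "X \<in> {X. U X}"
    proof (cases "X \<in> bad_event r n k")
      case False
      then obtain G where G: "G \<in> muf_level r i" "mufs r X = {G}" using U_level[OF X] UX by blast
      then have "G \<in> mufs r X" by simp
      then have "G \<in> lv n" "clauses G \<subseteq> X" using G(1) muf_on[OF X] by (auto simp: lv_def mufs_def)
      then show ?thesis by (auto simp: H_def)
    qed simp
    show "X \<in> {X. U X} \<or> X \<in> bad_event r n k" if "X \<in> H (lv n)"
      using that unique[OF X] by (auto simp: H_def lv_def)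
  qed
  have limU: "(\<lambda>n. real n ^ k * P n {X. U X} - total_weight r i (\<alpha> n)) \<longlonglongrightarrow> 0"
    by (rule scaled[OF evU S_lv])
  have simU: "(\<lambda>n. real n ^ k * P n {X. U X}) \<sim>[sequentially] (\<lambda>n. total_weight r i (\<alpha> n))"
    by (rule asymp_equiv_if_diff_tendsto_0[OF limU \<zeta>])
  have cond: "\<P>(F in measure_pmf (random_sat r n (p n)). \<Phi> (mufs_in r F) \<bar> unsat_from_level r i F)
      = P n {X. \<Phi> (mufs r X) \<and> U X} / P n {X. U X}" for n \<Phi>
  proof -
    have "P n {X. \<Phi> (mufs_in r (Formula {..<n} X)) \<and> unsat_from_level r i (Formula {..<n} X)} = P n {X. \<Phi> (mufs r X) \<and> U X}"
      "P n {X. unsat_from_level r i (Formula {..<n} X)} = P n {X. U X}"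
      unfolding P_def E_def
      by (intro prob_rsub_cong; simp add: mufs_in_eq unsat_from_level_iff U_def k_def)+
    then show ?thesis unfolding cond_prob_random_sat P_def E_def by simp
  qed
  show ?thesis
  proof (intro conjI ballI)
    fix F' assume F': "F' \<in> muf_level r i"
    let ?W = "{X. (\<exists>F0. mufs r X = {F0} \<and> isomorphic F0 F') \<and> U X}"
    have wfF': "wf_formula F'" using F' by (rule muf_level_wf)
    have "\<bar>P n ?W - S n (copies n F')\<bar> \<le> cS / real n ^ Suc k" if "good n" for n
    proof (rule sandwich[OF that])
      show "copies n F' \<subseteq> lv n" using copies_muf_level[OF F'] by (simp add: lv_def)
      fix X assume X: "X \<subseteq> E n"
      show "X \<in> H (copies n F') \<or> X \<in> bad_event r n k" if W: "X \<in> ?W"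
      proof -
        obtain F0 where F0: "F0 \<in> mufs r X" "isomorphic F0 F'" using W by auto
        then have "wf_formula F0" using muf_imp_wf by (auto simp: mufs_def)
        then have "isomorphic F' F0" using isomorphic_sym F0(2) by blast
        then have "F0 \<in> copies n F'" using muf_on[OF X F0(1)] by (simp add: copies_def)
        then show ?thesis using F0(1) by (auto simp: H_def mufs_def)
      qed
      show "X \<in> ?W \<or> X \<in> bad_event r n k" if HX: "X \<in> H (copies n F')"
      proof (cases "X \<in> bad_event r n k")
        case False
        obtain G where G: "isomorphic F' G" "clauses G \<subseteq> X" using HX by (auto simp: H_def copies_def)
        have "mufs r X = {G} \<and> U X" using unique[OF X False isomorphic_muf_level[OF F' G(1)] G(2)] .
        moreover have "isomorphic G F'" by (rule isomorphic_sym[OF wfF' G(1)])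
        ultimately show ?thesis by blast
      qed simp
    qed
    from scaled[OF this S_copies[OF F']]
    have "(\<lambda>n. real n ^ k * P n ?W - weight (\<alpha> n) F') \<longlonglongrightarrow> 0" .
    moreover obtain d where "d > 0" "\<forall>\<^sub>F n in sequentially. weight (\<alpha> n) F' \<ge> d"
      using w_ge[OF F'] by blast
    ultimately have "(\<lambda>n. real n ^ k * P n ?W) \<sim>[sequentially] (\<lambda>n. weight (\<alpha> n) F')"
      by (rule asymp_equiv_if_diff_tendsto_0)
    then have lim: "(\<lambda>n. (real n ^ k * P n ?W) / (real n ^ k * P n {X. U X}))
        \<sim>[sequentially] (\<lambda>n. weight (\<alpha> n) F' / total_weight r i (\<alpha> n))"
      using simU by (rule asymp_equiv_intros)
    have "\<forall>\<^sub>F n in sequentially. (real n ^ k * P n ?W) / (real n ^ k * P n {X. U X})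
        = P n ?W / P n {X. U X}"
      using ev1 by eventually_elim simp
    from iffD1[OF asymp_equiv_cong[OF this always_eventually[OF allI[OF refl]]] lim]
    show "(\<lambda>n. \<P>(F in measure_pmf (random_sat r n (p n)).
              (\<exists>F0. mufs_in r F = {F0} \<and> isomorphic F0 F') \<bar> unsat_from_level r i F))
            \<sim>[sequentially] (\<lambda>n. weight (\<alpha> n) F' / total_weight r i (\<alpha> n))"
      unfolding cond[of _ "\<lambda>M. \<exists>F0. M = {F0} \<and> isomorphic F0 F'"] .
  next
    let ?W = "{X. (\<exists>F0. mufs r X = {F0} \<and> F0 \<in> muf_level r i) \<and> U X}"
    have "\<forall>\<^sub>F n in sequentially. norm (real n ^ k * P n {X. U X} - total_weight r i (\<alpha> n)) < \<zeta> / 2"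
      using tendstoD[OF limU, of "\<zeta> / 2"] \<zeta>(1) by (simp add: dist_norm)
    then have "\<forall>\<^sub>F n in sequentially. norm (1 - P n ?W / P n {X. U X}) \<le> (2 * cB / \<zeta>) * norm (1 / real n)"
      using \<zeta>(2) ev_good
    proof eventually_elim
      case (elim n)
      have n: "n \<ge> 1" using elim(3) by (simp add: good_def)
      have "\<zeta> / 2 \<le> real n ^ k * P n {X. U X}" using elim(1,2) unfolding real_norm_def by linarith
      then have lowU: "\<zeta> / 2 / real n ^ k \<le> P n {X. U X}" using n by (simp add: field_simps)
      moreover have "0 < \<zeta> / 2 / real n ^ k" using \<zeta>(1) n by simp
      ultimately have U0: "P n {X. U X} > 0" by linarith
      have "P n {X. U X} \<le> P n (?W \<union> bad_event r n k)"
      proof (rule Pmono)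
        fix X assume X: "X \<subseteq> E n" "X \<in> {X. U X}"
        then show "X \<in> ?W \<union> bad_event r n k"
          using U_level[OF X(1)] by (cases "X \<in> bad_event r n k") auto
      qed
      also have "\<dots> \<le> P n ?W + cB / real n ^ Suc k" using PUn[of n ?W "bad_event r n k"] elim(3) by (simp add: good_def)
      finally have d: "P n {X. U X} - P n ?W \<le> cB / real n ^ Suc k" by simp
      have "P n ?W \<le> P n {X. U X}" by (intro Pmono) auto
      then have "norm (1 - P n ?W / P n {X. U X}) = (P n {X. U X} - P n ?W) / P n {X. U X}"
        using U0 by (simp add: field_simps)
      also have "\<dots> \<le> (cB / real n ^ Suc k) / (\<zeta> / 2 / real n ^ k)"
        using d lowU U0 \<zeta>(1) n cL(1) D0 by (intro frac_le) (auto simp: cB_def)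
      also have "\<dots> = (2 * cB / \<zeta>) * norm (1 / real n)" using n by (simp add: mult_ac)
      finally show ?case .
    qed
    then show "(\<lambda>n. 1 - \<P>(F in measure_pmf (random_sat r n (p n)).
              (\<exists>F0. mufs_in r F = {F0} \<and> F0 \<in> muf_level r i) \<bar> unsat_from_level r i F))
           \<in> O(\<lambda>n. 1 / real n)"
      unfolding cond[of _ "\<lambda>M. \<exists>F0. M = {F0} \<and> F0 \<in> muf_level r i"]
      by (rule bigoI)
  qed
qed

end
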